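(* Let $G$ and $\tilde G$ be two semi-simple real forms, with Lie algebras $\mathfrak g$ and $\tilde{\mathfrak g}$, of a complex semi-simple Lie group $G^{\mathbb C}$, and suppose that $(\mathfrak g,\tilde{\mathfrak g},\mathfrak u)$ is a compatible triple of semi-simple Lie algebras. Let $U$ be the compact real form of $G^{\mathbb C}$ with Lie algebra $\mathfrak u$, and $K\subset G$, $\tilde K\subset\tilde G$ the associated maximal compact subgroups, $K,\tilde K\subset U$. Let $\rho: G\to GL(V)$ and $\tilde\rho:\tilde G\to GL(\tilde V)$ be real representations having the same complexified action $\rho^{\mathbb C}:G^{\mathbb C}\to GL(V^{\mathbb C})$, where $V$ and $\tilde V$ are compatible real forms of $V^{\mathbb C}$. Let $v\in V$ and $\tilde v\in\tilde V$. Then: (1) Suppose $\tilde v\in G^{\mathbb C}v$. If $v\in\mathcal M(G,V)$ and $\tilde v\in\mathcal M(\tilde G,\tilde V)$ are minimal vectors, then $Uv=U\tilde v$, i.e. $Kv,\tilde K\tilde v\subset Uv$. (2) If $\tilde G=U$ is the compact real form compatible with $G$, then $$Gv\subset G^{\mathbb C}v \text{ and } \tilde G\tilde v\subset G^{\mathbb C}v \iff Gv\cap\tilde G\tilde v\neq\emptyset .$$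
   Context: All groups are semi-simple with finitely many connected components. Real forms. A real form of a complex vector space $E$ is a real subspace $W$ with $E=W\oplus iW$; its conjugation map is the antilinear involution of $E$ with fixed-point set $W$. For Lie algebras the real form is a real Lie subalgebra. Two real forms are compatible if their conjugation maps commute. A real Lie subgroup $G$ of a complex Lie group $G^{\mathbb C}$ is a real form if its Lie algebra $\mathfrak g$ is a real form of the Lie algebra $\mathfrak g^{\mathbb C}$ of $G^{\mathbb C}$ and $G^{\mathbb C}=G\,G^{\mathbb C}_0$, with $G^{\mathbb C}_0$ the identity component. A compatible triple $(\mathfrak g,\tilde{\mathfrak g},\mathfrak u)$ of semi-simple Lie algebras consists of three pairwise compatible real forms of the complex semi-simple Lie algebra $\mathfrak g^{\mathbb C}$ with $\mathfrak u$ compact. It gives Cartan decompositions $\mathfrak g=\mathfrak t\oplus\mathfrak p$, $\mathfrak t=\mathfrak g\cap\mathfrak u$, $\mathfrak p=\mathfrak g\cap i\mathfrak u$, and $\tilde{\mathfrak g}=\tilde{\mathfrak t}\oplus\tilde{\mathfrak p}$ similarly, with $\mathfrak u=\mathfrak t\oplus i\mathfrak p=\tilde{\mathfrak t}\oplus i\tilde{\mathfrak p}$. The corresponding global Cartan decompositions are $G=Ke^{\mathfrak p}$, $\tilde G=\tilde Ke^{\tilde{\mathfrak p}}$, $G^{\mathbb C}=Ue^{i\mathfrak u}$, where $K,\tilde K,U$ are the maximal compact subgroups with Lie algebras $\mathfrak t,\tilde{\mathfrak t},\mathfrak u$, and $K,\tilde K\subset U$. Complexified action. A holomorphic representation $\rho^{\mathbb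 C}:G^{\mathbb C}\to GL(V^{\mathbb C})$ is a complexified action of $\rho:G\to GL(V)$ if $V$ is a real form of $V^{\mathbb C}$ and $\rho^{\mathbb C}(g)|_V=\rho(g)$ for all $g\in G$; likewise for $\tilde\rho$ and $\tilde V$. Orbits $Gv$, $G^{\mathbb C}v$, etc. are with respect to these actions, inside $V^{\mathbb C}$. Minimal vectors. Fix a $U$-invariant Hermitian inner product on $V^{\mathbb C}$ which is real-valued on $V$ and on $\tilde V$ (such an inner product exists), and let $\|\cdot\|$ be its norm, restricted to $V$ and $\tilde V$ as needed. For a group $H$ acting on $X$ (with $(H,X)=(G,V)$, $(\tilde G,\tilde V)$ or $(G^{\mathbb C},V^{\mathbb C})$), the set of minimal vectors is $\mathcal M(H,X)=\{x\in X:\ \|h\cdot x\|\ge\|x\|\ \ \forall h\in H\}$. *)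

theory Defs
  imports "HOL-Analysis.Analysis" "HOL-Algebra.Coset"
begin

section \<open>Complex Lie groups\<close>

text \<open>
  A function on an open subset of a finite-dimensional complex vector space is holomorphic iff it
  is Frechet differentiable with complex-linear derivative.  A real-linear map is complex-linear
  iff it commutes with multiplication by the imaginary unit, written \<open>J\<close> on the source
  and \<open>J'\<close> on the target; this form also covers functions on products.
\<close>

definition holo_on ::
    "('a::real_normed_vector \<Rightarrow> 'a) \<Rightarrow> ('b::real_normed_vector \<Rightarrow> 'b) \<Rightarrow> 'a set \<Rightarrow> ('a \<Rightarrow> 'b) \<Rightarrow> bool" where
  "holo_on J J' S f \<longleftrightarrow>
     open S \<and> (\<forall>x\<in>S. \<exists>f'. (f has_derivative f') (at x) \<and> (\<forall>v. f' (J v) = J' (f' v)))"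

abbreviation im_unit :: "complex^'n \<Rightarrow> complex^'n" where
  "im_unit x \<equiv> \<i> *s x"

text \<open>
  A chart is a pair of an open domain and a coordinate function; the values of the coordinate
  function outside of the domain are irrelevant.
\<close>

record ('g, 'n) lie_data = "'g monoid" +
  gtop :: "'g topology"
  charts :: "('g set \<times> ('g \<Rightarrow> complex^'n)) set"

definition complex_atlas :: "'g topology \<Rightarrow> ('g set \<times> ('g \<Rightarrow> complex^'n)) set \<Rightarrow> bool" where
  "complex_atlas T A \<longleftrightarrow>
     (\<Union>(D, \<phi>)\<in>A. D) = topspace T \<and>
     (\<forall>(D, \<phi>)\<in>A. openin T D \<and> open (\<phi> ` D) \<and>
        homeomorphic_map (subtopology T D) (top_of_set (\<phi> ` D)) \<phi>) \<and>
     (\<forall>(D, \<phi>)\<in>A. \<forall>(D', \<phi>')\<in>A.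
        holo_on im_unit im_unit (\<phi> ` (D \<inter> D')) (\<lambda>x. \<phi>' (inv_into D \<phi> x)))"

definition complex_lie_group :: "('g, 'n::finite) lie_data \<Rightarrow> bool" where
  "complex_lie_group L \<longleftrightarrow>
     group L \<and>
     topspace (gtop L) = carrier L \<and> Hausdorff_space (gtop L) \<and> second_countable (gtop L) \<and>
     complex_atlas (gtop L) (charts L) \<and>
     continuous_map (prod_topology (gtop L) (gtop L)) (gtop L) (\<lambda>(x, y). x \<otimes>\<^bsub>L\<^esub> y) \<and>
     continuous_map (gtop L) (gtop L) (\<lambda>x. inv\<^bsub>L\<^esub> x) \<and>
     (\<forall>(D, \<phi>)\<in>charts L. \<forall>(D', \<phi>')\<in>charts L. \<forall>(D'', \<phi>'')\<in>charts L.
        holo_on (map_prod im_unit im_unit) im_unit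
          {(\<phi> x, \<phi>' y) | x y. x \<in> D \<and> y \<in> D' \<and> x \<otimes>\<^bsub>L\<^esub> y \<in> D''}
          (\<lambda>(a, b). \<phi>'' (inv_into D \<phi> a \<otimes>\<^bsub>L\<^esub> inv_into D' \<phi>' b))) \<and>
     (\<forall>(D, \<phi>)\<in>charts L. \<forall>(D', \<phi>')\<in>charts L.
        holo_on im_unit im_unit {\<phi> x | x. x \<in> D \<and> inv\<^bsub>L\<^esub> x \<in> D'}
          (\<lambda>a. \<phi>' (inv\<^bsub>L\<^esub> (inv_into D \<phi> a))))"

section \<open>The Lie algebra of a group and of its subgroups\<close>

text \<open>
  The Lie algebra of \<open>L\<close> is the tangent space at the identity, identified with
  \<open>complex^'n\<close> through an arbitrary but fixed chart around the identity (another
  choice gives an isomorphic Lie algebra).  The bracket of \<open>X\<close> and \<open>Y\<close> is the value at the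
  identity of the Lie bracket \<open>(D Y)(X) - (D X)(Y)\<close> of the left-invariant vector fields that
  extend them, computed in this chart.
\<close>

definition id_chart :: "('g, 'n::finite) lie_data \<Rightarrow> 'g set \<times> ('g \<Rightarrow> complex^'n)" where
  "id_chart L = (SOME c. c \<in> charts L \<and> \<one>\<^bsub>L\<^esub> \<in> fst c)"

definition coord :: "('g, 'n::finite) lie_data \<Rightarrow> 'g \<Rightarrow> complex^'n" where
  "coord L = snd (id_chart L)"

definition uncoord :: "('g, 'n::finite) lie_data \<Rightarrow> complex^'n \<Rightarrow> 'g" where
  "uncoord L = inv_into (fst (id_chart L)) (coord L)"

definition left_inv_field :: "('g, 'n::finite) lie_data \<Rightarrow> complex^'n \<Rightarrow> complex^'n \<Rightarrow> complex^'n" where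
  "left_inv_field L X a =
     frechet_derivative (\<lambda>b. coord L (uncoord L a \<otimes>\<^bsub>L\<^esub> uncoord L b)) (at (coord L \<one>\<^bsub>L\<^esub>)) X"

definition lie_bracket :: "('g, 'n::finite) lie_data \<Rightarrow> complex^'n \<Rightarrow> complex^'n \<Rightarrow> complex^'n" where
  "lie_bracket L X Y =
     frechet_derivative (left_inv_field L Y) (at (coord L \<one>\<^bsub>L\<^esub>)) X
     - frechet_derivative (left_inv_field L X) (at (coord L \<one>\<^bsub>L\<^esub>)) Y"

text \<open>
  \<open>one_param L \<gamma> X\<close> says that \<open>\<gamma> t = exp (t X)\<close>.  Hence the Lie algebra of a closed subgroup
  \<open>H\<close> below is the set of all \<open>X\<close> with \<open>exp (t X) \<in> H\<close> for all real \<open>t\<close>.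
\<close>

definition one_param :: "('g, 'n::finite) lie_data \<Rightarrow> (real \<Rightarrow> 'g) \<Rightarrow> complex^'n \<Rightarrow> bool" where
  "one_param L \<gamma> X \<longleftrightarrow>
     continuous_map euclideanreal (gtop L) \<gamma> \<and>
     (\<forall>s t. \<gamma> (s + t) = \<gamma> s \<otimes>\<^bsub>L\<^esub> \<gamma> t) \<and>
     ((\<lambda>t. coord L (\<gamma> t)) has_vector_derivative X) (at 0)"

definition lie_algebra :: "('g, 'n::finite) lie_data \<Rightarrow> 'g set \<Rightarrow> (complex^'n) set" where
  "lie_algebra L H = {X. \<exists>\<gamma>. one_param L \<gamma> X \<and> (\<forall>t. \<gamma> t \<in> H)}"

section \<open>Semisimple and compact Lie algebras\<close>

text \<open>
  The scalar multiplication \<open>s\<close> is a parameter, so that the same notions serve for complex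
  Lie algebras and for real subalgebras of them.
\<close>

definition lie_ideal ::
    "('k::comm_ring_1 \<Rightarrow> 'v::ab_group_add \<Rightarrow> 'v) \<Rightarrow> ('v \<Rightarrow> 'v \<Rightarrow> 'v) \<Rightarrow> 'v set \<Rightarrow> 'v set \<Rightarrow> bool" where
  "lie_ideal s br \<aa> I \<longleftrightarrow>
     module.subspace s I \<and> I \<subseteq> \<aa> \<and> (\<forall>x\<in>\<aa>. \<forall>y\<in>I. br x y \<in> I)"

primrec derived_series ::
    "('k::comm_ring_1 \<Rightarrow> 'v::ab_group_add \<Rightarrow> 'v) \<Rightarrow> ('v \<Rightarrow> 'v \<Rightarrow> 'v) \<Rightarrow> 'v set \<Rightarrow> nat \<Rightarrow> 'v set" where
  "derived_series s br I 0 = I"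
| "derived_series s br I (Suc k) =
     module.span s {br x y | x y. x \<in> derived_series s br I k \<and> y \<in> derived_series s br I k}"

definition semisimple_lie_algebra ::
    "('k::comm_ring_1 \<Rightarrow> 'v::ab_group_add \<Rightarrow> 'v) \<Rightarrow> ('v \<Rightarrow> 'v \<Rightarrow> 'v) \<Rightarrow> 'v set \<Rightarrow> bool" where
  "semisimple_lie_algebra s br \<aa> \<longleftrightarrow>
     (\<forall>I. lie_ideal s br \<aa> I \<and> (\<exists>k. derived_series s br I k = {0}) \<longrightarrow> I = {0})"

definition real_trace_on :: "'v::real_vector set \<Rightarrow> ('v \<Rightarrow> 'v) \<Rightarrow> real" where
  "real_trace_on W f =
     (let B = (SOME B. independent B \<and> span B = W) in \<Sum>b\<in>B. representation B (f b) b)"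

definition killing_form :: "('v \<Rightarrow> 'v \<Rightarrow> 'v) \<Rightarrow> 'v::real_vector set \<Rightarrow> 'v \<Rightarrow> 'v \<Rightarrow> real" where
  "killing_form br W X Y = real_trace_on W (\<lambda>Z. br X (br Y Z))"

text \<open>A semisimple real Lie algebra is compact iff its Killing form is negative definite.\<close>

definition compact_lie_algebra :: "('v \<Rightarrow> 'v \<Rightarrow> 'v) \<Rightarrow> 'v::real_vector set \<Rightarrow> bool" where
  "compact_lie_algebra br W \<longleftrightarrow> (\<forall>X\<in>W. X \<noteq> 0 \<longrightarrow> killing_form br W X X < 0)"

section \<open>Real forms\<close>

definition real_form :: "(complex^'n) set \<Rightarrow> bool" where
  "real_form W \<longleftrightarrow>
     subspace W \<and> W \<inter> im_unit ` W = {0} \<and> {a + im_unit b | a b. a \<in> W \<and> b \<in> W} = UNIV"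

definition conjugation :: "(complex^'n) set \<Rightarrow> complex^'n \<Rightarrow> complex^'n" where
  "conjugation W = (THE \<tau>.
     (\<forall>x y. \<tau> (x + y) = \<tau> x + \<tau> y) \<and> (\<forall>c x. \<tau> (c *s x) = cnj c *s \<tau> x) \<and>
     (\<forall>x. \<tau> (\<tau> x) = x) \<and> {x. \<tau> x = x} = W)"

definition compatible_real_forms :: "(complex^'n) set \<Rightarrow> (complex^'n) set \<Rightarrow> bool" where
  "compatible_real_forms W W' \<longleftrightarrow>
     real_form W \<and> real_form W' \<and> conjugation W \<circ> conjugation W' = conjugation W' \<circ> conjugation W"

definition real_form_lie_algebra ::
    "(complex^'n \<Rightarrow> complex^'n \<Rightarrow> complex^'n) \<Rightarrow> (complex^'n) set \<Rightarrow> bool" where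
  "real_form_lie_algebra br \<aa> \<longleftrightarrow> real_form \<aa> \<and> (\<forall>x\<in>\<aa>. \<forall>y\<in>\<aa>. br x y \<in> \<aa>)"

definition compatible_triple ::
    "(complex^'n \<Rightarrow> complex^'n \<Rightarrow> complex^'n) \<Rightarrow>
     (complex^'n) set \<Rightarrow> (complex^'n) set \<Rightarrow> (complex^'n) set \<Rightarrow> bool" where
  "compatible_triple br \<gg> \<gg>' \<uu> \<longleftrightarrow>
     (\<forall>\<aa>\<in>{\<gg>, \<gg>', \<uu>}. real_form_lie_algebra br \<aa> \<and> semisimple_lie_algebra (*\<^sub>R) br \<aa>) \<and>
     compatible_real_forms \<gg> \<gg>' \<and> compatible_real_forms \<gg> \<uu> \<and> compatible_real_forms \<gg>' \<uu> \<and>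
     compact_lie_algebra br \<uu>"

definition finitely_many_components :: "'g topology \<Rightarrow> bool" where
  "finitely_many_components T \<longleftrightarrow> finite (connected_components_of T)"

definition semisimple_complex_lie_group :: "('g, 'n::finite) lie_data \<Rightarrow> bool" where
  "semisimple_complex_lie_group L \<longleftrightarrow>
     complex_lie_group L \<and> finitely_many_components (gtop L) \<and>
     semisimple_lie_algebra (*s) (lie_bracket L) UNIV"

text \<open>
  Real Lie subgroups are closed subgroups.  For the subgroups considered here this loses nothing:
  if the Lie algebra of an immersed Lie subgroup is a semisimple real form, then the identity
  component of that subgroup is the identity component of the (closed) normalizer of this Lie
  algebra, so with finitely many components the subgroup is closed.
\<close>

definition semisimple_real_form_group :: "('g, 'n::finite) lie_data \<Rightarrow> 'g set \<Rightarrow> bool" where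
  "semisimple_real_form_group L H \<longleftrightarrow>
     subgroup H L \<and> closedin (gtop L) H \<and>
     finitely_many_components (subtopology (gtop L) H) \<and>
     real_form_lie_algebra (lie_bracket L) (lie_algebra L H) \<and>
     semisimple_lie_algebra (*\<^sub>R) (lie_bracket L) (lie_algebra L H) \<and>
     carrier L = H <#>\<^bsub>L\<^esub> connected_component_of_set (gtop L) \<one>\<^bsub>L\<^esub>"

definition compact_subgroup :: "('g, 'n::finite) lie_data \<Rightarrow> 'g set \<Rightarrow> bool" where
  "compact_subgroup L H \<longleftrightarrow> subgroup H L \<and> compactin (gtop L) H"

text \<open>
  \<open>K\<close> is the maximal compact subgroup of \<open>G\<close> associated with the compact real form \<open>U\<close>.
\<close>

definition associated_maximal_compact :: "('g, 'n::finite) lie_data \<Rightarrow> 'g set \<Rightarrow> 'g set \<Rightarrow> 'g set \<Rightarrow> bool" where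
  "associated_maximal_compact L G U K \<longleftrightarrow>
     compact_subgroup L K \<and> K \<subseteq> G \<and> K \<subseteq> U \<and>
     (\<forall>K'. compact_subgroup L K' \<and> K \<subseteq> K' \<and> K' \<subseteq> G \<longrightarrow> K' = K) \<and>
     lie_algebra L K = lie_algebra L G \<inter> lie_algebra L U"

section \<open>Representations, orbits and minimal vectors\<close>

definition holomorphic_rep :: "('g, 'n::finite) lie_data \<Rightarrow> ('g \<Rightarrow> complex^'m \<Rightarrow> complex^'m) \<Rightarrow> bool" where
  "holomorphic_rep L \<rho> \<longleftrightarrow>
     (\<forall>g\<in>carrier L. Vector_Spaces.linear (*s) (*s) (\<rho> g) \<and> bij (\<rho> g)) \<and>
     (\<forall>g\<in>carrier L. \<forall>h\<in>carrier L. \<rho> (g \<otimes>\<^bsub>L\<^esub> h) = \<rho> g \<circ> \<rho> h) \<and>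
     (\<forall>(D, \<phi>)\<in>charts L. \<forall>x. holo_on im_unit im_unit (\<phi> ` D) (\<lambda>a. \<rho> (inv_into D \<phi> a) x))"

text \<open>Only the values of \<open>\<rho> g\<close> on \<open>V\<close>, for \<open>g \<in> H\<close>, matter.\<close>

definition real_rep ::
    "('g, 'n::finite) lie_data \<Rightarrow> 'g set \<Rightarrow> 'v::real_normed_vector set \<Rightarrow> ('g \<Rightarrow> 'v \<Rightarrow> 'v) \<Rightarrow> bool" where
  "real_rep L H V \<rho> \<longleftrightarrow>
     (\<forall>g\<in>H. bij_betw (\<rho> g) V V \<and>
        (\<forall>x\<in>V. \<forall>y\<in>V. \<rho> g (x + y) = \<rho> g x + \<rho> g y) \<and>
        (\<forall>c. \<forall>x\<in>V. \<rho> g (c *\<^sub>R x) = c *\<^sub>R \<rho> g x)) \<and>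
     (\<forall>g\<in>H. \<forall>h\<in>H. \<forall>x\<in>V. \<rho> (g \<otimes>\<^bsub>L\<^esub> h) x = \<rho> g (\<rho> h x)) \<and>
     (\<forall>x\<in>V. continuous_map (subtopology (gtop L) H) euclidean (\<lambda>g. \<rho> g x))"

definition complexified_action ::
    "('g, 'n::finite) lie_data \<Rightarrow> 'g set \<Rightarrow> (complex^'m) set \<Rightarrow> ('g \<Rightarrow> complex^'m \<Rightarrow> complex^'m) \<Rightarrow>
     ('g \<Rightarrow> complex^'m \<Rightarrow> complex^'m) \<Rightarrow> bool" where
  "complexified_action L H V \<rho> \<rho>C \<longleftrightarrow>
     holomorphic_rep L \<rho>C \<and> real_form V \<and> (\<forall>g\<in>H. \<forall>x\<in>V. \<rho>C g x = \<rho> g x)"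

definition orbit :: "('g \<Rightarrow> 'v \<Rightarrow> 'v) \<Rightarrow> 'g set \<Rightarrow> 'v \<Rightarrow> 'v set" where
  "orbit \<rho> H x = (\<lambda>g. \<rho> g x) ` H"

definition hermitian_inner :: "(complex^'m \<Rightarrow> complex^'m \<Rightarrow> complex) \<Rightarrow> bool" where
  "hermitian_inner h \<longleftrightarrow>
     (\<forall>x y z. h (x + y) z = h x z + h y z) \<and> (\<forall>c x y. h (c *s x) y = c * h x y) \<and>
     (\<forall>x y. h y x = cnj (h x y)) \<and> (\<forall>x. x \<noteq> 0 \<longrightarrow> 0 < Re (h x x))"

definition hnorm :: "(complex^'m \<Rightarrow> complex^'m \<Rightarrow> complex) \<Rightarrow> complex^'m \<Rightarrow> real" where
  "hnorm h x = sqrt (Re (h x x))"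

definition minimal_vectors :: "('v \<Rightarrow> real) \<Rightarrow> ('g \<Rightarrow> 'v \<Rightarrow> 'v) \<Rightarrow> 'g set \<Rightarrow> 'v set \<Rightarrow> 'v set" where
  "minimal_vectors N \<rho> H X = {x \<in> X. \<forall>g\<in>H. N (\<rho> g x) \<ge> N x}"

end

theory Submission
  imports Defs
begin

text \<open>
  Choose an orthonormal frame for \<open>Re h\<close>, so that \<open>\<rho>C\<close> becomes a homomorphism \<open>r\<close> into real matrices
  with \<open>r U\<close> orthogonal, and let \<open>M = dr (UNIV)\<close> be the tangent space of its image, which is closed under
  transposition because \<open>\<uu>\<close> is a real form.  The core is the Cartan decomposition on the level of
  matrices: every \<open>r g\<close> is \<open>u exp Z\<close> with \<open>u \<in> r U\<close> and \<open>Z \<in> M\<close> symmetric.  It is proved by following the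
  polar decomposition along a curve tangent to the group; the set of all \<open>g\<close> that admit the
  decomposition is therefore open and closed.

  A minimal vector \<open>v \<in> V\<close> of \<open>G\<close> is critical, i.e. \<open>\<langle>Z v, v\<rangle> = 0\<close> for all symmetric \<open>Z \<in> M\<close>: one splits \<open>Z\<close>
  under the conjugation \<open>\<sigma>\<close> of \<open>V\<close>.  For critical \<open>x\<close> the inequality \<open>exp Z \<ge> 1 + Z\<close> gives
  \<open>|exp Z x - x|\<^sup>2 \<le> |exp Z x|\<^sup>2 - |x|\<^sup>2\<close>, so two critical vectors in one orbit of \<open>G\<^sup>C\<close> lie in one orbit
  of \<open>U\<close>, which is (1).  For (2), \<open>v'\<close> is critical as \<open>U\<close> acts isometrically; the positive matrices at which
  \<open>P \<mapsto> \<langle>P v, v\<rangle>\<close> attains its minimum on the orbit form a geodesically convex set stable under \<open>\<sigma>\<close>,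
  and a \<open>\<sigma>\<close>-fixed one comes from an element of \<open>G\<close> that moves \<open>v\<close> into the orbit of \<open>v'\<close> under \<open>U\<close>.
\<close>

section \<open>Real square matrices as a Euclidean algebra\<close>

text \<open>The hard point in following the polar decomposition is that the logarithm
  \<open>Z\<close> of \<open>adj (r g) * r g\<close> lies in \<open>M\<close>: the image of
  \<open>r\<close> is seen only through curves, and nothing says that it is closed or cut out by
  polynomials. What rescues the argument is that symmetric matrices have real eigenvalues, so that
  bracketing with \<open>Z\<close> and conjugating by \<open>exp Z\<close> have the same invariant
  subspaces. Conjugation preserves \<open>M\<close>, hence so does the bracket, and this forces the
  component \<open>C\<close> of \<open>Z\<close> orthogonal to \<open>M\<close> to centralize
  \<open>M\<close>. Such a component is excluded by a weighted logarithm of determinants that is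
  constant along curves tangent to \<open>M\<close>. The orthogonal factor then has its velocity in
  the skew part of \<open>M\<close>, and a distance argument keeps it in the compact group
  \<open>r U\<close>. In (2) a minimizer fixed by \<sigma> is wanted because a symmetric element of
  \<open>M\<close> fixed by \<sigma> comes from the Lie algebra of \<open>G\<close>, whereas the
  polar factor of an arbitrary group element need not.\<close>

typedef 'k mtx = "UNIV :: (real^'k^'k) set"
  morphisms entries Mtx ..

setup_lifting type_definition_mtx

instantiation mtx :: (finite) real_vector
begin

lift_definition zero_mtx :: "'a mtx" is 0 .
lift_definition plus_mtx :: "'a mtx \<Rightarrow> 'a mtx \<Rightarrow> 'a mtx" is "(+)" .
lift_definition minus_mtx :: "'a mtx \<Rightarrow> 'a mtx \<Rightarrow> 'a mtx" is "(-)" .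
lift_definition uminus_mtx :: "'a mtx \<Rightarrow> 'a mtx" is "uminus" .
lift_definition scaleR_mtx :: "real \<Rightarrow> 'a mtx \<Rightarrow> 'a mtx" is "scaleR" .

instance
  by standard (transfer; simp add: algebra_simps)+

end

instantiation mtx :: (finite) real_inner
begin

lift_definition inner_mtx :: "'a mtx \<Rightarrow> 'a mtx \<Rightarrow> real" is "inner" .
definition norm_mtx :: "'a mtx \<Rightarrow> real" where "norm_mtx A = sqrt (inner A A)"
definition dist_mtx :: "'a mtx \<Rightarrow> 'a mtx \<Rightarrow> real" where "dist_mtx A B = norm (A - B)"
definition sgn_mtx :: "'a mtx \<Rightarrow> 'a mtx" where "sgn_mtx A = A /\<^sub>R norm A"
definition uniformity_mtx :: "('a mtx \<times> 'a mtx) filter"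
  where "uniformity_mtx = (INF e\<in>{0<..}. principal {(x, y). dist x y < e})"
definition open_mtx :: "'a mtx set \<Rightarrow> bool"
  where "open_mtx U \<longleftrightarrow> (\<forall>x\<in>U. eventually (\<lambda>(x', y). x' = x \<longrightarrow> y \<in> U) uniformity)"

instance
proof
  fix A B C :: "'a mtx" and r :: real
  show "inner A B = inner B A" by transfer (rule inner_commute)
  show "inner (A + B) C = inner A C + inner B C" by transfer (rule inner_add_left)
  show "inner (r *\<^sub>R A) B = r * inner A B" by transfer simp
  show "0 \<le> inner A A" by transfer simp
  show "inner A A = 0 \<longleftrightarrow> A = 0" by transfer simp
qed (rule norm_mtx_def dist_mtx_def sgn_mtx_def uniformity_mtx_def open_mtx_def)+

end

lemma norm_mtx_entries: "norm A = norm (entries A)"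
  by (simp add: norm_mtx_def inner_mtx.rep_eq norm_eq_sqrt_inner)

text \<open>Subspaces of matrices thereby become closed and get orthogonal complements for the trace
  form; both are used for the tangent space of the group.\<close>

instantiation mtx :: (finite) euclidean_space
begin

lift_definition Basis_mtx :: "'a mtx set" is "Basis" .

instance
proof
  show "(Basis :: 'a mtx set) \<noteq> {}" "finite (Basis :: 'a mtx set)"
    by (transfer, simp)+
  show "inner u v = (if u = v then 1 else 0)" if "u \<in> Basis" "v \<in> Basis" for u v :: "'a mtx"
    using that by transfer (simp add: inner_Basis)
  show "(\<forall>u\<in>Basis. inner x u = 0) \<longleftrightarrow> x = 0" for x :: "'a mtx"
    by transfer (simp add: euclidean_all_zero_iff)
qed

end

text \<open>Cauchy-Schwarz for each row against each column, summed over all entries.\<close>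

lemma norm_matrix_mult_le:
  fixes A B :: "real^'k::finite^'k"
  shows "norm (A ** B) \<le> norm A * norm B"
proof -
  have sq: "(norm C)\<^sup>2 = (\<Sum>i\<in>UNIV. \<Sum>j\<in>UNIV. (C $ i $ j)\<^sup>2)" for C :: "real^'k^'k"
    unfolding power2_norm_eq_inner by (simp add: inner_vec_def power2_eq_square)
  have "(norm (A ** B))\<^sup>2 \<le> (\<Sum>i\<in>UNIV. \<Sum>j\<in>UNIV. (\<Sum>k\<in>UNIV. (A $ i $ k)\<^sup>2) * (\<Sum>k\<in>UNIV. (B $ k $ j)\<^sup>2))"
    unfolding sq matrix_matrix_mult_def by (intro sum_mono) (simp add: Cauchy_Schwarz_ineq_sum)
  also have "\<dots> = (norm A)\<^sup>2 * (\<Sum>j\<in>UNIV. \<Sum>k\<in>UNIV. (B $ k $ j)\<^sup>2)"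
    unfolding sq by (simp add: sum_product)
  also have "(\<Sum>j\<in>UNIV. \<Sum>k\<in>UNIV. (B $ k $ j)\<^sup>2) = (norm B)\<^sup>2"
    unfolding sq by (rule sum.swap)
  finally have "(norm (A ** B))\<^sup>2 \<le> (norm A * norm B)\<^sup>2"
    by (simp add: power_mult_distrib)
  then show ?thesis
    by (rule power2_le_imp_le) simp
qed

text \<open>The purpose of the copied type: \<open>*\<close> on \<open>real^'k^'k\<close> is the
  componentwise product, while here it is the matrix product, so that the rules for derivatives and
  limits in normed algebras apply to it.\<close>

instantiation mtx :: (finite) real_normed_algebra
begin

lift_definition times_mtx :: "'a mtx \<Rightarrow> 'a mtx \<Rightarrow> 'a mtx" is "(**)" .

instance
proof
  fix A B C :: "'a mtx" and r :: real
  show "A * B * C = A * (B * C)" by transfer (simp add: matrix_mul_assoc)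
  show "(A + B) * C = A * C + B * C" by transfer (simp add: matrix_matrix_mult_def vec_eq_iff distrib_right sum.distrib)
  show "A * (B + C) = A * B + A * C" by transfer (simp add: matrix_add_ldistrib)
  show "r *\<^sub>R A * B = r *\<^sub>R (A * B)" "A * r *\<^sub>R B = r *\<^sub>R (A * B)"
    by (transfer, simp add: matrix_matrix_mult_def vec_eq_iff sum_distrib_left ac_simps)+
  show "norm (A * B) \<le> norm A * norm B"
    unfolding norm_mtx_entries times_mtx.rep_eq by (rule norm_matrix_mult_le)
qed

end

text \<open>The Frobenius norm of \<open>1\<close> is the square root of the size, so the class with
  \<open>norm 1 = 1\<close>, on which the power series \<open>exp\<close> lives, is out of reach;
  exponentials are taken by spectral calculus instead.\<close>

instantiation mtx :: (finite) real_algebra_1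
begin

lift_definition one_mtx :: "'a mtx" is "mat 1" .

instance
proof
  show "1 * A = A" "A * 1 = A" for A :: "'a mtx"
    by (transfer, simp)+
  have "(mat 1 :: real^'a^'a) $ i $ i \<noteq> 0" for i
    by (simp add: mat_def)
  then show "(0 :: 'a mtx) \<noteq> 1"
    by transfer (metis zero_index)
qed

end

section \<open>Entries, action on vectors and transposes\<close>

lift_definition app :: "'k::finite mtx \<Rightarrow> real^'k \<Rightarrow> real^'k" (infixr \<open>\<star>\<close> 75) is "(*v)" .
lift_definition adj :: "'k::finite mtx \<Rightarrow> 'k mtx" is transpose .
lift_definition diag :: "('k::finite \<Rightarrow> real) \<Rightarrow> 'k mtx" is "\<lambda>d. \<chi> i j. if i = j then d i else 0" .
lift_definition entry :: "'k::finite mtx \<Rightarrow> 'k \<Rightarrow> 'k \<Rightarrow> real" is "\<lambda>A i j. A $ i $ j" .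
lift_definition mtx_of :: "('k::finite \<Rightarrow> 'k \<Rightarrow> real) \<Rightarrow> 'k mtx" is "\<lambda>f. \<chi> i j. f i j" .

lemma mtx_eq_iff: "A = B \<longleftrightarrow> (\<forall>i j. entry A i j = entry B i j)"
  by transfer (simp add: vec_eq_iff)

lemma entry_simps [simp]:
  "entry 0 i j = 0" "entry (A + B) i j = entry A i j + entry B i j"
  "entry (A - B) i j = entry A i j - entry B i j" "entry (- A) i j = - entry A i j"
  "entry (c *\<^sub>R A) i j = c * entry A i j" "entry 1 i j = (if i = j then 1 else 0)"
  "entry (adj A) i j = entry A j i" "entry (diag d) i j = (if i = j then d i else 0)"
  "entry (mtx_of f) i j = f i j"
  by (transfer, simp add: mat_def transpose_def)+

lemma entry_mult: "entry (A * B) i j = (\<Sum>k\<in>UNIV. entry A i k * entry B k j)"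
  by transfer (simp add: matrix_matrix_mult_def)

lemma entry_diag_mult [simp]: "entry (diag d * A) i j = d i * entry A i j"
  unfolding entry_mult by (simp add: if_distrib[of "\<lambda>x. x * _"] cong: if_cong)

lemma entry_mult_diag [simp]: "entry (A * diag d) i j = entry A i j * d j"
  unfolding entry_mult by (simp add: if_distrib[of "\<lambda>x. _ * x"] cong: if_cong)

lemma inner_mtx_entry: "inner A B = (\<Sum>i\<in>UNIV. \<Sum>j\<in>UNIV. entry A i j * entry B i j)"
  by transfer (simp add: inner_vec_def)

lemma app_nth: "(A \<star> x) $ i = (\<Sum>j\<in>UNIV. entry A i j * x $ j)"
  by transfer (simp add: matrix_vector_mult_def)

lemma app_simps [simp]:
  "1 \<star> x = x" "0 \<star> x = 0" "A \<star> 0 = 0"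
  by (transfer, simp)+

lemma app_mult: "(A * B) \<star> x = A \<star> B \<star> x"
  by transfer (simp add: matrix_vector_mul_assoc)

lemma app_linear:
  "(A + B) \<star> x = A \<star> x + B \<star> x" "(A - B) \<star> x = A \<star> x - B \<star> x" "(- A) \<star> x = - (A \<star> x)"
  "(c *\<^sub>R A) \<star> x = c *\<^sub>R (A \<star> x)"
  "A \<star> (x + y) = A \<star> x + A \<star> y" "A \<star> (x - y) = A \<star> x - A \<star> y" "A \<star> (- x) = - (A \<star> x)"
  "A \<star> (c *\<^sub>R x) = c *\<^sub>R (A \<star> x)"
  by (simp_all add: vec_eq_iff app_nth algebra_simps sum.distrib sum_subtractf sum_negf sum_distrib_left)

lemma app_eqI: "(\<And>x. A \<star> x = B \<star> x) \<Longrightarrow> A = B"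
  by transfer (simp add: matrix_eq)

lemma norm_app_le: "norm (A \<star> x) \<le> norm A * norm x"
proof -
  have "(norm (A \<star> x))\<^sup>2 = (\<Sum>i\<in>UNIV. (\<Sum>j\<in>UNIV. entry A i j * x $ j)\<^sup>2)"
    unfolding power2_norm_eq_inner by (simp add: inner_vec_def power2_eq_square app_nth)
  also have "\<dots> \<le> (\<Sum>i\<in>UNIV. (\<Sum>j\<in>UNIV. (entry A i j)\<^sup>2) * (\<Sum>j\<in>UNIV. (x $ j)\<^sup>2))"
    by (intro sum_mono Cauchy_Schwarz_ineq_sum)
  also have "\<dots> = (norm A)\<^sup>2 * (norm x)\<^sup>2"
    unfolding power2_norm_eq_inner by (simp add: inner_mtx_entry inner_vec_def power2_eq_square sum_distrib_right)
  finally have "(norm (A \<star> x))\<^sup>2 \<le> (norm A * norm x)\<^sup>2"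
    by (simp add: power_mult_distrib)
  then show ?thesis
    by (rule power2_le_imp_le) simp
qed

lemma bounded_bilinear_app: "bounded_bilinear (\<star>)"
  by (rule bounded_bilinear.intro) (auto simp: app_linear intro!: exI[of _ 1] norm_app_le)

lemma adj_simps [simp]:
  "adj (adj A) = A" "adj 0 = 0" "adj 1 = 1" "adj (A + B) = adj A + adj B"
  "adj (A - B) = adj A - adj B" "adj (- A) = - adj A" "adj (c *\<^sub>R A) = c *\<^sub>R adj A"
  "adj (diag d) = diag d"
  by (auto simp: mtx_eq_iff)

lemma adj_mult [simp]: "adj (A * B) = adj B * adj A"
  by (simp add: mtx_eq_iff entry_mult mult.commute)

lemma inner_adj_adj: "inner (adj A) (adj B) = inner A B"
  unfolding inner_mtx_entry entry_simps by (rule sum.swap)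

lemma bounded_linear_adj: "bounded_linear adj"
  by (rule bounded_linear_intro[where K = 1]) (simp_all add: norm_eq_sqrt_inner inner_adj_adj)

lemma inner_app: "inner (A \<star> x) y = inner x (adj A \<star> y)"
  by (simp add: inner_vec_def app_nth sum_distrib_left sum_distrib_right)
    (subst sum.swap, simp add: mult_ac)

lemma inner_mult_left: "inner (A * B) C = inner B (adj A * C)"
proof -
  have "inner (A * B) C = (\<Sum>i\<in>UNIV. \<Sum>j\<in>UNIV. \<Sum>k\<in>UNIV. entry A i k * entry B k j * entry C i j)"
    by (simp add: inner_mtx_entry entry_mult sum_distrib_right)
  also have "\<dots> = (\<Sum>i\<in>UNIV. \<Sum>k\<in>UNIV. \<Sum>j\<in>UNIV. entry A i k * entry B k j * entry C i j)"
    by (intro sum.cong refl sum.swap)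
  also have "\<dots> = (\<Sum>k\<in>UNIV. \<Sum>i\<in>UNIV. \<Sum>j\<in>UNIV. entry A i k * entry B k j * entry C i j)"
    by (rule sum.swap)
  also have "\<dots> = (\<Sum>k\<in>UNIV. \<Sum>j\<in>UNIV. \<Sum>i\<in>UNIV. entry A i k * entry B k j * entry C i j)"
    by (intro sum.cong refl sum.swap)
  also have "\<dots> = inner B (adj A * C)"
    by (simp add: inner_mtx_entry entry_mult sum_distrib_left mult_ac)
  finally show ?thesis .
qed

lemma inner_mult_right: "inner (A * B) C = inner A (C * adj B)"
proof -
  have "inner (A * B) C = inner (adj B * adj A) (adj C)"
    by (metis adj_mult inner_adj_adj)
  also have "\<dots> = inner (adj A) (B * adj C)"
    by (simp add: inner_mult_left)
  also have "\<dots> = inner A (C * adj B)"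
    by (metis adj_mult adj_simps(1) inner_adj_adj)
  finally show ?thesis .
qed

lemma diag_mult: "diag d * diag e = diag (\<lambda>i. d i * e i)"
  by (simp add: mtx_eq_iff)

lemma diag_one: "diag (\<lambda>_. 1) = 1"
  by (simp add: mtx_eq_iff)

section \<open>Orthogonal matrices\<close>

definition orth :: "'k::finite mtx \<Rightarrow> bool" where
  "orth Q \<longleftrightarrow> adj Q * Q = 1 \<and> Q * adj Q = 1"

lemma mtx_left_inverse: "A * B = 1 \<Longrightarrow> B * A = (1 :: 'k::finite mtx)"
  by transfer (simp add: matrix_left_right_inverse)

lemma orthI: "adj Q * Q = 1 \<Longrightarrow> orth Q"
  by (simp add: orth_def mtx_left_inverse)

lemma orthD: "orth Q \<Longrightarrow> adj Q * Q = 1" "orth Q \<Longrightarrow> Q * adj Q = 1"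
  "orth Q \<Longrightarrow> adj Q * (Q * A) = A" "orth Q \<Longrightarrow> Q * (adj Q * A) = A"
  by (auto simp: orth_def mult.assoc[symmetric])

lemma orth_simps: "orth 1" "orth Q \<Longrightarrow> orth (adj Q)" "orth Q \<Longrightarrow> orth R \<Longrightarrow> orth (Q * R)"
  by (auto simp: orth_def) (metis (no_types) mult.assoc mult_1_left mult_1_right)+

lemma norm_orth_mult:
  assumes "orth Q" shows "norm (Q * A) = norm A" "norm (A * Q) = norm A"
  using assms by (simp_all add: norm_eq_sqrt_inner inner_mult_left[of Q] inner_mult_right[of _ Q] mult.assoc orthD)

lemma norm_orth_app: "orth Q \<Longrightarrow> norm (Q \<star> x) = norm x"
  by (simp add: norm_eq_sqrt_inner inner_app app_mult[symmetric] orthD)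

section \<open>Spectral calculus for symmetric matrices\<close>

text \<open>A maximizer \<open>x\<close> of the Rayleigh quotient on the unit sphere of
  \<open>W\<close> is an eigenvector: \<open>c * inner y y - inner y (A \<star> y)\<close> is
  nonnegative on \<open>W\<close> and vanishes at \<open>x\<close>, so its first variation at
  \<open>x\<close> vanishes along \<open>W\<close>, in particular along the residual
  \<open>c *\<^sub>R x - A \<star> x\<close>.\<close>

lemma symmetric_eigenvector:
  fixes A :: "'k::finite mtx"
  assumes "adj A = A" "subspace W" "\<And>x. x \<in> W \<Longrightarrow> A \<star> x \<in> W" "w \<in> W" "w \<noteq> 0"
  obtains x c where "x \<in> W" "norm x = 1" "A \<star> x = c *\<^sub>R x"
proof -
  let ?f = "\<lambda>x. inner x (A \<star> x)"
  have cont: "continuous_on UNIV ?f"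
    using linear_continuous_on[OF bounded_bilinear.bounded_linear_right[OF bounded_bilinear_app]]
    by (intro continuous_intros)
  have "compact (sphere 0 1 \<inter> W)"
    by (intro compact_Int_closed compact_sphere closed_subspace assms)
  moreover have "w /\<^sub>R norm w \<in> sphere 0 1 \<inter> W"
    using assms by (simp add: subspace_scale)
  ultimately obtain x where x: "x \<in> sphere 0 1 \<inter> W" "\<And>y. y \<in> sphere 0 1 \<inter> W \<Longrightarrow> ?f y \<le> ?f x"
    using continuous_attains_sup[of "sphere 0 1 \<inter> W" ?f] cont continuous_on_subset[OF cont] by blast
  define c where "c = ?f x"
  have xx: "inner x x = 1"
    using x(1) by (simp add: dot_square_norm)
  have max: "?f y \<le> c * inner y y" if "y \<in> W" for y
  proof (cases "y = 0")
    case False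
    have "?f (y /\<^sub>R norm y) \<le> c"
      unfolding c_def using False that assms by (intro x(2)) (simp add: subspace_scale)
    moreover have "?f (y /\<^sub>R norm y) = ?f y / inner y y"
      by (simp add: app_linear divide_simps dot_square_norm power2_eq_square)
    ultimately show ?thesis
      using False by (simp add: divide_le_eq)
  qed simp
  define z where "z = c *\<^sub>R x - A \<star> x"
  have zW: "z \<in> W"
    unfolding z_def using x(1) assms by (intro subspace_diff subspace_scale) auto
  define K where "K = c * inner z z - inner z (A \<star> z)"
  have quad: "0 \<le> 2 * t * inner z z + t\<^sup>2 * K" for t
  proof -
    have "0 \<le> c * inner (x + t *\<^sub>R z) (x + t *\<^sub>R z) - ?f (x + t *\<^sub>R z)"
      using max[of "x + t *\<^sub>R z"] x(1) zW assms by (simp add: subspace_add subspace_scale)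
    also have "\<dots> = (c * inner x x - ?f x) + 2 * t * (c * inner x z - inner (A \<star> x) z) + t\<^sup>2 * K"
      using inner_app[of A x z] inner_app[of A z x] assms(1)
      by (simp add: K_def app_linear inner_add_left inner_add_right inner_commute power2_eq_square algebra_simps)
    also have "\<dots> = 2 * t * inner z z + t\<^sup>2 * K"
      by (simp add: xx c_def) (simp add: z_def c_def inner_diff_left)
    finally show ?thesis .
  qed
  have "inner z z = 0"
  proof (rule ccontr)
    assume "inner z z \<noteq> 0"
    then have pos: "inner z z > 0" by simp
    \<comment> \<open>Moving against \<open>z\<close> by this amount keeps \<open>t * K\<close> at
      most \<open>inner z z\<close> in size, half of the first-order term; the \<open>+ 1\<close>
      covers \<open>K = 0\<close>.\<close>
    define t where "t = - inner z z / (\<bar>K\<bar> + 1)"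
    have t: "t < 0" using pos by (simp add: t_def divide_neg_pos)
    have "t * (2 * inner z z + t * K) \<ge> 0"
      using quad[of t] by (simp add: algebra_simps power2_eq_square)
    then have "2 * inner z z + t * K \<le> 0"
      using t by (simp add: zero_le_mult_iff)
    moreover have "t * K \<ge> - inner z z"
    proof -
      have "\<bar>t * K\<bar> \<le> inner z z"
        using pos by (simp add: t_def abs_mult divide_simps mult_left_mono)
      then show ?thesis by linarith
    qed
    ultimately show False using pos by linarith
  qed
  then have "A \<star> x = c *\<^sub>R x"
    by (simp add: z_def)
  with x(1) that show ?thesis by auto
qed

text \<open>A symmetric matrix preserves the orthogonal complement of any set of its eigenvectors,
  and below full dimension this complement contains a further eigenvector.\<close>

lemma orthonormal_eigenvectors:
  fixes A :: "'k::finite mtx"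
  assumes "adj A = A" "n \<le> CARD('k)"
  shows "\<exists>S. finite S \<and> card S = n \<and> (\<forall>x\<in>S. norm x = 1 \<and> (\<exists>c. A \<star> x = c *\<^sub>R x)) \<and> pairwise orthogonal S"
  using assms(2)
proof (induction n)
  case 0
  then show ?case by (intro exI[of _ "{}"]) auto
next
  case (Suc n)
  then obtain S where S: "finite S" "card S = n" "pairwise orthogonal S"
    and ev: "\<And>x. x \<in> S \<Longrightarrow> norm x = 1 \<and> (\<exists>c. A \<star> x = c *\<^sub>R x)" by auto
  define W where "W = {y. \<forall>x\<in>S. orthogonal x y}"
  have "subspace W"
    unfolding W_def by (rule subspace_orthogonal_to_vectors)
  moreover have "A \<star> y \<in> W" if "y \<in> W" for y
    unfolding W_def
  proof safe
    fix x assume "x \<in> S"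
    with ev obtain c where "A \<star> x = c *\<^sub>R x" by blast
    with that \<open>x \<in> S\<close> assms(1) show "orthogonal x (A \<star> y)"
      using inner_app[of A x y] by (simp add: W_def orthogonal_def)
  qed
  moreover have "dim S < DIM(real^'k)"
    using dim_le_card[OF span_superset \<open>finite S\<close>] S(2) Suc.prems by simp
  then obtain w where "w \<noteq> 0" "\<And>y. y \<in> span S \<Longrightarrow> orthogonal w y"
    using orthogonal_to_subspace_exists by blast
  then have "w \<in> W" "w \<noteq> 0"
    by (auto simp: W_def orthogonal_commute span_base)
  ultimately obtain x c where x: "x \<in> W" "norm x = 1" "A \<star> x = c *\<^sub>R x"
    using symmetric_eigenvector[OF assms(1)] by metis
  have "x \<notin> S"
    using x(1,2) by (auto simp: W_def orthogonal_def)
  then show ?case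
    using S ev x by (intro exI[of _ "insert x S"])
      (auto simp: W_def pairwise_insert orthogonal_commute)
qed

definition spectral :: "'k::finite mtx \<Rightarrow> 'k mtx \<Rightarrow> ('k \<Rightarrow> real) \<Rightarrow> bool" where
  "spectral A Q d \<longleftrightarrow> orth Q \<and> A = Q * diag d * adj Q"

lemma spectral_theorem:
  fixes A :: "'k::finite mtx"
  assumes "adj A = A"
  obtains Q d where "spectral A Q d"
proof -
  obtain S :: "(real^'k) set" where S: "finite S" "card S = CARD('k)" "pairwise orthogonal S"
    and ev: "\<And>x. x \<in> S \<Longrightarrow> norm x = 1 \<and> (\<exists>c. A \<star> x = c *\<^sub>R x)"
    using orthonormal_eigenvectors[OF assms order_refl] by blast
  obtain e :: "'k \<Rightarrow> real^'k" where e: "bij_betw e UNIV S"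
    using finite_same_card_bij[of "UNIV :: 'k set" S] S by auto
  have eS: "e i \<in> S" for i
    using e by (auto simp: bij_betw_def)
  with ev have "\<forall>i. \<exists>c. A \<star> e i = c *\<^sub>R e i" by blast
  then obtain d where d: "\<And>i. A \<star> e i = d i *\<^sub>R e i"
    using choice[of "\<lambda>i c. A \<star> e i = c *\<^sub>R e i"] by blast
  have ee: "inner (e i) (e j) = (if i = j then 1 else 0)" for i j
    using S(3) eS[of i] eS[of j] ev[of "e i"] e
    by (auto simp: pairwise_def orthogonal_def bij_betw_def dot_square_norm dest: inj_onD)
  define Q where "Q = mtx_of (\<lambda>i j. e j $ i)"
  have "adj Q * Q = 1"
    using ee by (simp add: mtx_eq_iff entry_mult Q_def inner_vec_def)
  then have Q: "orth Q" by (rule orthI)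
  have "A * Q = Q * diag d"
  proof -
    have "entry (A * Q) i j = (A \<star> e j) $ i" for i j
      by (simp add: entry_mult app_nth Q_def)
    then show ?thesis
      by (simp add: mtx_eq_iff d) (simp add: Q_def)
  qed
  then have "A = Q * diag d * adj Q"
    using orthD(2)[OF Q] by (metis mult.assoc mult.right_neutral)
  with Q that show ?thesis by (auto simp: spectral_def)
qed

text \<open>Functional calculus through an arbitrary diagonalization;
  \<open>spectral_intertwine\<close> with \<open>X = 1\<close> shows that the choice does not
  matter.\<close>

definition fsym :: "(real \<Rightarrow> real) \<Rightarrow> 'k::finite mtx \<Rightarrow> 'k mtx" where
  "fsym f A = (SOME B. \<exists>Q d. spectral A Q d \<and> B = Q * diag (f \<circ> d) * adj Q)"

text \<open>In the two eigenbases \<open>X\<close> becomes a matrix \<open>Y\<close> supported where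
  the eigenvalues \<open>d j\<close> and \<open>e i\<close> agree, and there \<open>f\<close> takes
  equal values. Independence of the diagonalization, commutation and conjugation rules all follow
  from this.\<close>

lemma spectral_intertwine:
  assumes A: "spectral A Q d" and B: "spectral B R e" and X: "X * A = B * X"
  shows "X * (Q * diag (f \<circ> d) * adj Q) = (R * diag (f \<circ> e) * adj R) * X"
proof -
  have oQ: "orth Q" and oR: "orth R" using A B by (auto simp: spectral_def)
  define Y where "Y = adj R * X * Q"
  have "Y * diag d = adj R * (X * A) * Q"
    using A oQ by (simp add: Y_def spectral_def mult.assoc orthD)
  also have "\<dots> = diag e * Y"
    unfolding X using B oR by (simp add: Y_def spectral_def mult.assoc orthD)
  finally have "entry Y i j * d j = e i * entry Y i j" for i j
    by (metis entry_diag_mult entry_mult_diag)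
  then have "Y * diag (f \<circ> d) = diag (f \<circ> e) * Y"
    by (simp add: mtx_eq_iff) (metis mult.commute mult_cancel_right)
  then have "R * (Y * diag (f \<circ> d)) * adj Q = R * (diag (f \<circ> e) * Y) * adj Q"
    by simp
  then show ?thesis
    using oQ oR by (simp add: Y_def mult.assoc orthD)
qed

lemma fsym_spectral:
  assumes "spectral A Q d"
  shows "fsym f A = Q * diag (f \<circ> d) * adj Q"
proof -
  have "\<exists>Q d. spectral A Q d \<and> fsym f A = Q * diag (f \<circ> d) * adj Q"
    unfolding fsym_def by (rule someI_ex) (use assms in blast)
  then obtain R e where R: "spectral A R e" "fsym f A = R * diag (f \<circ> e) * adj R"
    by blast
  have "1 * (R * diag (f \<circ> e) * adj R) = (Q * diag (f \<circ> d) * adj Q) * 1"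
    by (rule spectral_intertwine[OF R(1) assms]) simp
  then show ?thesis using R(2) by simp
qed

lemma fsym_intertwine:
  assumes "adj A = A" "adj B = B" "X * A = B * X"
  shows "X * fsym f A = fsym f B * X"
proof -
  obtain Q d where Q: "spectral A Q d" using assms(1) by (rule spectral_theorem)
  obtain R e where R: "spectral B R e" using assms(2) by (rule spectral_theorem)
  show ?thesis
    unfolding fsym_spectral[OF Q] fsym_spectral[OF R] by (rule spectral_intertwine[OF Q R assms(3)])
qed

lemma spectral_fsym: "spectral A Q d \<Longrightarrow> spectral (fsym f A) Q (f \<circ> d)"
  by (simp add: fsym_spectral) (simp add: spectral_def)

lemma spectral_adj: "spectral A Q d \<Longrightarrow> adj A = A"
  by (simp add: spectral_def mult.assoc)

lemma spectral_scaleR: "spectral A Q d \<Longrightarrow> spectral (c *\<^sub>R A) Q (\<lambda>i. c * d i)"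
proof -
  have "diag (\<lambda>i. c * d i) = c *\<^sub>R diag d" by (simp add: mtx_eq_iff)
  then show "spectral A Q d \<Longrightarrow> spectral (c *\<^sub>R A) Q (\<lambda>i. c * d i)"
    by (simp add: spectral_def)
qed

lemma spectral_mult:
  assumes "spectral A Q d" "spectral B Q e"
  shows "spectral (A * B) Q (\<lambda>i. d i * e i)"
proof -
  have "A * B = Q * (diag d * diag e) * adj Q"
    using assms by (simp add: spectral_def mult.assoc orthD)
  then show ?thesis using assms by (simp add: spectral_def diag_mult)
qed

lemma spectral_unique: "spectral A Q d \<Longrightarrow> spectral B Q d \<Longrightarrow> A = B"
  by (simp add: spectral_def)

lemma spectral_quad:
  assumes "spectral A Q d"
  shows "inner x (A \<star> x) = (\<Sum>i\<in>UNIV. d i * ((adj Q \<star> x) $ i)\<^sup>2)"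
proof -
  have "inner x (A \<star> x) = inner (adj Q \<star> x) (diag d \<star> adj Q \<star> x)"
    using assms by (simp add: spectral_def app_mult inner_app[of "adj Q"])
  also have "\<dots> = (\<Sum>i\<in>UNIV. d i * ((adj Q \<star> x) $ i)\<^sup>2)"
    by (simp add: inner_vec_def app_nth power2_eq_square if_distrib[of "\<lambda>x. x * _"] mult_ac cong: if_cong)
  finally show ?thesis .
qed

lemma spectral_norm_app: "orth Q \<Longrightarrow> inner x x = (\<Sum>i\<in>UNIV. ((adj Q \<star> x) $ i)\<^sup>2)"
  using spectral_quad[of 1 Q "\<lambda>_. 1" x] by (simp add: spectral_def diag_one orthD)

lemma spectral_quad_mtx:
  assumes "spectral A Q d"
  shows "inner X (A * X) = (\<Sum>i\<in>UNIV. \<Sum>j\<in>UNIV. d i * (entry (adj Q * X) i j)\<^sup>2)"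
proof -
  have "inner X (A * X) = inner (Q * (diag d * (adj Q * X))) X"
    using assms by (simp add: spectral_def inner_commute mult.assoc)
  also have "\<dots> = inner (diag d * (adj Q * X)) (adj Q * X)"
    by (rule inner_mult_left)
  also have "\<dots> = (\<Sum>i\<in>UNIV. \<Sum>j\<in>UNIV. d i * (entry (adj Q * X) i j)\<^sup>2)"
    by (simp add: inner_mtx_entry power2_eq_square mult_ac)
  finally show ?thesis .
qed

section \<open>Exponential of symmetric matrices\<close>

abbreviation mexp :: "'k::finite mtx \<Rightarrow> 'k mtx" where "mexp \<equiv> fsym exp"

lemma spectral_mexp: "spectral Z Q d \<Longrightarrow> spectral (mexp (c *\<^sub>R Z)) Q (\<lambda>i. exp (c * d i))"
  using spectral_fsym[OF spectral_scaleR, of Z Q d exp c] by (simp add: o_def)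

lemma adj_mexp [simp]: "adj Z = Z \<Longrightarrow> adj (mexp Z) = mexp Z"
  by (metis spectral_adj spectral_fsym spectral_theorem)

lemma mexp_add:
  assumes "adj Z = Z"
  shows "mexp (s *\<^sub>R Z) * mexp (t *\<^sub>R Z) = mexp ((s + t) *\<^sub>R Z)"
proof -
  obtain Q d where "spectral Z Q d" using assms by (rule spectral_theorem)
  note * = spectral_mexp[OF this]
  show ?thesis
    by (rule spectral_unique[OF spectral_mult[OF * *]])
      (use *[of "s + t"] in \<open>simp add: exp_add[symmetric] algebra_simps\<close>)
qed

lemma mexp_zero [simp]: "mexp (0 :: 'k::finite mtx) = 1"
proof -
  have "spectral (0 :: 'k mtx) 1 (\<lambda>_. 0)"
    by (simp add: spectral_def orth_simps mtx_eq_iff)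
  from spectral_fsym[OF this, of exp] show ?thesis
    by (simp add: spectral_def o_def diag_one)
qed

lemma mexp_inverse:
  assumes "adj Z = Z"
  shows "mexp Z * mexp (- Z) = 1" "mexp (- Z) * mexp Z = 1"
  using mexp_add[OF assms, of 1 "- 1"] mexp_add[OF assms, of "- 1" 1] by simp_all

lemma mexp_double: "adj Z = Z \<Longrightarrow> mexp (2 *\<^sub>R Z) = mexp Z * mexp Z"
  using mexp_add[of Z 1 1] by simp

lemma mexp_half: "adj Z = Z \<Longrightarrow> mexp ((1/2) *\<^sub>R Z) * mexp ((1/2) *\<^sub>R Z) = mexp Z"
  using mexp_add[of Z "1/2" "1/2"] by simp

lemma entry_sum: "entry (\<Sum>k\<in>I. F k) i j = (\<Sum>k\<in>I. entry (F k) i j)"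
  by (induction I rule: infinite_finite_induct) auto

text \<open>Lets a curve of diagonal matrices be differentiated as a finite sum of scalar functions
  times constant matrices.\<close>

lemma diag_sum: "diag d = (\<Sum>i\<in>UNIV. d i *\<^sub>R diag (\<lambda>j. of_bool (i = j)))"
  by (auto simp: mtx_eq_iff entry_sum of_bool_def if_distrib[of "\<lambda>x. _ * x"] cong: if_cong)

lemma mexp_has_vector_derivative:
  assumes "adj Z = Z"
  shows "((\<lambda>t. mexp (t *\<^sub>R Z)) has_vector_derivative mexp (t *\<^sub>R Z) * Z) (at t within S)"
proof -
  obtain Q d where Q: "spectral Z Q d" using assms by (rule spectral_theorem)
  let ?E = "\<lambda>i. diag (\<lambda>j. of_bool (i = j))"
  have *: "mexp (t *\<^sub>R Z) = Q * (\<Sum>i\<in>UNIV. exp (t * d i) *\<^sub>R ?E i) * adj Q" for t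
    using spectral_mexp[OF Q, of t] unfolding spectral_def diag_sum[of "\<lambda>i. exp (t * d i)"] by simp
  have "mexp (t *\<^sub>R Z) * Z = Q * diag (\<lambda>i. exp (t * d i) * d i) * adj Q"
    using spectral_mult[OF spectral_mexp[OF Q] Q] by (simp add: spectral_def)
  also have "\<dots> = Q * (\<Sum>i\<in>UNIV. (exp (t * d i) * d i) *\<^sub>R ?E i) * adj Q"
    unfolding diag_sum[of "\<lambda>i. exp (t * d i) * d i"] ..
  finally show ?thesis
    unfolding * by (auto intro!: derivative_eq_intros)
qed

lemma mexp_intertwine:
  "adj A = A \<Longrightarrow> adj B = B \<Longrightarrow> X * A = B * X \<Longrightarrow> X * mexp A = mexp B * X"
  by (rule fsym_intertwine)

lemma mexp_commute: "adj Z = Z \<Longrightarrow> Z * X = X * Z \<Longrightarrow> mexp Z * X = X * mexp Z"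
  using mexp_intertwine[of Z Z X] by simp

lemma mexp_conj:
  assumes "orth u" "adj Z = Z"
  shows "u * mexp Z * adj u = mexp (u * Z * adj u)"
proof -
  have "u * mexp Z = mexp (u * Z * adj u) * u"
    using assms by (intro mexp_intertwine) (simp_all add: mult.assoc orthD)
  then show ?thesis
    using assms by (simp add: mult.assoc orthD)
qed

lemma mexp_inj:
  fixes A B :: "'k::finite mtx"
  assumes "adj A = A" "adj B = B" "mexp A = mexp B"
  shows "A = B"
proof -
  have "fsym ln (mexp Z) = Z" if Z: "adj Z = Z" for Z :: "'k mtx"
  proof -
    obtain Q d where Q: "spectral Z Q d" using Z by (rule spectral_theorem)
    have "ln \<circ> (exp \<circ> d) = d" by auto
    then show ?thesis
      using spectral_unique[OF Q] spectral_fsym[OF spectral_fsym[OF Q, of exp], of ln] by metis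
  qed
  with assms show ?thesis by metis
qed

lemma mexp_log:
  assumes "adj P = P" "\<And>x. x \<noteq> 0 \<Longrightarrow> 0 < inner x (P \<star> x)"
  obtains Z where "adj Z = Z" "mexp Z = P"
proof -
  obtain Q d where Q: "spectral P Q d" using assms(1) by (rule spectral_theorem)
  then have oQ: "orth Q" by (simp add: spectral_def)
  have "d i > 0" for i
  proof -
    let ?x = "Q \<star> axis i 1"
    have x: "adj Q \<star> ?x = axis i 1"
      using oQ by (simp add: app_mult[symmetric] orthD)
    then have "?x \<noteq> 0"
      by (metis app_simps(3) axis_eq_0_iff zero_neq_one)
    then have "0 < inner ?x (P \<star> ?x)" by (rule assms)
    also have "\<dots> = d i"
      unfolding spectral_quad[OF Q] x
      by (simp add: axis_def if_distrib[of "\<lambda>x. x\<^sup>2"] if_distrib[of "\<lambda>x. _ * x"] cong: if_cong)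
    finally show ?thesis .
  qed
  then have "exp \<circ> (ln \<circ> d) = d" by auto
  then have "mexp (fsym ln P) = P"
    using spectral_unique[OF Q] spectral_fsym[OF spectral_fsym[OF Q, of ln], of exp] by metis
  then show ?thesis
    using that spectral_adj[OF spectral_fsym[OF Q]] by blast
qed

lemma mexp_log_gram:
  fixes A B :: "'k::finite mtx"
  assumes "A * B = 1"
  obtains Z where "adj Z = Z" "mexp Z = adj A * A"
proof (rule mexp_log)
  show "adj (adj A * A) = adj A * A" by simp
  fix x :: "real^'k" assume "x \<noteq> 0"
  then have "A \<star> x \<noteq> 0"
    using mtx_left_inverse[OF assms] by (metis app_mult app_simps(1,3))
  then show "0 < inner x ((adj A * A) \<star> x)"
    by (simp add: app_mult inner_app[of A, symmetric])
qed

text \<open>The squares are \<open>mexp (2 *\<^sub>R A)\<close> and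
  \<open>mexp (2 *\<^sub>R B)\<close>, so injectivity of \<open>mexp\<close> makes positive square
  roots unique.\<close>

lemma mexp_sqrt_unique:
  assumes "adj A = A" "adj B = B" "mexp A * mexp A = mexp B * mexp B"
  shows "mexp A = mexp B"
  using mexp_inj[of "2 *\<^sub>R A" "2 *\<^sub>R B"] assms by (simp add: mexp_double)

text \<open>The constant is the smallest eigenvalue of \<open>mexp Z\<close>; the second estimate is
  the first one for the transposed matrix. Left and right multiplication by \<open>mexp Z\<close>
  are thus positive definite for the trace form.\<close>

lemma mexp_lower_bound:
  assumes "adj Z = Z"
  obtains c where "c > 0" "\<And>X. c * (norm X)\<^sup>2 \<le> inner X (mexp Z * X)"
    "\<And>X. c * (norm X)\<^sup>2 \<le> inner X (X * mexp Z)"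
proof -
  obtain Q d where Q: "spectral Z Q d" using assms by (rule spectral_theorem)
  then have oQ: "orth Q" by (simp add: spectral_def)
  define c where "c = Min (range (exp \<circ> d))"
  have c: "c > 0" "\<And>i. c \<le> exp (d i)"
    unfolding c_def by (subst Min_gr_iff) (auto intro: Min_le)
  have 1: "c * (norm X)\<^sup>2 \<le> inner X (mexp Z * X)" for X
  proof -
    have "c * (norm X)\<^sup>2 = c * (norm (adj Q * X))\<^sup>2"
      using oQ by (simp add: norm_orth_mult orth_simps)
    also have "\<dots> = (\<Sum>i\<in>UNIV. \<Sum>j\<in>UNIV. c * (entry (adj Q * X) i j)\<^sup>2)"
      unfolding power2_norm_eq_inner by (simp add: inner_mtx_entry power2_eq_square sum_distrib_left)
    also have "\<dots> \<le> inner X (mexp Z * X)"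
      unfolding spectral_quad_mtx[OF spectral_fsym[OF Q]]
      by (intro sum_mono mult_right_mono) (simp_all add: c)
    finally show ?thesis .
  qed
  have 2: "c * (norm X)\<^sup>2 \<le> inner X (X * mexp Z)" for X
  proof -
    have "inner X (X * mexp Z) = inner (adj X) (mexp Z * adj X)"
      using assms inner_adj_adj[of X "X * mexp Z"] by simp
    moreover have "norm (adj X) = norm X"
      by (simp add: norm_eq_sqrt_inner inner_adj_adj)
    ultimately show ?thesis using 1[of "adj X"] by simp
  qed
  show ?thesis using that c(1) 1 2 by blast
qed

lemma mexp_ge_linear:
  assumes "adj Z = Z"
  shows "inner x x + inner x (Z \<star> x) \<le> inner x (mexp Z \<star> x)"
proof -
  obtain Q d where Q: "spectral Z Q d" using assms by (rule spectral_theorem)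
  then have oQ: "orth Q" by (simp add: spectral_def)
  show ?thesis
    unfolding spectral_norm_app[OF oQ] spectral_quad[OF Q] spectral_quad[OF spectral_fsym[OF Q]]
      sum.distrib[symmetric]
  proof (intro sum_mono)
    fix i
    have "(1 + d i) * ((adj Q \<star> x) $ i)\<^sup>2 \<le> exp (d i) * ((adj Q \<star> x) $ i)\<^sup>2"
      by (intro mult_right_mono exp_ge_add_one_self) simp
    then show "((adj Q \<star> x) $ i)\<^sup>2 + d i * ((adj Q \<star> x) $ i)\<^sup>2 \<le> (exp \<circ> d) i * ((adj Q \<star> x) $ i)\<^sup>2"
      by (simp add: algebra_simps)
  qed
qed

section \<open>Invariant subspaces under conjugation by positive matrices\<close>

text \<open>Applying \<open>T - \<nu>\<close> to the sum kills the component for \<nu> and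
  multiplies the others by nonzero scalars, which shortens the sum by one term.\<close>

lemma eigencomponents_mem:
  fixes T :: "'a::real_vector \<Rightarrow> 'a"
  assumes "linear T" "subspace M" "\<And>X. X \<in> M \<Longrightarrow> T X \<in> M" "finite \<Lambda>"
    and "\<And>\<mu>. \<mu> \<in> \<Lambda> \<Longrightarrow> T (E \<mu>) = \<mu> *\<^sub>R E \<mu>" "(\<Sum>\<mu>\<in>\<Lambda>. E \<mu>) \<in> M" "\<mu> \<in> \<Lambda>"
  shows "E \<mu> \<in> M"
  using assms(4-)
proof (induction \<Lambda> arbitrary: E \<mu> rule: finite_induct)
  case (insert \<nu> \<Lambda>)
  let ?S = "\<Sum>\<mu>\<in>insert \<nu> \<Lambda>. E \<mu>"
  have "T ?S - \<nu> *\<^sub>R ?S = (\<Sum>\<mu>\<in>\<Lambda>. (\<mu> - \<nu>) *\<^sub>R E \<mu>)"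
    using insert by (simp add: linear_sum[OF assms(1)] linear_add[OF assms(1)] scaleR_sum_right
        sum_subtractf[symmetric] algebra_simps)
  moreover have "T ?S - \<nu> *\<^sub>R ?S \<in> M"
    using insert.prems assms by (intro subspace_diff subspace_scale) auto
  ultimately have IH: "(\<mu> - \<nu>) *\<^sub>R E \<mu> \<in> M" if "\<mu> \<in> \<Lambda>" for \<mu>
    using insert.IH[of "\<lambda>\<mu>. (\<mu> - \<nu>) *\<^sub>R E \<mu>" \<mu>] insert.prems that
    by (simp add: linear_scale[OF assms(1)])
  have *: "E \<mu> \<in> M" if "\<mu> \<in> \<Lambda>" for \<mu>
  proof -
    have "\<mu> \<noteq> \<nu>" using that insert by auto
    then show ?thesis
      using subspace_scale[OF assms(2) IH[OF that], of "1 / (\<mu> - \<nu>)"] by simp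
  qed
  have "?S - (\<Sum>\<mu>\<in>\<Lambda>. E \<mu>) \<in> M"
    by (rule subspace_diff[OF assms(2) insert.prems(2) subspace_sum[OF assms(2) *]])
  then have "E \<nu> \<in> M"
    using insert by simp
  with * insert.prems show ?case by auto
qed simp

text \<open>A Schur multiplier in the basis \<open>Q\<close>. If \<open>Q\<close> diagonalizes
  \<open>Z\<close>, then both the bracket with \<open>Z\<close> and conjugation by
  \<open>mexp Z\<close> are of this form, so they are diagonal in the same basis of
  matrices.\<close>

definition hadamard :: "'k::finite mtx \<Rightarrow> ('k \<Rightarrow> 'k \<Rightarrow> real) \<Rightarrow> 'k mtx \<Rightarrow> 'k mtx" where
  "hadamard Q \<phi> X = Q * mtx_of (\<lambda>i j. \<phi> i j * entry (adj Q * X * Q) i j) * adj Q"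

lemma hadamard_hadamard:
  "orth Q \<Longrightarrow> hadamard Q \<phi> (hadamard Q \<psi> X) = hadamard Q (\<lambda>i j. \<phi> i j * \<psi> i j) X"
  by (simp add: hadamard_def mult.assoc orthD mult_ac)

lemma hadamard_linear:
  fixes Q :: "'k::finite mtx"
  shows "linear (hadamard Q \<phi>)"
proof (rule linearI)
  have "mtx_of (\<lambda>i j. \<phi> i j * entry (adj Q * (X + Y) * Q) i j) =
      mtx_of (\<lambda>i j. \<phi> i j * entry (adj Q * X * Q) i j) + mtx_of (\<lambda>i j. \<phi> i j * entry (adj Q * Y * Q) i j)" for X Y
    by (simp add: mtx_eq_iff algebra_simps)
  then show "hadamard Q \<phi> (X + Y) = hadamard Q \<phi> X + hadamard Q \<phi> Y" for X Y
    by (simp add: hadamard_def algebra_simps)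
  have "mtx_of (\<lambda>i j. \<phi> i j * entry (adj Q * (c *\<^sub>R X) * Q) i j) =
      c *\<^sub>R mtx_of (\<lambda>i j. \<phi> i j * entry (adj Q * X * Q) i j)" for X c
    by (simp add: mtx_eq_iff)
  then show "hadamard Q \<phi> (c *\<^sub>R X) = c *\<^sub>R hadamard Q \<phi> X" for X c
    by (simp add: hadamard_def)
qed

lemma hadamard_sum:
  fixes Q :: "'k::finite mtx"
  assumes "finite I"
  shows "(\<Sum>\<mu>\<in>I. hadamard Q (\<phi> \<mu>) X) = hadamard Q (\<lambda>i j. \<Sum>\<mu>\<in>I. \<phi> \<mu> i j) X"
  using assms
proof (induction I)
  case empty
  have "mtx_of (\<lambda>i j. 0) = (0 :: 'k mtx)" by (simp add: mtx_eq_iff)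
  then show ?case by (simp add: hadamard_def)
next
  case (insert \<mu> I)
  have "mtx_of (\<lambda>i j. (f i j + g i j) * h i j) = mtx_of (\<lambda>i j. f i j * h i j) + mtx_of (\<lambda>i j. g i j * h i j)"
    for f g h :: "'k \<Rightarrow> 'k \<Rightarrow> real"
    by (simp add: mtx_eq_iff algebra_simps)
  then show ?case
    using insert by (simp add: hadamard_def algebra_simps)
qed

text \<open>\<open>M\<close> splits along the eigenspaces of the multiplier \<open>t\<close>, and a
  multiplier that is a function \<open>F\<close> of \<open>t\<close> acts on each of them as a
  scalar.\<close>

lemma hadamard_mem:
  fixes Q :: "'k::finite mtx"
  assumes Q: "orth Q" and M: "subspace M" and inv: "\<And>X. X \<in> M \<Longrightarrow> hadamard Q t X \<in> M"
    and F: "\<And>i j. \<phi> i j = F (t i j)" and X: "X \<in> M"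
  shows "hadamard Q \<phi> X \<in> M"
proof -
  define \<Lambda> where "\<Lambda> = (\<lambda>(i, j). t i j) ` UNIV"
  define E where "E \<mu> = hadamard Q (\<lambda>i j. of_bool (t i j = \<mu>)) X" for \<mu>
  have fin: "finite \<Lambda>" by (simp add: \<Lambda>_def)
  have t: "t i j \<in> \<Lambda>" for i j by (auto simp: \<Lambda>_def)
  have sc: "hadamard Q \<psi> (c *\<^sub>R Y) = hadamard Q (\<lambda>i j. c * \<psi> i j) Y" for \<psi> c Y
  proof -
    have "adj Q * (c *\<^sub>R Y) * Q = c *\<^sub>R (adj Q * Y * Q)" by simp
    then show ?thesis by (simp add: hadamard_def mult_ac)
  qed
  have lin: "c *\<^sub>R hadamard Q \<psi> Y = hadamard Q (\<lambda>i j. c * \<psi> i j) Y" for \<psi> c Y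
    using sc linear_scale[OF hadamard_linear] by metis
  have sum1: "(\<Sum>\<mu>\<in>\<Lambda>. G \<mu> * of_bool (t i j = \<mu>)) = G (t i j)" for G :: "real \<Rightarrow> real" and i j
    using fin t by (simp add: of_bool_def if_distrib[of "\<lambda>x. _ * x"] cong: if_cong)
  have "hadamard Q (\<lambda>i j. 1) X = X"
  proof -
    have "mtx_of (\<lambda>i j. entry A i j) = A" for A :: "'k mtx" by (simp add: mtx_eq_iff)
    then show ?thesis using Q by (simp add: hadamard_def mult.assoc orthD)
  qed
  then have "(\<Sum>\<mu>\<in>\<Lambda>. E \<mu>) = X"
    using sum1[of "\<lambda>_. 1"] by (simp add: E_def hadamard_sum fin)
  moreover have "hadamard Q t (E \<mu>) = \<mu> *\<^sub>R E \<mu>" for \<mu>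
    unfolding E_def lin hadamard_hadamard[OF Q]
    by (rule arg_cong[of _ _ "\<lambda>f. hadamard Q f X"]) (auto simp: fun_eq_iff)
  ultimately have "E \<mu> \<in> M" if "\<mu> \<in> \<Lambda>" for \<mu>
    using eigencomponents_mem[OF hadamard_linear M inv fin, of E] X that by auto
  then have "(\<Sum>\<mu>\<in>\<Lambda>. F \<mu> *\<^sub>R E \<mu>) \<in> M"
    using M by (intro subspace_sum subspace_scale)
  also have "(\<Sum>\<mu>\<in>\<Lambda>. F \<mu> *\<^sub>R E \<mu>) = hadamard Q \<phi> X"
    unfolding E_def lin hadamard_sum[OF fin] sum1 F[symmetric] ..
  finally show ?thesis .
qed

lemma hadamard_prod:
  fixes Q :: "'k::finite mtx"
  shows "hadamard Q (\<lambda>i j. a i * b j) X = (Q * diag a * adj Q) * X * (Q * diag b * adj Q)"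
proof -
  have "mtx_of (\<lambda>i j. a i * b j * entry Y i j) = diag a * Y * diag b" for Y :: "'k mtx"
    by (simp add: mtx_eq_iff mult_ac)
  then show ?thesis by (simp add: hadamard_def mult.assoc)
qed

lemma hadamard_diff:
  fixes Q :: "'k::finite mtx"
  shows "hadamard Q (\<lambda>i j. \<phi> i j - \<psi> i j) X = hadamard Q \<phi> X - hadamard Q \<psi> X"
proof -
  have *: "mtx_of (\<lambda>i j. (\<phi> i j - \<psi> i j) * entry Y i j) =
      mtx_of (\<lambda>i j. \<phi> i j * entry Y i j) - mtx_of (\<lambda>i j. \<psi> i j * entry Y i j)" for Y :: "'k mtx"
    by (simp add: mtx_eq_iff algebra_simps)
  show ?thesis
    unfolding hadamard_def * by (simp only: right_diff_distrib left_diff_distrib)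
qed

lemma hadamard_bracket:
  assumes "spectral Z Q d"
  shows "hadamard Q (\<lambda>i j. d i - d j) X = Z * X - X * Z"
proof -
  have "hadamard Q (\<lambda>i j. d i * 1 - 1 * d j) X = Z * X - X * Z"
    unfolding hadamard_diff hadamard_prod using assms by (simp add: spectral_def diag_one orthD)
  then show ?thesis by simp
qed

lemma hadamard_conj:
  assumes "spectral Z Q d"
  shows "hadamard Q (\<lambda>i j. exp (c * (d i - d j))) X = mexp (c *\<^sub>R Z) * X * mexp (- c *\<^sub>R Z)"
proof -
  have "hadamard Q (\<lambda>i j. exp (c * d i) * exp (- c * d j)) X = mexp (c *\<^sub>R Z) * X * mexp (- c *\<^sub>R Z)"
    unfolding hadamard_prod
    using spectral_mexp[OF assms, of c] spectral_mexp[OF assms, of "- c"] by (simp add: spectral_def)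
  then show ?thesis by (simp add: exp_add[symmetric] algebra_simps)
qed

text \<open>Conjugation by \<open>mexp Z\<close> has the multiplier \<open>exp (d i - d j)\<close>,
  from which \<open>ln\<close> recovers the multiplier \<open>d i - d j\<close> of the bracket: real
  eigenvalues lose nothing under \<open>exp\<close>.\<close>

lemma conj_mexp_invariant:
  assumes "adj Z = Z" "subspace M" and inv: "\<And>X. X \<in> M \<Longrightarrow> mexp Z * X * mexp (- Z) \<in> M" and "X \<in> M"
  shows "Z * X - X * Z \<in> M" "mexp (c *\<^sub>R Z) * X * mexp (- c *\<^sub>R Z) \<in> M"
proof -
  obtain Q d where Q: "spectral Z Q d" using assms(1) by (rule spectral_theorem)
  then have oQ: "orth Q" by (simp add: spectral_def)
  have inv': "hadamard Q (\<lambda>i j. exp (1 * (d i - d j))) X \<in> M" if "X \<in> M" for X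
    unfolding hadamard_conj[OF Q] using inv[OF that] by simp
  show "Z * X - X * Z \<in> M"
    unfolding hadamard_bracket[OF Q, symmetric]
    by (rule hadamard_mem[OF oQ assms(2) inv', of _ ln]) (simp_all add: assms)
  show "mexp (c *\<^sub>R Z) * X * mexp (- c *\<^sub>R Z) \<in> M"
    unfolding hadamard_conj[OF Q, symmetric]
    by (rule hadamard_mem[OF oQ assms(2) inv', of _ "\<lambda>x. exp (c * ln x)"]) (simp_all add: assms)
qed

text \<open>The same comparison of multipliers in the other direction, with \<open>exp\<close> in
  place of \<open>ln\<close>.\<close>

lemma bracket_mexp_invariant:
  assumes "adj Z = Z" "subspace M" "\<And>X. X \<in> M \<Longrightarrow> Z * X - X * Z \<in> M" "X \<in> M"
  shows "mexp Z * X * mexp (- Z) \<in> M"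
proof -
  obtain Q d where Q: "spectral Z Q d" using assms(1) by (rule spectral_theorem)
  then have oQ: "orth Q" by (simp add: spectral_def)
  have "hadamard Q (\<lambda>i j. exp (1 * (d i - d j))) X \<in> M"
    by (rule hadamard_mem[OF oQ assms(2), of "\<lambda>i j. d i - d j" _ exp])
      (simp_all add: assms hadamard_bracket[OF Q])
  then show ?thesis
    unfolding hadamard_conj[OF Q] by simp
qed

section \<open>Derivative of the determinant\<close>

lift_definition mdet :: "'k::finite mtx \<Rightarrow> real" is det .

lemma mdet_one [simp]: "mdet 1 = 1"
  by transfer simp

lemma mdet_mult: "mdet (A * B) = mdet A * mdet B"
  by transfer (rule det_mul)

lemma mdet_entry:
  "mdet A = (\<Sum>p\<in>{p. p permutes UNIV}. of_int (sign p) * (\<Prod>i\<in>UNIV. entry A i (p i)))"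
  by transfer (simp add: det_def)

lemma bounded_linear_entry: "bounded_linear (\<lambda>A. entry A i j)"
  by (simp add: linear_conv_bounded_linear[symmetric] linear_iff)

text \<open>\<open>inner 1 X\<close> is the trace of \<open>X\<close>. At the identity matrix only
  the identity permutation of the Leibniz formula survives the product rule.\<close>

lemma mdet_has_derivative_at_one:
  assumes R: "(R has_vector_derivative X) (at t within S)" and one: "R t = 1"
  shows "((\<lambda>\<tau>. mdet (R \<tau>)) has_real_derivative inner 1 X) (at t within S)"
proof -
  let ?D = "\<lambda>p i y. y * entry X i (p i)"
  have ent: "((\<lambda>\<tau>. entry (R \<tau>) i j) has_derivative (\<lambda>y. y * entry X i j)) (at t within S)" for i j
    using bounded_linear.has_vector_derivative[OF bounded_linear_entry R, of i j]
    by (simp add: has_vector_derivative_def)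
  have der: "((\<lambda>\<tau>. mdet (R \<tau>)) has_derivative (\<lambda>y. \<Sum>p\<in>{p. p permutes UNIV}.
      of_int (sign p) * (\<Sum>i\<in>UNIV. ?D p i y * (\<Prod>j\<in>UNIV - {i}. entry (R t) j (p j))))) (at t within S)"
    unfolding mdet_entry by (intro has_derivative_sum has_derivative_mult_right has_derivative_prod ent)
  have off: "(\<Sum>i\<in>UNIV. ?D p i y * (\<Prod>j\<in>UNIV - {i}. entry (R t) j (p j))) =
      (if p = id then y * inner 1 X else 0)" if p: "p permutes UNIV" for p y
  proof (cases "p = id")
    case True
    then show ?thesis
      by (simp add: one inner_mtx_entry if_distrib[of "\<lambda>x. x * _"] sum_distrib_left cong: if_cong)
  next
    case False
    have "(\<Prod>j\<in>UNIV - {i}. entry (R t) j (p j)) = 0" for i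
    proof -
      \<comment> \<open>A permutation that moves a point moves at least two, so a zero factor
        remains after \<open>i\<close> is left out.\<close>
      obtain j where "j \<noteq> i" "p j \<noteq> j"
      proof (rule ccontr)
        assume "\<not> thesis"
        with that have *: "\<And>j. j \<noteq> i \<Longrightarrow> p j = j" by blast
        moreover have "p i = i"
          using * permutes_inj[OF p] by (metis injD)
        ultimately have "p = id" by (metis eq_id_iff)
        with False show False ..
      qed
      then show ?thesis
        by (intro prod_zero) (auto simp: one intro!: bexI[of _ j])
    qed
    then show ?thesis
      using False by (simp only: mult_zero_right sum.neutral_const if_False)
  qed
  have "(\<Sum>p\<in>{p. p permutes UNIV}. of_int (sign p) *
      (\<Sum>i\<in>UNIV. ?D p i y * (\<Prod>j\<in>UNIV - {i}. entry (R t) j (p j)))) = inner 1 X * y" for y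
  proof -
    have "(\<Sum>p\<in>{p. p permutes UNIV}. of_int (sign p) *
      (\<Sum>i\<in>UNIV. ?D p i y * (\<Prod>j\<in>UNIV - {i}. entry (R t) j (p j)))) =
      (\<Sum>p\<in>{p. p permutes (UNIV :: 'a set)}. if p = id then y * inner 1 X else 0)"
      by (intro sum.cong refl) (use off in \<open>auto simp: sign_id\<close>)
    also have "\<dots> = inner 1 X * y"
      by (simp add: permutes_id finite_permutations mult.commute)
    finally show ?thesis .
  qed
  then show ?thesis
    unfolding has_field_derivative_def by (intro has_derivative_eq_rhs[OF der] ext)
qed

text \<open>Jacobi's formula, reduced to the identity matrix by multiplying with the inverse
  \<open>B\<close> of \<open>R t\<close>.\<close>

lemma mdet_has_derivative:
  assumes R: "(R has_vector_derivative R t * X) (at t within S)" and inv: "B * R t = 1"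
  shows "((\<lambda>\<tau>. mdet (R \<tau>)) has_real_derivative mdet (R t) * inner 1 X) (at t within S)"
proof -
  have "((\<lambda>\<tau>. B * R \<tau>) has_vector_derivative X) (at t within S)"
    using has_vector_derivative_mult_right[OF R, of B] inv by (simp add: mult.assoc[symmetric])
  from mdet_has_derivative_at_one[OF this inv]
  have "((\<lambda>\<tau>. mdet (R t) * mdet (B * R \<tau>)) has_real_derivative mdet (R t) * inner 1 X) (at t within S)"
    by (rule DERIV_cmult)
  moreover have "mdet (R t) * mdet B = 1"
    using inv by (metis mdet_mult mdet_one mult.commute)
  then have "mdet (R t) * mdet (B * R \<tau>) = mdet (R \<tau>)" for \<tau>
    by (simp add: mdet_mult mult.assoc[symmetric])
  ultimately show ?thesis by simp
qed

lemma has_vector_derivative_constant_on: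
  fixes f :: "real \<Rightarrow> 'a::real_normed_vector"
  assumes "\<And>t. t \<in> {0..1} \<Longrightarrow> (f has_vector_derivative 0) (at t within {0..1})"
    and "t \<in> {0..1}"
  shows "f t = f 0"
proof -
  obtain c where "\<And>x. x \<in> {0..1} \<Longrightarrow> f x = c"
    using has_vector_derivative_zero_constant[OF _ assms(1)] by auto
  with assms(2) show ?thesis by auto
qed

text \<open>Squaring before taking \<open>ln\<close> admits determinants of either sign.\<close>

lemma ln_square_has_real_derivative:
  assumes "(g has_real_derivative g t * K) (at t within S)" "g t \<noteq> 0"
  shows "((\<lambda>\<tau>. ln ((g \<tau>)\<^sup>2)) has_real_derivative 2 * K) (at t within S)"
proof -
  have "((\<lambda>\<tau>. (g \<tau>)\<^sup>2) has_real_derivative 2 * g t * (g t * K)) (at t within S)"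
    by (rule derivative_eq_intros assms refl)+ simp
  moreover have "(g t)\<^sup>2 > 0"
    using assms(2) by simp
  ultimately have "((\<lambda>\<tau>. ln ((g \<tau>)\<^sup>2)) has_real_derivative inverse ((g t)\<^sup>2) * (2 * g t * (g t * K))) (at t within S)"
    by (intro DERIV_chain2[OF DERIV_ln])
  then show ?thesis
    using assms(2) by (simp add: power2_eq_square field_simps)
qed

text \<open>
  \<open>F q\<close> is \<open>tr (C log (q\<^sup>T q))\<close> for \<open>q\<close> commuting with the symmetric matrix \<open>C\<close>; writing it
  with determinants on the eigenspaces of \<open>C\<close> makes it visibly differentiable along curves.
\<close>

lemma weighted_log_det:
  fixes C :: "'k::finite mtx"
  assumes C: "adj C = C"
  obtains F :: "'k mtx \<Rightarrow> real" where "F 1 = 0"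
    "\<And>r s m t S. (r has_vector_derivative r t * m) (at t within S) \<Longrightarrow> r t * s = 1 \<Longrightarrow>
      s * C = C * s \<Longrightarrow> m * C = C * m \<Longrightarrow>
      ((\<lambda>\<tau>. F (r \<tau>)) has_real_derivative 2 * inner C m) (at t within S)"
proof -
  obtain Q c where Q: "spectral C Q c" using C by (rule spectral_theorem)
  define E where "E \<mu> = fsym (\<lambda>x. of_bool (x = \<mu>)) C" for \<mu>
  have EE: "E \<mu> * E \<mu> = E \<mu>" for \<mu>
    unfolding E_def using spectral_fsym[OF Q, of "\<lambda>x. of_bool (x = \<mu>)"]
    by (intro spectral_unique[OF spectral_mult]) (auto simp: o_def of_bool_conj[symmetric])
  have EE': "E \<mu> * (E \<mu> * Y) = E \<mu> * Y" for \<mu> Y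
    by (simp add: mult.assoc[symmetric] EE)
  have comm: "Y * E \<mu> = E \<mu> * Y" if "Y * C = C * Y" for Y \<mu>
    unfolding E_def by (rule fsym_intertwine[OF C C that])
  have sumE: "(\<Sum>\<mu>\<in>range c. \<mu> *\<^sub>R E \<mu>) = C"
  proof -
    have "E \<mu> = Q * diag (\<lambda>i. of_bool (c i = \<mu>)) * adj Q" for \<mu>
      using spectral_fsym[OF Q, of "\<lambda>x. of_bool (x = \<mu>)"] by (simp add: E_def spectral_def o_def)
    then have "(\<Sum>\<mu>\<in>range c. \<mu> *\<^sub>R E \<mu>) = Q * (\<Sum>\<mu>\<in>range c. \<mu> *\<^sub>R diag (\<lambda>i. of_bool (c i = \<mu>))) * adj Q"
      by (simp add: sum_distrib_left sum_distrib_right)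
    also have "(\<Sum>\<mu>\<in>range c. \<mu> *\<^sub>R diag (\<lambda>i. of_bool (c i = \<mu>))) = diag c"
      by (auto simp: mtx_eq_iff entry_sum of_bool_def if_distrib[of "\<lambda>x. _ * x"] cong: if_cong)
    finally show ?thesis using Q by (simp add: spectral_def)
  qed
  \<comment> \<open>For \<open>q\<close> commuting with \<open>C\<close> the determinant is that of
    \<open>q\<close> on the eigenspace of \<open>C\<close> for \<mu>, since
    \<open>1 - E \<mu>\<close> fills in the identity on the other eigenspaces.\<close>
  define F where "F q = (\<Sum>\<mu>\<in>range c. \<mu> * ln ((mdet (q * E \<mu> + (1 - E \<mu>)))\<^sup>2))" for q
  have "F 1 = 0"
    by (simp add: F_def)
  moreover have "((\<lambda>\<tau>. F (r \<tau>)) has_real_derivative 2 * inner C m) (at t within S)"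
    if r: "(r has_vector_derivative r t * m) (at t within S)" and inv: "r t * s = 1"
      and s: "s * C = C * s" and m: "m * C = C * m" for r s m t S
  proof -
    have "((\<lambda>\<tau>. \<mu> * ln ((mdet (r \<tau> * E \<mu> + (1 - E \<mu>)))\<^sup>2)) has_real_derivative
        \<mu> * (2 * inner 1 (m * E \<mu>))) (at t within S)" for \<mu>
    proof -
      let ?R = "\<lambda>\<tau>. r \<tau> * E \<mu> + (1 - E \<mu>)"
      have "((\<lambda>\<tau>. ?R \<tau>) has_vector_derivative r t * m * E \<mu> + 0) (at t within S)"
        by (intro has_vector_derivative_add has_vector_derivative_mult_left r has_vector_derivative_const)
      moreover have "r t * m * E \<mu> + 0 = ?R t * (m * E \<mu>)"
        using comm[OF m, of \<mu>] by (simp add: algebra_simps EE EE')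
      ultimately have R: "(?R has_vector_derivative ?R t * (m * E \<mu>)) (at t within S)"
        by simp
      have "?R t * (s * E \<mu> + (1 - E \<mu>)) = r t * s * E \<mu> + (1 - E \<mu>)"
        using comm[OF s, of \<mu>] by (simp add: algebra_simps EE EE')
      then have inv': "?R t * (s * E \<mu> + (1 - E \<mu>)) = 1"
        by (simp add: inv)
      have nz: "mdet (?R t) \<noteq> 0"
        using arg_cong[OF inv', of mdet] by (auto simp: mdet_mult)
      have "((\<lambda>\<tau>. ln ((mdet (?R \<tau>))\<^sup>2)) has_real_derivative 2 * inner 1 (m * E \<mu>)) (at t within S)"
        by (rule ln_square_has_real_derivative[OF mdet_has_derivative[OF R mtx_left_inverse[OF inv']] nz])
      then show ?thesis by (rule DERIV_cmult)
    qed
    then have "((\<lambda>\<tau>. F (r \<tau>)) has_real_derivative (\<Sum>\<mu>\<in>range c. \<mu> * (2 * inner 1 (m * E \<mu>)))) (at t within S)"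
      unfolding F_def by (intro DERIV_sum)
    also have "(\<Sum>\<mu>\<in>range c. \<mu> * (2 * inner 1 (m * E \<mu>))) = 2 * inner 1 (m * (\<Sum>\<mu>\<in>range c. \<mu> *\<^sub>R E \<mu>))"
      by (simp add: sum_distrib_left inner_sum_right mult_ac)
    also have "\<dots> = 2 * inner C m"
      unfolding sumE m using inner_mult_left[of C m 1] C by (simp add: inner_commute)
    finally show ?thesis .
  qed
  ultimately show ?thesis by (rule that)
qed

text \<open>The functional of \<open>weighted_log_det\<close> has derivative
  \<open>2 * inner C (m t) = 0\<close> along \<open>P\<close> and equals
  \<open>2 * inner C Y\<close> at \<open>mexp Y\<close>, so \<open>inner C X = 0\<close> carries
  over to \<open>Z\<close>.\<close>

lemma log_orthogonal_along_path:
  fixes C :: "'k::finite mtx"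
  assumes C: "adj C = C"
    and P: "\<And>t. t \<in> {0..1} \<Longrightarrow> (P has_vector_derivative P t * m t) (at t within {0..1})"
    and inv: "\<And>t. t \<in> {0..1} \<Longrightarrow> P t * s t = 1"
    and comm: "\<And>t. t \<in> {0..1} \<Longrightarrow> s t * C = C * s t" "\<And>t. t \<in> {0..1} \<Longrightarrow> m t * C = C * m t"
    and orth: "\<And>t. t \<in> {0..1} \<Longrightarrow> inner C (m t) = 0"
    and X: "P 0 = mexp X" "adj X = X" "X * C = C * X" "inner C X = 0"
    and Z: "P 1 = mexp Z" "adj Z = Z" "Z * C = C * Z"
  shows "inner C Z = 0"
proof -
  obtain F where F: "F 1 = 0"
    "\<And>r s m t S. (r has_vector_derivative r t * m) (at t within S) \<Longrightarrow> r t * s = 1 \<Longrightarrow>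
      s * C = C * s \<Longrightarrow> m * C = C * m \<Longrightarrow>
      ((\<lambda>\<tau>. F (r \<tau>)) has_real_derivative 2 * inner C m) (at t within S)"
    using weighted_log_det[OF C] by metis
  have Fexp: "F (mexp Y) = 2 * inner C Y" if Y: "adj Y = Y" "Y * C = C * Y" for Y
  proof -
    \<comment> \<open>Along the ray \<open>mexp (\<tau> *\<^sub>R Y)\<close> the velocity is
      constantly \<open>Y\<close>; subtracting the expected linear function leaves a
      constant.\<close>
    have "((\<lambda>\<tau>. F (mexp (\<tau> *\<^sub>R Y)) - \<tau> * (2 * inner C Y)) has_real_derivative 2 * inner C Y - 1 * (2 * inner C Y))
        (at t within {0..1})" for t
    proof (intro DERIV_diff DERIV_cmult_right DERIV_ident F(2))
      show "((\<lambda>\<tau>. mexp (\<tau> *\<^sub>R Y)) has_vector_derivative mexp (t *\<^sub>R Y) * Y) (at t within {0..1})"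
        by (rule mexp_has_vector_derivative[OF Y(1)])
      show "mexp (t *\<^sub>R Y) * mexp (- (t *\<^sub>R Y)) = 1"
        using Y by (simp add: mexp_inverse)
      show "mexp (- (t *\<^sub>R Y)) * C = C * mexp (- (t *\<^sub>R Y))"
        using Y by (intro mexp_commute) auto
    qed (rule Y)
    then have "((\<lambda>\<tau>. F (mexp (\<tau> *\<^sub>R Y)) - \<tau> * (2 * inner C Y)) has_vector_derivative 0) (at t within {0..1})" for t
      by (simp add: has_real_derivative_iff_has_vector_derivative)
    from has_vector_derivative_constant_on[OF this, of 1] show ?thesis
      using F(1) by simp
  qed
  have "((\<lambda>\<tau>. F (P \<tau>)) has_vector_derivative 0) (at t within {0..1})" if "t \<in> {0..1}" for t
    using F(2)[OF P[OF that] inv[OF that] comm(1)[OF that] comm(2)[OF that]] orth[OF that]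
    by (simp add: has_real_derivative_iff_has_vector_derivative)
  from has_vector_derivative_constant_on[OF this, of 1] show ?thesis
    using Fexp[OF X(2,3)] Fexp[OF Z(2,3)] X Z by simp
qed

section \<open>Differentiating square roots\<close>

text \<open>In the pairing with \<open>D\<close>, right multiplication by \<open>mexp B\<close>
  contributes a nonnegative term, which is dropped. So the constant depends on \<open>A\<close>
  alone, as the estimate for square roots requires, where \<open>B\<close> varies along a
  curve.\<close>

lemma sylvester_bound:
  assumes A: "adj A = A"
  obtains c where "c > 0" "\<And>B D. adj B = B \<Longrightarrow> c * norm D \<le> norm (mexp A * D + D * mexp B)"
proof -
  obtain c where c: "c > 0" "\<And>X. c * (norm X)\<^sup>2 \<le> inner X (mexp A * X)"
    using mexp_lower_bound[OF A] by metis
  have "c * norm D \<le> norm (mexp A * D + D * mexp B)" if B: "adj B = B" for B D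
  proof -
    obtain b where b: "b > 0" "\<And>X. b * (norm X)\<^sup>2 \<le> inner X (X * mexp B)"
      using mexp_lower_bound[OF B] by metis
    have "0 \<le> inner D (D * mexp B)"
      by (rule order_trans[OF _ b(2)]) (use b(1) in simp)
    then have "norm D * (c * norm D) \<le> inner D (mexp A * D + D * mexp B)"
      using c(2)[of D] by (simp add: inner_add_right power2_eq_square mult_ac)
    also have "\<dots> \<le> norm D * norm (mexp A * D + D * mexp B)"
      by (rule norm_cauchy_schwarz)
    finally show ?thesis
      by (cases "D = 0") simp_all
  qed
  with c(1) that show ?thesis by blast
qed

text \<open>Implicit differentiation of \<open>p * p = P\<close>, whose linearization is the
  Sylvester equation for \<open>Y\<close>. Nothing is assumed about the continuity of
  \<open>Z\<close>: the uniform Sylvester bound controls increments of \<open>p\<close> by those of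
  \<open>P\<close>.\<close>

lemma mexp_sqrt_has_vector_derivative:
  assumes sym: "\<And>\<tau>. \<tau> \<in> S \<Longrightarrow> adj (Z \<tau>) = Z \<tau>" and sq: "\<And>\<tau>. \<tau> \<in> S \<Longrightarrow> P \<tau> = mexp (Z \<tau>) * mexp (Z \<tau>)"
    and t: "t \<in> S" and P: "(P has_vector_derivative P') (at t within S)"
    and Y: "mexp (Z t) * Y + Y * mexp (Z t) = P'"
  shows "((\<lambda>\<tau>. mexp (Z \<tau>)) has_vector_derivative Y) (at t within S)"
proof -
  define p where "p \<tau> = mexp (Z \<tau>)" for \<tau>
  obtain c where c: "c > 0" and
    syl: "\<And>B D. adj B = B \<Longrightarrow> c * norm D \<le> norm (p t * D + D * mexp B)"
    unfolding p_def using sylvester_bound[OF sym[OF t]] by metis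
  let ?N = "\<lambda>\<tau>. norm (P \<tau> - P t - (\<tau> - t) *\<^sub>R P')"
  \<comment> \<open>For the increment \<open>D\<close> of \<open>p\<close> one has
    \<open>P \<tau> - P t = p t * D + D * p \<tau>\<close>, to which the Sylvester bound
    applies.\<close>
  have lip: "c * norm (p \<tau> - p t) \<le> norm (P \<tau> - P t)" if "\<tau> \<in> S" for \<tau>
    using syl[OF sym[OF that], of "p \<tau> - p t"] sq[OF that] sq[OF t]
    by (simp add: p_def algebra_simps)
  \<comment> \<open>The factor \<open>c\<^sup>2\<close> turns the quadratic error into the square of
    \<open>c * norm ?D\<close>, which \<open>lip\<close> bounds without divisions.\<close>
  have rem: "c ^ 3 * norm (p \<tau> - p t - (\<tau> - t) *\<^sub>R Y) \<le> c\<^sup>2 * ?N \<tau> + (norm (P \<tau> - P t))\<^sup>2" if "\<tau> \<in> S" for \<tau>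
  proof -
    let ?D = "p \<tau> - p t" and ?R = "p \<tau> - p t - (\<tau> - t) *\<^sub>R Y"
    have "p t * ?R + ?R * p t = (P \<tau> - P t - (\<tau> - t) *\<^sub>R P') - ?D * ?D"
      using sq[OF that] sq[OF t] by (simp add: p_def Y[symmetric] algebra_simps)
    then have "c * norm ?R \<le> norm ((P \<tau> - P t - (\<tau> - t) *\<^sub>R P') - ?D * ?D)"
      using syl[OF sym[OF t], of ?R] by (simp add: p_def)
    also have "\<dots> \<le> ?N \<tau> + norm ?D * norm ?D"
      by (rule order_trans[OF norm_triangle_ineq4]) (simp add: norm_mult_ineq)
    finally have "c\<^sup>2 * (c * norm ?R) \<le> c\<^sup>2 * (?N \<tau> + norm ?D * norm ?D)"
      by (rule mult_left_mono) simp
    also have "\<dots> = c\<^sup>2 * ?N \<tau> + (c * norm ?D)\<^sup>2"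
      by (simp add: power2_eq_square algebra_simps)
    also have "\<dots> \<le> c\<^sup>2 * ?N \<tau> + (norm (P \<tau> - P t))\<^sup>2"
      using lip[OF that] c by (intro add_left_mono power_mono) auto
    finally show ?thesis by (simp add: power2_eq_square power3_eq_cube mult_ac)
  qed
  have PN: "\<forall>\<^sub>F \<tau> in at t within S. ?N \<tau> \<le> e * norm (\<tau> - t)" if "e > 0" for e
    using P that unfolding has_vector_derivative_def has_derivative_within_alt2 by blast
  define L where "L = 1 + norm P'"
  have L: "L > 0" by (simp add: L_def add_pos_nonneg)
  have "\<forall>\<^sub>F \<tau> in at t within S. norm (p \<tau> - p t - (\<tau> - t) *\<^sub>R Y) \<le> e * norm (\<tau> - t)" if e: "e > 0" for e
  proof -
    have ce: "c * e / 2 > 0" using c e by simp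
    \<comment> \<open>Within this radius the quadratic error contributes at most half of
      \<open>c ^ 3 * e\<close> per unit of distance; the other half is left for the remainder of
      \<open>P\<close>.\<close>
    have "\<forall>\<^sub>F \<tau> in at t within S. norm (\<tau> - t) < c ^ 3 * e / (2 * L\<^sup>2)"
      unfolding eventually_at using e c L
      by (intro exI[of _ "c ^ 3 * e / (2 * L\<^sup>2)"]) (auto simp: dist_norm)
    moreover have "\<forall>\<^sub>F \<tau> in at t within S. \<tau> \<in> S"
      by (simp add: eventually_at_filter)
    ultimately show ?thesis
      using PN[OF ce] PN[OF zero_less_one]
    proof (eventually_elim)
      case (elim \<tau>)
      have "norm (P \<tau> - P t) \<le> ?N \<tau> + norm ((\<tau> - t) *\<^sub>R P')"
        by (metis diff_add_cancel norm_triangle_ineq)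
      also have "\<dots> \<le> L * norm (\<tau> - t)"
        using elim(4) by (simp add: L_def distrib_right mult.commute[of _ "norm P'"])
      finally have "(norm (P \<tau> - P t))\<^sup>2 \<le> (L * norm (\<tau> - t))\<^sup>2"
        by (rule power_mono) simp
      also have "\<dots> = (L\<^sup>2 * norm (\<tau> - t)) * norm (\<tau> - t)"
        by (simp add: power2_eq_square)
      also have "\<dots> \<le> (c ^ 3 * e / 2) * norm (\<tau> - t)"
        using elim(1) L by (intro mult_right_mono) (simp_all add: field_simps)
      finally have "c ^ 3 * norm (p \<tau> - p t - (\<tau> - t) *\<^sub>R Y) \<le> c\<^sup>2 * (c * e / 2 * norm (\<tau> - t)) + (c ^ 3 * e / 2) * norm (\<tau> - t)"
        using elim(3) c e
        by (intro order_trans[OF rem[OF elim(2)]] add_mono mult_left_mono) auto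
      also have "\<dots> = c ^ 3 * (e * norm (\<tau> - t))"
        by (simp add: power2_eq_square power3_eq_cube algebra_simps)
      finally show ?case using c by simp
    qed
  qed
  then show ?thesis
    unfolding has_vector_derivative_def has_derivative_within_alt2 p_def
    by (simp add: bounded_linear_scaleR_left)
qed

section \<open>Curves tangent to a closed group\<close>

text \<open>For fixed \<open>e\<close> the last time at which \<open>f t \<le> e * t\<close> must be
  1, since the slope condition would produce a later one. Hence \<open>f 1 \<le> e\<close> for every
  positive \<open>e\<close>.\<close>

lemma nonneg_zero_if_right_slope_le_zero:
  fixes f :: "real \<Rightarrow> real"
  assumes cont: "continuous_on {0..1} f" and zero: "f 0 = 0" and nonneg: "f 1 \<ge> 0"
    and slope: "\<And>t e. 0 \<le> t \<Longrightarrow> t < 1 \<Longrightarrow> e > 0 \<Longrightarrow> \<exists>\<tau>. t < \<tau> \<and> \<tau> \<le> 1 \<and> f \<tau> \<le> f t + e * (\<tau> - t)"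
  shows "f 1 = 0"
proof -
  have "f 1 \<le> e" if e: "e > 0" for e
  proof (rule ccontr)
    assume contra: "\<not> f 1 \<le> e"
    let ?A = "{t \<in> {0..1}. f t - e * t \<le> 0}"
    have "closed ?A"
      by (intro continuous_on_closed_Collect_le continuous_intros cont closed_real_atLeastAtMost)
    moreover have "bounded ?A"
      by (rule bounded_subset[of "{0..1}"]) auto
    ultimately have "compact ?A"
      by (simp add: compact_eq_bounded_closed)
    then obtain s where s: "s \<in> ?A" "\<And>t. t \<in> ?A \<Longrightarrow> t \<le> s"
      using compact_attains_sup[of ?A] zero by force
    then have "s < 1" using contra by (cases "s = 1") auto
    with s(1) slope[of s e] e obtain \<tau> where "s < \<tau>" "\<tau> \<le> 1" "f \<tau> \<le> f s + e * (\<tau> - s)" by auto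
    moreover from this s(1) have "\<tau> \<in> ?A" by (auto simp: algebra_simps)
    ultimately show False using s(2)[of \<tau>] by simp
  qed
  then have "f 1 \<le> 0" by (meson dense_ge)
  with nonneg show ?thesis by simp
qed

text \<open>The distance to \<open>H\<close> has right slope at most 0: a point \<open>u\<close>
  nearest to \<open>k t\<close> is carried along as \<open>u * c (\<tau> - t)\<close>, which follows
  \<open>k\<close> to first order. Only pointwise tangency enters, so the velocity \<open>a\<close>
  may be irregular and no uniqueness theorem for differential equations is involved.\<close>

lemma tangent_curve_in_closed_group:
  fixes H :: "'k::finite mtx set"
  assumes H: "closed H" "\<And>u. u \<in> H \<Longrightarrow> orth u" "\<And>u v. u \<in> H \<Longrightarrow> v \<in> H \<Longrightarrow> u * v \<in> H"
    and k: "\<And>t. t \<in> {0..1} \<Longrightarrow> (k has_vector_derivative k t * a t) (at t within {0..1})"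
    and a: "\<And>t. t \<in> {0..1} \<Longrightarrow> \<exists>c. (\<forall>\<tau>. c \<tau> \<in> H) \<and> c 0 = 1 \<and> (c has_vector_derivative a t) (at 0)"
    and k0: "k 0 \<in> H"
  shows "k 1 \<in> H"
proof -
  let ?f = "\<lambda>t. infdist (k t) H"
  have ne: "H \<noteq> {}" using k0 by auto
  have "?f 1 = 0"
  proof (rule nonneg_zero_if_right_slope_le_zero)
    have "continuous_on {0..1} k"
      using k by (rule continuous_on_vector_derivative)
    then show "continuous_on {0..1} ?f"
      by (rule continuous_on_infdist)
    show "?f 0 = 0" using k0 by simp
    show "?f 1 \<ge> 0" by (rule infdist_nonneg)
    fix t e :: real assume t: "0 \<le> t" "t < 1" and e: "e > 0"
    obtain c where c: "\<And>\<tau>. c \<tau> \<in> H" "c 0 = 1" "(c has_vector_derivative a t) (at 0)"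
      using a[of t] t by auto
    obtain u where u: "u \<in> H" "?f t = dist (k t) u"
      using infdist_attains_inf[OF H(1) ne] by metis
    have "((\<lambda>\<tau>. c (\<tau> - t)) has_vector_derivative a t) (at t within {0..1})"
    proof -
      have "((c \<circ> (\<lambda>\<tau>. \<tau> - t)) has_vector_derivative 1 *\<^sub>R a t) (at t within {0..1})"
      proof (rule vector_diff_chain_within)
        show "((\<lambda>\<tau>. \<tau> - t) has_vector_derivative 1) (at t within {0..1})"
          unfolding has_vector_derivative_diff_const by (rule has_vector_derivative_id)
        show "(c has_vector_derivative a t) (at (t - t) within (\<lambda>\<tau>. \<tau> - t) ` {0..1})"
          using has_vector_derivative_at_within[OF c(3)] by simp
      qed
      then show ?thesis by (simp add: o_def)
    qed
    from has_vector_derivative_diff[OF k has_vector_derivative_mult_right[OF this, of "k t"]]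
    have "((\<lambda>\<tau>. k \<tau> - k t * c (\<tau> - t)) has_vector_derivative 0) (at t within {0..1})"
      using t by simp
    then obtain d where d: "d > 0" "\<And>\<tau>. \<tau> \<in> {0..1} \<Longrightarrow> norm (\<tau> - t) < d \<Longrightarrow>
        norm (k \<tau> - k t * c (\<tau> - t)) \<le> e * norm (\<tau> - t)"
      using e unfolding has_vector_derivative_def has_derivative_within_alt by (auto simp: c(2))
    define \<tau> where "\<tau> = min 1 (t + d / 2)"
    have \<tau>: "t < \<tau>" "\<tau> \<le> 1" "norm (\<tau> - t) < d" "\<tau> \<in> {0..1}"
      using t d(1) by (auto simp: \<tau>_def min_def)
    have "?f \<tau> \<le> dist (k \<tau>) (u * c (\<tau> - t))"
      by (rule infdist_le) (use H u c in auto)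
    also have "\<dots> \<le> norm (k \<tau> - k t * c (\<tau> - t)) + norm ((k t - u) * c (\<tau> - t))"
    proof -
      have "k \<tau> - u * c (\<tau> - t) = (k \<tau> - k t * c (\<tau> - t)) + (k t - u) * c (\<tau> - t)"
        by (simp add: left_diff_distrib)
      then show ?thesis
        unfolding dist_norm by (metis norm_triangle_ineq)
    qed
    \<comment> \<open>Right multiplication by the orthogonal matrix \<open>c (\<tau> - t)\<close>
      preserves the norm.\<close>
    also have "norm ((k t - u) * c (\<tau> - t)) = ?f t"
      using H(2)[OF c(1)] u(2) by (simp add: norm_orth_mult dist_norm)
    also have "norm (k \<tau> - k t * c (\<tau> - t)) \<le> e * (\<tau> - t)"
      using d(2)[OF \<tau>(4,3)] \<tau>(1) by simp
    finally show "\<exists>\<tau>>t. \<tau> \<le> 1 \<and> ?f \<tau> \<le> ?f t + e * (\<tau> - t)"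
      using \<tau> by (intro exI[of _ \<tau>]) simp
  qed
  then show ?thesis
    using in_closed_iff_infdist_zero[OF H(1) ne] by blast
qed

section \<open>Polar decomposition in a self-adjoint group\<close>

lemma linear_inj_on_subspace_surj:
  fixes T :: "'a::euclidean_space \<Rightarrow> 'a"
  assumes T: "linear T" and M: "subspace M" "\<And>x. x \<in> M \<Longrightarrow> T x \<in> M"
    and inj: "\<And>x. x \<in> M \<Longrightarrow> T x = 0 \<Longrightarrow> x = 0"
  shows "T ` M = M"
proof (rule subspace_dim_equal)
  have "inj_on T (span M)"
    using T M(1) inj by (subst linear_inj_on_iff_eq_0) (auto simp: span_eq_iff[THEN iffD2])
  then show "dim (T ` M) \<ge> dim M"
    using dim_image_eq[OF T] by simp
qed (use T M in \<open>auto simp: linear_subspace_image\<close>)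

text \<open>\<open>M\<close> will be the image of the Lie algebra and \<open>H\<close> the image of
  \<open>U\<close>. The group itself does not occur, which admits paths that are not known to come
  from group elements, such as products of exponentials. \<open>H_tangent\<close> supplies just the
  curves that the distance argument consumes.\<close>

locale self_adjoint_group =
  fixes M H :: "'k::finite mtx set"
  assumes subspace_M: "subspace M"
    and adj_M: "X \<in> M \<Longrightarrow> adj X \<in> M"
    and bracket_M: "X \<in> M \<Longrightarrow> Y \<in> M \<Longrightarrow> X * Y - Y * X \<in> M"
    and H_closed: "closed H"
    and H_orth: "u \<in> H \<Longrightarrow> orth u"
    and H_one: "1 \<in> H"
    and H_mult: "u \<in> H \<Longrightarrow> w \<in> H \<Longrightarrow> u * w \<in> H"
    and H_adj: "u \<in> H \<Longrightarrow> adj u \<in> H"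
    and H_M: "u \<in> H \<Longrightarrow> X \<in> M \<Longrightarrow> u * X * adj u \<in> M"
    and H_tangent: "X \<in> M \<Longrightarrow> adj X = - X \<Longrightarrow>
      \<exists>c. (\<forall>t. c t \<in> H) \<and> c 0 = 1 \<and> (c has_vector_derivative X) (at 0)"
begin

definition sym_part :: "'k mtx set" where
  "sym_part = {X \<in> M. adj X = X}"

definition polar_set :: "'k mtx set" where
  "polar_set = {u * mexp X | u X. u \<in> H \<and> X \<in> sym_part}"

text \<open>\<open>s\<close> is the inverse of \<open>r\<close>, and \<open>m\<close> is the left
  logarithmic derivative of \<open>r\<close>. Invariance of \<open>M\<close> under conjugation is
  part of the notion because the path is not tied to a group that would guarantee it.\<close>

definition tangent_path :: "(real \<Rightarrow> 'k mtx) \<Rightarrow> (real \<Rightarrow> 'k mtx) \<Rightarrow> (real \<Rightarrow> 'k mtx) \<Rightarrow> bool" where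
  "tangent_path r s m \<longleftrightarrow> (\<forall>t\<in>{0..1}.
     (r has_vector_derivative r t * m t) (at t within {0..1}) \<and>
     (s has_vector_derivative - (m t * s t)) (at t within {0..1}) \<and>
     r t * s t = 1 \<and> m t \<in> M \<and> (\<forall>X\<in>M. r t * X * s t \<in> M \<and> s t * X * r t \<in> M))"

lemma M_closed:
  "X \<in> M \<Longrightarrow> Y \<in> M \<Longrightarrow> X + Y \<in> M" "X \<in> M \<Longrightarrow> Y \<in> M \<Longrightarrow> X - Y \<in> M"
  "X \<in> M \<Longrightarrow> c *\<^sub>R X \<in> M" "X \<in> M \<Longrightarrow> - X \<in> M"
  using subspace_M by (auto intro: subspace_add subspace_diff subspace_scale subspace_neg)

lemma sym_partD: "X \<in> sym_part \<Longrightarrow> X \<in> M" "X \<in> sym_part \<Longrightarrow> adj X = X"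
  by (auto simp: sym_part_def)

lemma sym_part_scaleR: "X \<in> sym_part \<Longrightarrow> c *\<^sub>R X \<in> sym_part"
  by (auto simp: sym_part_def M_closed)

lemma sym_part_uminus: "X \<in> sym_part \<Longrightarrow> - X \<in> sym_part"
  by (auto simp: sym_part_def M_closed)

lemma sym_part_conj: "u \<in> H \<Longrightarrow> X \<in> sym_part \<Longrightarrow> u * X * adj u \<in> sym_part"
  using H_M[of u X] by (auto simp: sym_part_def mult.assoc)

lemma mexp_conj_M:
  assumes "Z \<in> sym_part" "X \<in> M"
  shows "mexp Z * X * mexp (- Z) \<in> M"
  using assms by (intro bracket_mexp_invariant subspace_M bracket_M) (auto simp: sym_part_def)

lemma tangent_pathD:
  assumes "tangent_path r s m" "t \<in> {0..1}"
  shows "(r has_vector_derivative r t * m t) (at t within {0..1})"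
    "(s has_vector_derivative - (m t * s t)) (at t within {0..1})"
    "r t * s t = 1" "s t * r t = 1" "m t \<in> M"
    "X \<in> M \<Longrightarrow> r t * X * s t \<in> M" "X \<in> M \<Longrightarrow> s t * X * r t \<in> M"
  using assms mtx_left_inverse[of "r t" "s t"] by (auto simp: tangent_path_def)

text \<open>Serves to restrict a path to an initial segment and to run it backwards.\<close>

lemma tangent_path_affine:
  assumes path: "tangent_path r s m" and img: "(\<lambda>t. a + c * t) ` {0..1} \<subseteq> {0..1}"
  shows "tangent_path (\<lambda>t. r (a + c * t)) (\<lambda>t. s (a + c * t)) (\<lambda>t. c *\<^sub>R m (a + c * t))"
  unfolding tangent_path_def
proof (intro ballI)
  fix t :: real assume t: "t \<in> {0..1}"
  then have ct: "a + c * t \<in> {0..1}" using img by blast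
  have chain: "((\<lambda>t. f (a + c * t)) has_vector_derivative c *\<^sub>R f') (at t within {0..1})"
    if "(f has_vector_derivative f') (at (a + c * t) within {0..1})" for f :: "real \<Rightarrow> 'k mtx" and f'
  proof -
    have "((\<lambda>t. a + c * t) has_vector_derivative c) (at t within {0..1})"
      by (auto intro!: derivative_eq_intros)
    from vector_diff_chain_within[OF this has_vector_derivative_within_subset[OF that img]]
    show ?thesis by (simp add: o_def)
  qed
  note D = tangent_pathD[OF path ct]
  show "((\<lambda>t. r (a + c * t)) has_vector_derivative r (a + c * t) * c *\<^sub>R m (a + c * t)) (at t within {0..1}) \<and>
      ((\<lambda>t. s (a + c * t)) has_vector_derivative - (c *\<^sub>R m (a + c * t) * s (a + c * t))) (at t within {0..1}) \<and>
      r (a + c * t) * s (a + c * t) = 1 \<and> c *\<^sub>R m (a + c * t) \<in> M \<and>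
      (\<forall>X\<in>M. r (a + c * t) * X * s (a + c * t) \<in> M \<and> s (a + c * t) * X * r (a + c * t) \<in> M)"
    using chain[OF D(1)] chain[OF D(2)] D(3,5-7) by (simp add: M_closed)
qed

lemma gram_has_vector_derivative:
  assumes "tangent_path r s m" "t \<in> {0..1}"
  shows "((\<lambda>t. adj (r t) * r t) has_vector_derivative adj (m t) * (adj (r t) * r t) + adj (r t) * r t * m t)
    (at t within {0..1})"
proof -
  note D = tangent_pathD[OF assms]
  have "((\<lambda>t. adj (r t) * r t) has_vector_derivative
      adj (r t) * (r t * m t) + adj (r t * m t) * r t) (at t within {0..1})"
    by (intro has_vector_derivative_mult bounded_linear.has_vector_derivative[OF bounded_linear_adj] D(1))
  then show ?thesis by (simp add: mult.assoc add.commute)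
qed

text \<open>
  The component \<open>C\<close> of \<open>Z\<close> orthogonal to \<open>M\<close> centralizes \<open>M\<close>, hence commutes with the path,
  and the derivative of \<open>tr (C log (r\<^sup>T r))\<close> along the path vanishes because \<open>C\<close> is orthogonal to \<open>M\<close>.
\<close>

lemma gram_log_mem_end:
  assumes path: "tangent_path r s m" and X: "r 0 = mexp X" "X \<in> sym_part"
    and Z: "adj Z = Z" "mexp Z = adj (r 1) * r 1"
  shows "Z \<in> M"
proof -
  note D = tangent_pathD[OF path]
  let ?P = "\<lambda>t. adj (r t) * r t" and ?Pi = "\<lambda>t. s t * adj (s t)"
  have assoc1: "r t * (s t * Y) = Y" "s t * (r t * Y) = Y" if "t \<in> {0..1}" for t Y
    using D(3,4)[OF that] by (simp_all add: mult.assoc[symmetric])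
  have adj1: "adj (s t) * adj (r t) = 1" "adj (r t) * adj (s t) = 1" if "t \<in> {0..1}" for t
    using arg_cong[OF D(3)[OF that], of adj] arg_cong[OF D(4)[OF that], of adj] by simp_all
  have PPi: "?P t * ?Pi t = 1" if "t \<in> {0..1}" for t
    using that by (simp add: mult.assoc assoc1 adj1)
  have mexp_mZ: "mexp (- Z) = ?Pi 1"
  proof -
    have "mexp (- Z) = mexp (- Z) * (?P 1 * ?Pi 1)" using PPi[of 1] by simp
    also have "\<dots> = ?Pi 1"
      unfolding Z(2)[symmetric] mult.assoc[of "mexp Z", symmetric]
      by (simp add: mult.assoc[symmetric] mexp_inverse[OF Z(1)])
    finally show ?thesis .
  qed
  \<comment> \<open>Conjugation by \<open>adj (r 1) * r 1\<close> is composed of two conjugations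
    along the path and two transpositions, each of which preserves \<open>M\<close>.\<close>
  have "mexp Z * Y * mexp (- Z) \<in> M" if "Y \<in> M" for Y
  proof -
    have "adj (s 1 * adj (r 1 * Y * s 1) * r 1) \<in> M"
      by (intro adj_M D(6,7) that) auto
    then show ?thesis unfolding mexp_mZ Z(2) by (simp add: mult.assoc)
  qed
  then have ZM: "Z * Y - Y * Z \<in> M" if "Y \<in> M" for Y
    using conj_mexp_invariant(1)[OF Z(1) subspace_M] that by blast
  obtain W C where "W \<in> span M" "\<And>w. w \<in> span M \<Longrightarrow> orthogonal C w" and WC: "Z = W + C"
    using orthogonal_subspace_decomp_exists[of M Z] by metis
  then have W: "W \<in> M" and C: "\<And>w. w \<in> M \<Longrightarrow> inner C w = 0"
    using subspace_M by (auto simp: span_eq_iff[THEN iffD2] orthogonal_def)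
  have adjC: "adj C = C"
  proof -
    \<comment> \<open>The left side lies in \<open>M\<close>, while \<open>C\<close> and
      \<open>adj C\<close> are orthogonal to \<open>M\<close>; so this matrix is orthogonal to
      itself.\<close>
    have *: "W - adj W = adj C - C"
      using Z(1) WC by (simp add: algebra_simps)
    have "W - adj W \<in> M" using W by (intro M_closed adj_M)
    then have "inner C (W - adj W) = 0" "inner C (adj (W - adj W)) = 0"
      using C adj_M by blast+
    then have "inner (adj C - C) (W - adj W) = 0"
      using inner_adj_adj[of "adj C" "W - adj W"] by (simp add: inner_diff_left)
    then show ?thesis unfolding * by simp
  qed
  have CM: "Y * C = C * Y" if Y: "Y \<in> M" for Y
  proof -
    let ?B = "C * Y - Y * C"
    have "?B = (Z * Y - Y * Z) - (W * Y - Y * W)"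
      by (simp add: WC algebra_simps)
    then have B: "?B \<in> M"
      using ZM[OF Y] bracket_M[OF W Y] by (metis M_closed(2))
    \<comment> \<open>Moving \<open>Y\<close> across the trace form exhibits the squared norm of the
      commutator as \<open>C\<close> paired with a bracket in \<open>M\<close>.\<close>
    have "inner ?B ?B = inner C (?B * adj Y - adj Y * ?B)"
      using inner_mult_right[of C Y ?B] inner_mult_left[of Y C ?B]
      by (simp only: inner_diff_left inner_diff_right)
    also have "\<dots> = 0"
      by (intro C bracket_M B adj_M Y)
    finally show ?thesis by simp
  qed
  have XC: "X * C = C * X" and mXC: "mexp X * C = C * mexp X"
    using CM X(2) by (auto simp: sym_part_def intro: mexp_commute)
  have rC: "r t * C = C * r t" and sC: "s t * C = C * s t" if t: "t \<in> {0..1}" for t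
  proof -
    \<comment> \<open>\<open>C\<close> commutes with every velocity, so this conjugate of
      \<open>C\<close> is constant; it starts at \<open>C\<close> because \<open>X\<close> commutes
      with \<open>C\<close>.\<close>
    have "((\<lambda>t. r t * C * s t) has_vector_derivative 0) (at t within {0..1})" if t: "t \<in> {0..1}" for t
    proof -
      have "((\<lambda>t. r t * C * s t) has_vector_derivative r t * C * - (m t * s t) + r t * m t * C * s t)
          (at t within {0..1})"
        by (intro has_vector_derivative_mult has_vector_derivative_mult_left D[OF t])
      then show ?thesis
        using CM[OF D(5)[OF t]] by (simp add: mult.assoc)
    qed
    from has_vector_derivative_constant_on[OF this t]
    have "r t * C * s t = r 0 * C * s 0" .
    also have "\<dots> = C"
      using D(3)[of 0] X mXC by (simp add: mult.assoc)
    finally have *: "r t * C * s t = C" .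
    show "r t * C = C * r t"
      using arg_cong[OF *, of "\<lambda>Y. Y * r t"] D(4)[OF t] by (simp add: mult.assoc)
    show "s t * C = C * s t"
      using arg_cong[OF *, of "\<lambda>Y. s t * Y"] D(4)[OF t] by (simp add: mult.assoc[symmetric])
  qed
  \<comment> \<open>The left logarithmic derivative of \<open>?P\<close>, with the transposed
    velocity brought into \<open>M\<close> by conjugations.\<close>
  let ?m = "\<lambda>t. s t * adj (r t * m t * s t) * r t + m t"
  have mM: "?m t \<in> M" if "t \<in> {0..1}" for t
    using D[OF that] by (intro M_closed D(7)[OF that] adj_M D(6)[OF that])
  have "inner C Z = 0"
  proof (rule log_orthogonal_along_path[where P = ?P and s = ?Pi and m = ?m and X = "2 *\<^sub>R X"])
    fix t :: real assume t: "t \<in> {0..1}"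
    have "?P t * ?m t = adj (m t) * ?P t + ?P t * m t"
      using adj1[OF t] by (simp add: algebra_simps assoc1[OF t]) (simp add: mult.assoc[symmetric] adj1[OF t])
    then show "(?P has_vector_derivative ?P t * ?m t) (at t within {0..1})"
      using gram_has_vector_derivative[OF path t] by simp
    show "?P t * ?Pi t = 1" by (rule PPi[OF t])
    have "adj (s t) * C = C * adj (s t)"
      using arg_cong[OF sC[OF t], of adj] adjC by simp
    then show "?Pi t * C = C * ?Pi t"
      using sC[OF t] by (metis mult.assoc)
    show "?m t * C = C * ?m t" by (rule CM[OF mM[OF t]])
    show "inner C (?m t) = 0" by (rule C[OF mM[OF t]])
  next
    show "?P 0 = mexp (2 *\<^sub>R X)"
      using X by (simp add: sym_part_def mexp_double)
    show "inner C (2 *\<^sub>R X) = 0"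
      using C X(2) by (simp add: sym_part_def)
    show "Z * C = C * Z"
      using CM[OF W] by (simp add: WC algebra_simps)
  qed (use X XC Z adjC in \<open>auto simp: sym_part_def\<close>)
  \<comment> \<open>\<open>W\<close> and \<open>C\<close> are orthogonal, so
    \<open>inner C Z\<close> is the squared norm of \<open>C\<close>.\<close>
  then have "C = 0"
    using C[OF W] by (simp add: WC inner_add_right)
  then show ?thesis using W WC by simp
qed

lemma gram_log_mem:
  assumes path: "tangent_path r s m" and X: "r 0 = mexp X" "X \<in> sym_part" and t: "t \<in> {0..1}"
    and Z: "adj Z = Z" "mexp Z = adj (r t) * r t"
  shows "Z \<in> M"
proof -
  have "(\<lambda>\<tau>. 0 + t * \<tau>) ` {0..1} \<subseteq> {0..1}" using t by (auto intro: mult_le_one)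
  from gram_log_mem_end[OF tangent_path_affine[OF path this]] show ?thesis using X Z by simp
qed

text \<open>Writing the unknown of a Sylvester equation for \<open>mexp Z\<close> as
  \<open>y * mexp Z\<close> gives this equation, which makes sense inside \<open>M\<close>. The
  Sylvester bound yields injectivity, hence surjectivity in finite dimension.\<close>

lemma conj_plus_id_surj:
  assumes Z: "Z \<in> sym_part" and R: "R \<in> M"
  obtains y where "y \<in> M" "mexp Z * y * mexp (- Z) + y = R"
proof -
  let ?T = "\<lambda>y. mexp Z * y * mexp (- Z) + y"
  have "?T ` M = M"
  proof (rule linear_inj_on_subspace_surj[OF _ subspace_M])
    show "linear ?T"
      by (rule linearI) (simp_all add: algebra_simps)
    show "?T y \<in> M" if "y \<in> M" for y
      by (intro M_closed mexp_conj_M Z that)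
    show "y = 0" if "?T y = 0" for y
    proof -
      have "?T y * mexp Z = mexp Z * y + y * mexp Z"
        using mexp_inverse[OF sym_partD(2)[OF Z]] by (simp add: algebra_simps)
      then have "mexp Z * y + y * mexp Z = 0" using that by simp
      moreover obtain c where "c > 0" "\<And>B D. adj B = B \<Longrightarrow> c * norm D \<le> norm (mexp Z * D + D * mexp B)"
        using sylvester_bound[OF sym_partD(2)[OF Z]] by metis
      ultimately have "c > 0" "c * norm y \<le> 0"
        using sym_partD(2)[OF Z] by (auto, metis norm_zero)
      then show ?thesis by (simp add: mult_le_0_iff)
    qed
  qed
  with R that show ?thesis by (metis (no_types, lifting) image_iff)
qed

lemma tangent_path_from_exp:
  assumes path: "tangent_path r s m" and X: "r 0 = mexp X" "X \<in> sym_part"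
  shows "r 1 \<in> polar_set"
proof -
  note D = tangent_pathD[OF path]
  have "\<exists>Z. adj Z = Z \<and> mexp Z = adj (r t) * r t" if "t \<in> {0..1}" for t
    using mexp_log_gram[OF D(3)[OF that]] by metis
  then obtain Z where Z: "\<And>t. t \<in> {0..1} \<Longrightarrow> adj (Z t) = Z t" "\<And>t. t \<in> {0..1} \<Longrightarrow> mexp (Z t) = adj (r t) * r t"
    by metis
  define z where "z t = (1/2) *\<^sub>R Z t" for t
  have z: "z t \<in> sym_part" if "t \<in> {0..1}" for t
    using gram_log_mem[OF path X that Z(1)[OF that] Z(2)[OF that]] Z(1)[OF that]
    by (simp add: z_def sym_part_def M_closed)
  have pp: "adj (r t) * r t = mexp (z t) * mexp (z t)" if "t \<in> {0..1}" for t
    using Z[OF that] by (simp add: z_def mexp_half)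
  \<comment> \<open>This is the orthogonal factor \<open>r t * mexp (- z t)\<close>, written so that
    its derivative needs only those of \<open>s\<close> and of \<open>mexp (z t)\<close>.\<close>
  define k where "k t = adj (s t) * mexp (z t)" for t
  have pq: "mexp (z t) * mexp (- z t) = 1" "mexp (- z t) * mexp (z t) = 1" if "t \<in> {0..1}" for t
    using mexp_inverse[OF sym_partD(2)[OF z[OF that]]] by auto
  have pq': "mexp (z t) * (mexp (- z t) * Y) = Y" "mexp (- z t) * (mexp (z t) * Y) = Y" if "t \<in> {0..1}" for t Y
    using pq[OF that] by (simp_all add: mult.assoc[symmetric])
  have adj1: "adj (s t) * adj (r t) = 1" "adj (r t) * adj (s t) = 1" if "t \<in> {0..1}" for t
    using arg_cong[OF D(3)[OF that], of adj] arg_cong[OF D(4)[OF that], of adj] by simp_all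
  have assoc1: "r t * (s t * Y) = Y" "s t * (r t * Y) = Y" if "t \<in> {0..1}" for t Y
    using D(3,4)[OF that] by (simp_all add: mult.assoc[symmetric])
  have adj2: "adj (s t) * (adj (r t) * Y) = Y" "adj (r t) * (adj (s t) * Y) = Y" if "t \<in> {0..1}" for t Y
    using adj1[OF that] by (simp_all add: mult.assoc[symmetric])
  have adjk: "adj (k t) = mexp (z t) * s t" if "t \<in> {0..1}" for t
    using sym_partD(2)[OF z[OF that]] by (simp add: k_def)
  have korth: "orth (k t)" if t: "t \<in> {0..1}" for t
  proof (rule orthI)
    have "s t * adj (s t) = mexp (- z t) * (mexp (- z t) * ((mexp (z t) * mexp (z t)) * (s t * adj (s t))))"
      by (simp add: mult.assoc pq'[OF t])
    also have "\<dots> = mexp (- z t) * mexp (- z t)"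
      unfolding pp[OF t, symmetric] by (simp add: mult.assoc assoc1[OF t] adj1[OF t])
    finally have "mexp (z t) * (s t * adj (s t)) * mexp (z t) = 1"
      by (simp add: mult.assoc pq'[OF t] pq[OF t])
    then show "adj (k t) * k t = 1"
      unfolding adjk[OF t] by (simp add: k_def mult.assoc)
  qed
  have "\<exists>a. a \<in> M \<and> (k has_vector_derivative k t * a) (at t within {0..1})" if t: "t \<in> {0..1}" for t
  proof -
    let ?P = "adj (r t) * r t"
    \<comment> \<open>The derivative of \<open>?P\<close> times the inverse of \<open>?P\<close>, in
      a form that visibly lies in \<open>M\<close>.\<close>
    define R where "R = adj (m t) + adj (s t * adj (r t * m t * s t) * r t)"
    have "R \<in> M"
      unfolding R_def by (intro M_closed adj_M D(5-7)[OF t])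
    then obtain y where y: "y \<in> M" "mexp (z t) * y * mexp (- z t) + y = R"
      using conj_plus_id_surj[OF z[OF t]] by metis
    have "mexp (z t) * (y * mexp (z t)) + y * mexp (z t) * mexp (z t) =
        (mexp (z t) * y * mexp (- z t) + y) * (mexp (z t) * mexp (z t))"
      by (simp add: algebra_simps pq'[OF t])
    also have "\<dots> = R * ?P"
      unfolding y(2) pp[OF t] ..
    also have "\<dots> = adj (m t) * ?P + ?P * m t"
      by (simp add: R_def algebra_simps adj2[OF t] assoc1[OF t] adj1[OF t] D(4)[OF t])
    finally have "((\<lambda>t. mexp (z t)) has_vector_derivative y * mexp (z t)) (at t within {0..1})"
      using t gram_has_vector_derivative[OF path t] z pp
      by (intro mexp_sqrt_has_vector_derivative[where P = "\<lambda>t. adj (r t) * r t"]) (auto dest: sym_partD)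
    then have "(k has_vector_derivative adj (s t) * (y * mexp (z t)) + adj (- (m t * s t)) * mexp (z t))
        (at t within {0..1})"
      unfolding k_def
      by (intro has_vector_derivative_mult bounded_linear.has_vector_derivative[OF bounded_linear_adj] D(2)[OF t])
    \<comment> \<open>Factoring out \<open>k t\<close> leaves a conjugate of
      \<open>y - adj (m t)\<close> by an exponential of \<open>sym_part\<close>, again in
      \<open>M\<close>.\<close>
    moreover have "adj (s t) * (y * mexp (z t)) + adj (- (m t * s t)) * mexp (z t) =
        k t * (mexp (- z t) * (y - adj (m t)) * mexp (- (- z t)))"
      by (simp add: k_def algebra_simps pq'[OF t])
    moreover have "mexp (- z t) * (y - adj (m t)) * mexp (- (- z t)) \<in> M"
      by (intro mexp_conj_M sym_part_uminus z[OF t] M_closed y(1) adj_M D(5)[OF t])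
    ultimately show ?thesis by metis
  qed
  then obtain a where a: "\<And>t. t \<in> {0..1} \<Longrightarrow> a t \<in> M"
    "\<And>t. t \<in> {0..1} \<Longrightarrow> (k has_vector_derivative k t * a t) (at t within {0..1})"
    by metis
  \<comment> \<open>Differentiate \<open>adj (k t) * k t = 1\<close>.\<close>
  have skew: "adj (a t) = - a t" if t: "t \<in> {0..1}" for t
  proof -
    have "((\<lambda>t. adj (k t) * k t) has_vector_derivative adj (k t) * (k t * a t) + adj (k t * a t) * k t)
        (at t within {0..1})"
      by (intro has_vector_derivative_mult bounded_linear.has_vector_derivative[OF bounded_linear_adj] a t)
    moreover have "adj (k t) * (k t * a t) + adj (k t * a t) * k t = a t + adj (a t)"
      using korth[OF t] by (simp add: mult.assoc orthD)
    moreover have "((\<lambda>t. adj (k t) * k t) has_vector_derivative 0) (at t within {0..1})"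
      by (rule has_vector_derivative_transform[OF t _ has_vector_derivative_const[of 1]])
        (use korth in \<open>auto simp: orth_def\<close>)
    ultimately have "a t + adj (a t) = 0"
      using vector_derivative_unique_within_closed_interval[of 0 1 t] t by (metis cbox_interval zero_less_one)
    then show ?thesis by (simp add: eq_neg_iff_add_eq_0 add.commute)
  qed
  have "k 0 = 1"
  proof -
    have "mexp (z 0) = mexp X"
      using pp[of 0] X z[of 0] by (intro mexp_sqrt_unique) (auto simp: sym_part_def)
    then show ?thesis
      using adj1(1)[of 0] X by (simp add: k_def sym_part_def)
  qed
  then have "k 0 \<in> H" using H_one by simp
  have "k 1 \<in> H"
    by (rule tangent_curve_in_closed_group[OF H_closed H_orth H_mult a(2) H_tangent[OF a(1) skew] \<open>k 0 \<in> H\<close>])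
  moreover have "r 1 = k 1 * mexp (z 1)"
    using pp[of 1] adj2(1)[of 1 "r 1"] by (simp add: k_def mult.assoc)
  ultimately show ?thesis
    unfolding polar_set_def using z[of 1] by auto
qed

text \<open>Left translation by \<open>adj u\<close> keeps the velocity and makes the path start at
  a pure exponential.\<close>

lemma tangent_path_polar:
  assumes path: "tangent_path r s m" and r0: "r 0 \<in> polar_set"
  shows "r 1 \<in> polar_set"
proof -
  obtain u X where u: "u \<in> H" and X: "X \<in> sym_part" and r0: "r 0 = u * mexp X"
    using r0 by (auto simp: polar_set_def)
  note o = orthD[OF H_orth[OF u]]
  have "tangent_path (\<lambda>t. adj u * r t) (\<lambda>t. s t * u) m"
    unfolding tangent_path_def
  proof (intro ballI)
    fix t :: real assume t: "t \<in> {0..1}"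
    note D = tangent_pathD[OF path t]
    have "((\<lambda>t. adj u * r t) has_vector_derivative adj u * (r t * m t)) (at t within {0..1})"
      "((\<lambda>t. s t * u) has_vector_derivative - (m t * s t) * u) (at t within {0..1})"
      by (intro has_vector_derivative_mult_left has_vector_derivative_mult_right D)+
    moreover have "adj u * r t * (s t * u) = 1"
    proof -
      have "adj u * r t * (s t * u) = adj u * (r t * s t) * u" by (simp add: mult.assoc)
      then show ?thesis using D(3) o(1) by simp
    qed
    moreover have "adj u * r t * Y * (s t * u) \<in> M" if "Y \<in> M" for Y
      using H_M[OF H_adj[OF u] D(6)[OF that]] by (simp add: mult.assoc)
    moreover have "s t * u * Y * (adj u * r t) \<in> M" if "Y \<in> M" for Y
      using D(7)[OF H_M[OF u that]] by (simp add: mult.assoc)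
    ultimately show "((\<lambda>t. adj u * r t) has_vector_derivative adj u * r t * m t) (at t within {0..1}) \<and>
      ((\<lambda>t. s t * u) has_vector_derivative - (m t * (s t * u))) (at t within {0..1}) \<and>
      adj u * r t * (s t * u) = 1 \<and> m t \<in> M \<and>
      (\<forall>X\<in>M. adj u * r t * X * (s t * u) \<in> M \<and> s t * u * X * (adj u * r t) \<in> M)"
      using D(5) by (simp add: mult.assoc)
  qed
  then have "adj u * r 1 \<in> polar_set"
    by (rule tangent_path_from_exp[OF _ _ X]) (simp add: r0 o)
  then obtain w Y where "w \<in> H" "Y \<in> sym_part" "adj u * r 1 = w * mexp Y"
    by (auto simp: polar_set_def)
  moreover from this have "r 1 = (u * w) * mexp Y"
    using o(4)[of "r 1"] by (simp add: mult.assoc)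
  ultimately show ?thesis
    unfolding polar_set_def using H_mult[OF u] by blast
qed

lemma tangent_path_polar_iff:
  assumes path: "tangent_path r s m"
  shows "r 0 \<in> polar_set \<longleftrightarrow> r 1 \<in> polar_set"
  using tangent_path_polar[OF path] tangent_path_polar[OF tangent_path_affine[OF path, of 1 "- 1"]] by auto

lemma mexp_mult_mem_polar_set:
  assumes X: "X \<in> sym_part" and Y: "Y \<in> sym_part"
  shows "mexp X * mexp Y \<in> polar_set"
proof -
  \<comment> \<open>A tangent path from \<open>mexp X\<close> to the product, so the product has a
    polar decomposition without being the image of a known group element.\<close>
  let ?r = "\<lambda>t. mexp X * mexp (t *\<^sub>R Y)" and ?s = "\<lambda>t. mexp (t *\<^sub>R (- Y)) * mexp (- X)"
  note sX = sym_partD(2)[OF X] and sY = sym_partD(2)[OF Y]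
  have tY: "t *\<^sub>R Y \<in> sym_part" for t by (rule sym_part_scaleR[OF Y])
  note inv = mexp_inverse[OF sX] mexp_inverse[OF sym_partD(2)[OF tY]]
  have "tangent_path ?r ?s (\<lambda>_. Y)"
    unfolding tangent_path_def
  proof (intro ballI)
    fix t :: real
    have "(?r has_vector_derivative mexp X * (mexp (t *\<^sub>R Y) * Y)) (at t within {0..1})"
      by (intro has_vector_derivative_mult_right mexp_has_vector_derivative sY)
    moreover have "(?s has_vector_derivative - (Y * ?s t)) (at t within {0..1})"
    proof -
      have "(?s has_vector_derivative mexp (t *\<^sub>R (- Y)) * (- Y) * mexp (- X)) (at t within {0..1})"
        using sY by (intro has_vector_derivative_mult_left mexp_has_vector_derivative) simp
      moreover have "mexp (t *\<^sub>R (- Y)) * Y = Y * mexp (t *\<^sub>R (- Y))"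
        using sY by (intro mexp_commute) simp_all
      ultimately show ?thesis
        by (simp add: mult.assoc[symmetric])
    qed
    moreover have "?r t * ?s t = 1"
    proof -
      have "?r t * ?s t = mexp X * (mexp (t *\<^sub>R Y) * mexp (- (t *\<^sub>R Y))) * mexp (- X)"
        by (simp add: mult.assoc)
      then show ?thesis using inv by simp
    qed
    moreover have "?r t * W * ?s t \<in> M" if "W \<in> M" for W
      using mexp_conj_M[OF X mexp_conj_M[OF tY that, of t]] by (simp add: mult.assoc)
    moreover have "?s t * W * ?r t \<in> M" if "W \<in> M" for W
      using mexp_conj_M[OF sym_part_uminus[OF tY] mexp_conj_M[OF sym_part_uminus[OF X] that], of t]
      by (simp add: mult.assoc)
    ultimately show "(?r has_vector_derivative ?r t * Y) (at t within {0..1}) \<and>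
       (?s has_vector_derivative - (Y * ?s t)) (at t within {0..1}) \<and>
       ?r t * ?s t = 1 \<and> Y \<in> M \<and> (\<forall>X\<in>M. ?r t * X * ?s t \<in> M \<and> ?s t * X * ?r t \<in> M)"
      using sym_partD(1)[OF Y] by (simp add: mult.assoc)
  qed
  moreover have "?r 0 \<in> polar_set"
    unfolding polar_set_def using X H_one by force
  ultimately show ?thesis
    using tangent_path_polar by fastforce
qed

section \<open>Minimal vectors\<close>

text \<open>Vectors at which the moment map of the group \<open>polar_set\<close> vanishes.\<close>

definition critical :: "real^'k \<Rightarrow> bool" where
  "critical x \<longleftrightarrow> (\<forall>Z\<in>sym_part. inner x (Z \<star> x) = 0)"

lemma critical_app:
  assumes "u \<in> H" "critical x"
  shows "critical (u \<star> x)"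
  unfolding critical_def
proof
  fix Z assume "Z \<in> sym_part"
  with assms(1) have "adj u * Z * adj (adj u) \<in> sym_part"
    by (intro sym_part_conj H_adj)
  with assms(2) have "inner x ((adj u * Z * u) \<star> x) = 0"
    by (simp add: critical_def)
  then show "inner (u \<star> x) (Z \<star> u \<star> x) = 0"
    by (simp add: app_mult inner_app[of u])
qed

lemma critical_displacement:
  assumes "critical x" "Z \<in> sym_part"
  shows "(norm (mexp Z \<star> x - x))\<^sup>2 \<le> (norm (mexp Z \<star> x))\<^sup>2 - (norm x)\<^sup>2"
proof -
  have "inner x x \<le> inner x (mexp Z \<star> x)"
    using mexp_ge_linear[of Z x] assms by (simp add: critical_def sym_part_def)
  then show ?thesis
    by (simp add: power2_norm_eq_inner inner_diff_left inner_diff_right inner_commute)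
qed

lemma critical_fixed:
  assumes "critical x" "Z \<in> sym_part" "norm (mexp Z \<star> x) \<le> norm x"
  shows "mexp Z \<star> x = x"
proof -
  have "(norm (mexp Z \<star> x))\<^sup>2 \<le> (norm x)\<^sup>2"
    using assms(3) by (rule power_mono) simp
  then have "(norm (mexp Z \<star> x - x))\<^sup>2 \<le> 0"
    using critical_displacement[OF assms(1,2)] by linarith
  then show ?thesis by simp
qed

lemma critical_norm_le:
  assumes "critical x" "Z \<in> sym_part"
  shows "norm x \<le> norm (mexp Z \<star> x)"
proof (rule power2_le_imp_le)
  show "(norm x)\<^sup>2 \<le> (norm (mexp Z \<star> x))\<^sup>2"
    using critical_displacement[OF assms] zero_le_power2[of "norm (mexp Z \<star> x - x)"] by linarith
qed simp

text \<open>Both \<open>x\<close> and \<open>mexp Z \<star> x\<close> are critical, and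
  \<open>mexp (- Z)\<close> leads back from the second to the first. So neither is longer than the
  other, and \<open>critical_fixed\<close> applies.\<close>

lemma critical_polar_orbit:
  assumes x: "critical x" and y: "critical (g \<star> x)" and g: "g \<in> polar_set"
  obtains u where "u \<in> H" "g \<star> x = u \<star> x"
proof -
  obtain u Z where u: "u \<in> H" and Z: "Z \<in> sym_part" and g: "g = u * mexp Z"
    using g by (auto simp: polar_set_def)
  let ?w = "mexp Z \<star> x"
  have "adj u \<star> g \<star> x = ?w"
    using orthD(3)[OF H_orth[OF u]] by (simp add: g app_mult[symmetric])
  then have w: "critical ?w"
    using critical_app[OF H_adj[OF u] y] by simp
  have "mexp (- Z) \<star> ?w = x"
    using mexp_inverse(2)[OF sym_partD(2)[OF Z]] by (simp add: app_mult[symmetric])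
  then have "norm ?w \<le> norm x"
    using critical_norm_le[OF w sym_part_uminus[OF Z]] by simp
  then have "?w = x" by (rule critical_fixed[OF x Z])
  then show ?thesis
    using that[OF u] by (simp add: g app_mult)
qed

text \<open>
  The positive matrices \<open>exp (- 2 Z)\<close> and \<open>exp (- 2 Z')\<close>, where \<open>Z' = \<sigma> Z \<sigma>\<close>, both minimize
  \<open>P \<mapsto> \<langle>P v, v\<rangle>\<close>.  Their geodesic midpoint \<open>A\<close>, the unique positive solution of
  \<open>A exp (2 Z') A = exp (- 2 Z)\<close>, is a minimizer as well, and it is fixed by \<open>\<sigma>\<close>.
\<close>

lemma fixed_point_reaches_critical_orbit:
  assumes \<sigma>: "\<sigma> * \<sigma> = 1" "adj \<sigma> = \<sigma>" "\<And>X. X \<in> M \<Longrightarrow> \<sigma> * X * \<sigma> \<in> M"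
    and v: "\<sigma> \<star> v = v" and y: "critical y" and Z: "Z \<in> sym_part" and vy: "v = mexp Z \<star> y"
  obtains Q u where "Q \<in> sym_part" "\<sigma> * Q * \<sigma> = Q" "u \<in> H" "mexp Q \<star> v = u \<star> y"
proof -
  have o\<sigma>: "orth \<sigma>" using \<sigma> by (simp add: orth_def)
  have \<sigma>\<sigma>: "\<sigma> * (\<sigma> * Y) = Y" for Y using \<sigma>(1) by (simp add: mult.assoc[symmetric])
  have \<sigma>_sym: "\<sigma> * X * \<sigma> \<in> sym_part" if "X \<in> sym_part" for X
    using that \<sigma> by (simp add: sym_part_def mult.assoc)
  have \<sigma>_exp: "\<sigma> * mexp X * \<sigma> = mexp (\<sigma> * X * \<sigma>)" if "adj X = X" for X
    using mexp_conj[OF o\<sigma> that] \<sigma>(2) by simp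
  define Z' where "Z' = \<sigma> * Z * \<sigma>"
  have Z': "Z' \<in> sym_part" unfolding Z'_def by (rule \<sigma>_sym[OF Z])
  have adjZ: "adj Z = Z" "adj Z' = Z'" using Z Z' by (auto simp: sym_part_def)
  note inv = mexp_inverse[OF adjZ(1)] mexp_inverse[OF adjZ(2)]
  have inv': "mexp Z * (mexp (- Z) * Y) = Y" "mexp (- Z) * (mexp Z * Y) = Y"
    "mexp Z' * (mexp (- Z') * Y) = Y" "mexp (- Z') * (mexp Z' * Y) = Y" for Y
    using inv by (simp_all add: mult.assoc[symmetric])
  have yv: "mexp (- Z) \<star> v = y"
    by (simp add: vy app_mult[symmetric] inv)
  have "\<sigma> \<star> y = mexp (- Z') \<star> v"
  proof -
    have "mexp (- Z') = \<sigma> * mexp (- Z) * \<sigma>"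
      unfolding Z'_def using \<sigma>_exp[of "- Z"] adjZ by simp
    then show ?thesis by (simp add: app_mult v yv)
  qed
  then have \<sigma>y: "\<sigma> \<star> y = (mexp (- Z') * mexp Z) \<star> y"
    by (simp add: vy app_mult)
  obtain u1 T where u1: "u1 \<in> H" and T: "T \<in> sym_part" and u1T: "mexp (- Z') * mexp Z = u1 * mexp T"
    using mexp_mult_mem_polar_set[OF sym_part_uminus[OF Z'] Z] by (auto simp: polar_set_def)
  have adjT: "adj T = T" using T by (simp add: sym_part_def)
  \<comment> \<open>\<sigma> and \<open>u1\<close> are isometries, so \<open>mexp T\<close>
    preserves the length of the critical vector \<open>y\<close> and therefore fixes it.\<close>
  have "norm (mexp T \<star> y) = norm (\<sigma> \<star> y)"
    unfolding \<sigma>y u1T by (simp add: app_mult norm_orth_app H_orth[OF u1])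
  then have "norm (mexp T \<star> y) \<le> norm y"
    by (simp add: norm_orth_app[OF o\<sigma>])
  then have Ty: "mexp T \<star> y = y"
    by (rule critical_fixed[OF y T])
  \<comment> \<open>The midpoint \<open>mexp (- Z) * mexp T * mexp (- Z)\<close> is the Gram matrix
    of \<open>mexp T2 * mexp (- Z)\<close>, whose polar decomposition then supplies
    \<open>Q\<close>.\<close>
  define T2 where "T2 = (1/2) *\<^sub>R T"
  have T2: "T2 \<in> sym_part" unfolding T2_def by (rule sym_part_scaleR[OF T])
  have T2T2: "mexp T2 * mexp T2 = mexp T"
    unfolding T2_def by (rule mexp_half[OF adjT])
  have "(norm (mexp T2 \<star> y))\<^sup>2 = inner y (mexp T \<star> y)"
    using T2 by (simp add: power2_norm_eq_inner inner_app sym_part_def T2T2 app_mult[symmetric])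
  then have "norm (mexp T2 \<star> y) = norm y"
    by (simp add: Ty power2_norm_eq_inner[symmetric])
  then have T2y: "mexp T2 \<star> y = y"
    by (intro critical_fixed[OF y T2]) simp
  obtain u2 Q where u2: "u2 \<in> H" and Q: "Q \<in> sym_part" and u2Q: "mexp T2 * mexp (- Z) = u2 * mexp Q"
    using mexp_mult_mem_polar_set[OF T2 sym_part_uminus[OF Z]] by (auto simp: polar_set_def)
  have adjQ: "adj Q = Q" using Q by (simp add: sym_part_def)
  have "u2 \<star> mexp Q \<star> v = y"
    by (simp add: app_mult[symmetric] u2Q[symmetric]) (simp add: app_mult yv T2y)
  then have "mexp Q \<star> v = adj u2 \<star> y"
    using orthD(1)[OF H_orth[OF u2]] by (metis app_mult app_simps(1))
  moreover have "\<sigma> * Q * \<sigma> = Q"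
  proof -
    let ?A = "mexp (2 *\<^sub>R Q)" and ?B = "mexp (2 *\<^sub>R (\<sigma> * Q * \<sigma>))"
    have adj\<sigma>Q: "adj (\<sigma> * Q * \<sigma>) = \<sigma> * Q * \<sigma>"
      using \<sigma>_sym[OF Q] by (simp add: sym_part_def)
    have "?A = adj (u2 * mexp Q) * (u2 * mexp Q)"
      using adjQ orthD(3)[OF H_orth[OF u2]] by (simp add: mexp_double mult.assoc)
    also have "\<dots> = mexp (- Z) * (mexp T2 * mexp T2) * mexp (- Z)"
      unfolding u2Q[symmetric] using T2 adjZ by (simp add: sym_part_def mult.assoc)
    finally have A: "?A = mexp (- Z) * mexp T * mexp (- Z)"
      unfolding T2T2 .
    \<comment> \<open>With this, \<open>?A\<close> is recognized as the geometric mean of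
      \<open>mexp (- 2 *\<^sub>R Z)\<close> and \<open>mexp (- 2 *\<^sub>R Z')\<close>.\<close>
    have TT: "mexp T * mexp T = mexp Z * (mexp (- Z') * mexp (- Z')) * mexp Z"
    proof -
      have "mexp T * mexp T = adj (u1 * mexp T) * (u1 * mexp T)"
        using adjT orthD(3)[OF H_orth[OF u1]] by (simp add: mult.assoc)
      then show ?thesis
        unfolding u1T[symmetric] using adjZ by (simp add: mult.assoc)
    qed
    have AZA: "?A * (mexp Z * mexp Z) * ?A = mexp (- Z') * mexp (- Z')"
    proof -
      have "?A * (mexp Z * mexp Z) * ?A = mexp (- Z) * (mexp T * mexp T) * mexp (- Z)"
        unfolding A by (simp add: mult.assoc inv')
      then show ?thesis unfolding TT by (simp add: mult.assoc inv' inv)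
    qed
    have B: "?B = \<sigma> * ?A * \<sigma>"
      using \<sigma>_exp[of "2 *\<^sub>R Q"] adjQ by simp
    \<comment> \<open>Conjugation by \<sigma> exchanges \<open>Z\<close> and \<open>Z'\<close> in
      \<open>AZA\<close>.\<close>
    have BZB: "?B * (mexp Z' * mexp Z') * ?B = mexp (- Z) * mexp (- Z)"
    proof -
      have Zs: "mexp Z' = \<sigma> * mexp Z * \<sigma>" "mexp (- Z) = \<sigma> * mexp (- Z') * \<sigma>"
        using \<sigma>_exp[OF adjZ(1)] \<sigma>_exp[of "- Z'"] adjZ \<sigma>(1) \<sigma>\<sigma> by (simp_all add: Z'_def mult.assoc)
      have "?B * (mexp Z' * mexp Z') * ?B = \<sigma> * (?A * (mexp Z * mexp Z) * ?A) * \<sigma>"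
        unfolding B Zs(1) by (simp add: mult.assoc \<sigma>\<sigma>)
      then show ?thesis
        unfolding AZA Zs(2) by (simp add: mult.assoc \<sigma>\<sigma>)
    qed
    have "?B = ?A"
    proof -
      define Ai where "Ai = mexp (- (2 *\<^sub>R Q))"
      have AAi: "?A * Ai = 1" "Ai * ?A = 1"
        unfolding Ai_def by (rule mexp_inverse; simp add: adjQ)+
      have AAi': "?A * (Ai * Y) = Y" "Ai * (?A * Y) = Y" for Y
        using AAi by (simp_all add: mult.assoc[symmetric])
      \<comment> \<open>Inverting \<open>AZA\<close> shows that the mean is symmetric in its two
        arguments; so \<open>?A\<close> and \<open>?B\<close> solve the same equation.\<close>
      have AZA': "?A * (mexp Z' * mexp Z') * ?A = mexp (- Z) * mexp (- Z)"
      proof -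
        have 1: "(?A * (mexp Z * mexp Z) * ?A) * (mexp Z' * mexp Z') = 1"
          unfolding AZA by (simp add: mult.assoc inv' inv)
        have "?A * (mexp Z' * mexp Z') * ?A =
            mexp (- Z) * (mexp (- Z) * (Ai * (((?A * (mexp Z * mexp Z) * ?A) * (mexp Z' * mexp Z')) * ?A)))"
          by (simp add: mult.assoc AAi' inv')
        then show ?thesis unfolding 1 by (simp add: AAi)
      qed
      \<comment> \<open>\<open>?h\<close> turns the quadratic equation into one for a square, and
        positive square roots are unique.\<close>
      let ?h = "\<lambda>Y. mexp Z' * Y * mexp Z'"
      have sq: "?h Y * ?h Y = mexp Z' * (Y * (mexp Z' * mexp Z') * Y) * mexp Z'" for Y
        by (simp add: mult.assoc)
      have hexp: "\<exists>W. adj W = W \<and> mexp W = ?h (mexp (2 *\<^sub>R E))" if "adj E = E" for E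
      proof -
        have "(mexp E * mexp Z') * (mexp (- Z') * mexp (- E)) = 1"
          using mexp_inverse[OF that] by (simp add: mult.assoc inv')
        from mexp_log_gram[OF this] obtain W where "adj W = W" "mexp W = adj (mexp E * mexp Z') * (mexp E * mexp Z')" .
        then show ?thesis using that adjZ by (auto simp: mexp_double mult.assoc)
      qed
      obtain W1 W2 where W: "adj W1 = W1" "mexp W1 = ?h ?A" "adj W2 = W2" "mexp W2 = ?h ?B"
        using hexp[OF adjQ] hexp[OF adj\<sigma>Q] by blast
      have "mexp W1 = mexp W2"
        by (rule mexp_sqrt_unique[OF W(1,3)]) (simp only: W sq AZA' BZB)
      then have "mexp (- Z') * ?h ?B * mexp (- Z') = mexp (- Z') * ?h ?A * mexp (- Z')"
        unfolding W by simp
      then show ?thesis by (simp add: mult.assoc inv' inv)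
    qed
    then have "2 *\<^sub>R (\<sigma> * Q * \<sigma>) = 2 *\<^sub>R Q"
      by (rule mexp_inj[rotated 2]) (simp_all add: adjQ adj\<sigma>Q del: adj_mult)
    then show ?thesis by simp
  qed
  ultimately show ?thesis
    using that[OF Q _ H_adj[OF u2]] by blast
qed

end

section \<open>Differentiability in charts\<close>

lemma norm_mult3: "norm (a * b * c) \<le> norm a * norm b * norm (c :: 'a::real_normed_algebra)"
  by (meson mult_right_mono norm_ge_zero norm_mult_ineq order_trans)

text \<open>Continuity of \<open>s\<close> is drawn first from
  \<open>s \<tau> - s t = - (s \<tau> * (r \<tau> - r t) * s t)\<close>; then the same identity
  gives the derivative.\<close>

lemma has_vector_derivative_mtx_inverse:
  fixes r s :: "real \<Rightarrow> 'k::finite mtx"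
  assumes r: "(r has_vector_derivative r t * m) (at t within S)" and t: "t \<in> S"
    and inv: "\<And>\<tau>. \<tau> \<in> S \<Longrightarrow> r \<tau> * s \<tau> = 1"
  shows "(s has_vector_derivative - (m * s t)) (at t within S)"
proof -
  have inv': "s \<tau> * r \<tau> = 1" if "\<tau> \<in> S" for \<tau>
    by (rule mtx_left_inverse[OF inv[OF that]])
  have diff: "s \<tau> - s t = - (s \<tau> * (r \<tau> - r t) * s t)" if "\<tau> \<in> S" for \<tau>
  proof -
    have "s \<tau> * (r \<tau> - r t) * s t = (s \<tau> * r \<tau>) * s t - s \<tau> * (r t * s t)"
      by (simp add: algebra_simps)
    then show ?thesis using inv[OF t] inv'[OF that] by simp
  qed
  have S: "\<forall>\<^sub>F \<tau> in at t within S. \<tau> \<in> S"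
    by (simp add: eventually_at_filter)
  have r_lim: "(r \<longlongrightarrow> r t) (at t within S)"
    using has_vector_derivative_continuous[OF r] by (simp add: continuous_within)
  then have r0: "((\<lambda>\<tau>. norm (r \<tau> - r t)) \<longlongrightarrow> 0) (at t within S)"
    by (simp add: tendsto_norm_zero LIM_zero)
  have s_lim: "(s \<longlongrightarrow> s t) (at t within S)"
  proof (rule LIM_zero_cancel, rule Lim_null_comparison)
    \<comment> \<open>Close enough for the identity to bound the increment of \<open>s\<close> by
      half of \<open>norm (s \<tau>)\<close>, whence
      \<open>norm (s \<tau>) \<le> 2 * norm (s t)\<close>. The \<open>+ 1\<close> keeps the
      denominator positive.\<close>
    have "\<forall>\<^sub>F \<tau> in at t within S. norm (r \<tau> - r t) < 1 / (2 * (norm (s t) + 1))"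
      by (rule order_tendstoD(2)[OF r0]) (simp add: add_nonneg_pos)
    then show "\<forall>\<^sub>F \<tau> in at t within S. norm (s \<tau> - s t) \<le> 2 * norm (s t) * norm (r \<tau> - r t) * norm (s t)"
      using S
    proof eventually_elim
      case (elim \<tau>)
      have le: "norm (s \<tau> - s t) \<le> norm (s \<tau>) * norm (r \<tau> - r t) * norm (s t)"
        unfolding diff[OF elim(2)] norm_minus_cancel by (rule norm_mult3)
      have "norm (r \<tau> - r t) * norm (s t) \<le> norm (r \<tau> - r t) * (norm (s t) + 1)"
        by (intro mult_left_mono) auto
      also have "\<dots> \<le> 1 / 2"
      proof -
        have pos: "0 < 2 * (norm (s t) + 1)" by (simp add: add_nonneg_pos)
        have "norm (r \<tau> - r t) * (2 * (norm (s t) + 1)) \<le> 1"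
          using elim(1) unfolding pos_less_divide_eq[OF pos] by simp
        then show ?thesis by (simp add: algebra_simps)
      qed
      finally have "norm (s \<tau>) * (norm (r \<tau> - r t) * norm (s t)) \<le> norm (s \<tau>) * (1 / 2)"
        by (rule mult_left_mono) simp
      with le have "norm (s \<tau> - s t) \<le> norm (s \<tau>) / 2"
        by (simp add: mult.assoc)
      moreover have "norm (s \<tau>) \<le> norm (s t) + norm (s \<tau> - s t)"
        by (metis add.commute diff_add_cancel norm_triangle_ineq)
      ultimately have "norm (s \<tau>) \<le> 2 * norm (s t)" by simp
      then have "norm (s \<tau>) * norm (r \<tau> - r t) * norm (s t) \<le> 2 * norm (s t) * norm (r \<tau> - r t) * norm (s t)"
        by (intro mult_right_mono) auto
      with le show ?case by simp
    qed
    show "((\<lambda>\<tau>. 2 * norm (s t) * norm (r \<tau> - r t) * norm (s t)) \<longlongrightarrow> 0) (at t within S)"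
      by (rule tendsto_eq_intros refl r0)+ simp
  qed
  let ?N = "\<lambda>\<tau>. r \<tau> - r t - (\<tau> - t) *\<^sub>R (r t * m)"
  have N: "((\<lambda>\<tau>. norm (?N \<tau>) / norm (\<tau> - t)) \<longlongrightarrow> 0) (at t within S)"
    using r unfolding has_vector_derivative_def has_derivative_iff_norm by simp
  show ?thesis
    unfolding has_vector_derivative_def
  proof (rule has_derivativeI_sandwich[where e = 1 and
        H = "\<lambda>\<tau>. norm (s \<tau>) * (norm (?N \<tau>) / norm (\<tau> - t)) * norm (s t) + norm (s \<tau> - s t) * norm (r t * m * s t)"])
    fix \<tau> assume \<tau>: "\<tau> \<in> S" "\<tau> \<noteq> t"
    have "s \<tau> - s t - (\<tau> - t) *\<^sub>R - (m * s t) = - (s \<tau> * ?N \<tau> * s t) - (\<tau> - t) *\<^sub>R ((s \<tau> - s t) * (r t * m * s t))"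
    proof -
      have "(s \<tau> - s t) * (r t * m * s t) = s \<tau> * (r t * m) * s t - m * s t"
        using inv'[OF t] by (simp add: algebra_simps) (simp add: mult.assoc[symmetric])
      moreover have "s \<tau> * ?N \<tau> * s t = s \<tau> * (r \<tau> - r t) * s t - (\<tau> - t) *\<^sub>R (s \<tau> * (r t * m) * s t)"
        by (simp add: right_diff_distrib left_diff_distrib)
      ultimately show ?thesis
        using diff[OF \<tau>(1)] by (simp only: scaleR_diff_right scaleR_minus_right) simp
    qed
    then have "norm (s \<tau> - s t - (\<tau> - t) *\<^sub>R - (m * s t)) \<le>
        norm (s \<tau> * ?N \<tau> * s t) + norm ((\<tau> - t) *\<^sub>R ((s \<tau> - s t) * (r t * m * s t)))"
      by (metis norm_minus_cancel norm_triangle_ineq4)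
    also have "\<dots> \<le> norm (s \<tau>) * norm (?N \<tau>) * norm (s t) + norm (\<tau> - t) * (norm (s \<tau> - s t) * norm (r t * m * s t))"
      by (intro add_mono norm_mult3) (simp add: mult_left_mono norm_mult_ineq)
    finally show "norm (s \<tau> - s t - (\<tau> - t) *\<^sub>R - (m * s t)) / norm (\<tau> - t) \<le>
        norm (s \<tau>) * (norm (?N \<tau>) / norm (\<tau> - t)) * norm (s t) + norm (s \<tau> - s t) * norm (r t * m * s t)"
      using \<tau>(2) by (simp add: field_simps)
  next
    show "((\<lambda>\<tau>. norm (s \<tau>) * (norm (?N \<tau>) / norm (\<tau> - t)) * norm (s t) + norm (s \<tau> - s t) * norm (r t * m * s t))
        \<longlongrightarrow> 0) (at t within S)"
    proof -
      have "((\<lambda>\<tau>. norm (s \<tau>) * (norm (?N \<tau>) / norm (\<tau> - t)) * norm (s t) + norm (s \<tau> - s t) * norm (r t * m * s t))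
        \<longlongrightarrow> norm (s t) * 0 * norm (s t) + norm (s t - s t) * norm (r t * m * s t)) (at t within S)"
        by (intro tendsto_intros s_lim N)
      then show ?thesis by simp
    qed
  qed (rule bounded_linear_scaleR_left zero_less_one)+
qed

lemma open_slice:
  assumes "open S"
  shows "open {b. (a, b) \<in> S}" "open {b. (b, a) \<in> S}"
proof -
  have "continuous_on UNIV (\<lambda>b. (a, b))" "continuous_on UNIV (\<lambda>b. (b, a))"
    by (intro continuous_intros)+
  from open_vimage[OF assms this(1)] open_vimage[OF assms this(2)]
  show "open {b. (a, b) \<in> S}" "open {b. (b, a) \<in> S}"
    by (auto simp: vimage_def)
qed

lemma has_derivative_eventually_eq:
  assumes "(f has_derivative f') (at x)" "\<forall>\<^sub>F y in nhds x. g y = f y"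
  shows "(g has_derivative f') (at x)"
proof (rule has_derivative_transform_eventually[OF assms(1)])
  show "\<forall>\<^sub>F y in at x. f y = g y"
    using assms(2) by (auto simp: eventually_at_filter elim: eventually_mono)
  show "f x = g x"
    using eventually_nhds_x_imp_x[OF assms(2)] by simp
qed simp

section \<open>Charts and translations of a complex Lie group\<close>

locale lie_group_charts =
  fixes L :: "('g, 'n::finite) lie_data"
  assumes lie: "complex_lie_group L"
begin

lemma group: "group L"
  using lie by (simp add: complex_lie_group_def)

sublocale group L by (rule group)

lemma topspace: "topspace (gtop L) = carrier L"
  using lie by (simp add: complex_lie_group_def)

lemma atlas: "complex_atlas (gtop L) (charts L)"
  using lie by (simp add: complex_lie_group_def)

lemma chartD:
  assumes "(D, \<phi>) \<in> charts L"
  shows "openin (gtop L) D" "open (\<phi> ` D)" "inj_on \<phi> D" "D \<subseteq> carrier L"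
    "homeomorphic_map (subtopology (gtop L) D) (top_of_set (\<phi> ` D)) \<phi>"
proof -
  show op: "openin (gtop L) D" and "open (\<phi> ` D)"
    and hom: "homeomorphic_map (subtopology (gtop L) D) (top_of_set (\<phi> ` D)) \<phi>"
    using atlas assms by (auto simp: complex_atlas_def)
  show sub: "D \<subseteq> carrier L"
    using openin_subset[OF op] by (simp add: topspace)
  then have "topspace (subtopology (gtop L) D) = D"
    by (auto simp: topspace)
  then show "inj_on \<phi> D"
    using homeomorphic_imp_injective_map[OF hom] by simp
qed

lemma chart_at:
  assumes "g \<in> carrier L"
  obtains D \<phi> where "(D, \<phi>) \<in> charts L" "g \<in> D"
proof -
  have "(\<Union>(D, \<phi>)\<in>charts L. D) = carrier L"
    using atlas by (simp add: complex_atlas_def topspace)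
  with assms that show ?thesis by blast
qed

lemma product_holo:
  assumes "(D, \<phi>) \<in> charts L" "(D', \<phi>') \<in> charts L" "(D'', \<phi>'') \<in> charts L"
  shows "holo_on (map_prod im_unit im_unit) im_unit
     {(\<phi> x, \<phi>' y) | x y. x \<in> D \<and> y \<in> D' \<and> x \<otimes>\<^bsub>L\<^esub> y \<in> D''}
     (\<lambda>(a, b). \<phi>'' (inv_into D \<phi> a \<otimes>\<^bsub>L\<^esub> inv_into D' \<phi>' b))"
proof -
  have "\<forall>(D, \<phi>)\<in>charts L. \<forall>(D', \<phi>')\<in>charts L. \<forall>(D'', \<phi>'')\<in>charts L.
        holo_on (map_prod im_unit im_unit) im_unit
          {(\<phi> x, \<phi>' y) | x y. x \<in> D \<and> y \<in> D' \<and> x \<otimes>\<^bsub>L\<^esub> y \<in> D''}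
          (\<lambda>(a, b). \<phi>'' (inv_into D \<phi> a \<otimes>\<^bsub>L\<^esub> inv_into D' \<phi>' b))"
    using lie unfolding complex_lie_group_def by blast
  with assms show ?thesis by blast
qed

text \<open>A translation is the product map restricted to a slice through a chart around
  \<open>g\<close>. The second conjunct keeps nearby points in the target chart, where coordinates
  can be inverted.\<close>

lemma translation_differentiable:
  assumes c: "(D, \<phi>) \<in> charts L" "(D'', \<phi>'') \<in> charts L" and g: "g \<in> carrier L" and x: "x \<in> D"
  shows left_translation: "g \<otimes>\<^bsub>L\<^esub> x \<in> D'' \<Longrightarrow>
      \<exists>f'. ((\<lambda>a. \<phi>'' (g \<otimes>\<^bsub>L\<^esub> inv_into D \<phi> a)) has_derivative f') (at (\<phi> x)) \<and>
        (\<forall>\<^sub>F a in nhds (\<phi> x). a \<in> \<phi> ` D \<and> g \<otimes>\<^bsub>L\<^esub> inv_into D \<phi> a \<in> D'')"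
    and right_translation: "x \<otimes>\<^bsub>L\<^esub> g \<in> D'' \<Longrightarrow>
      \<exists>f'. ((\<lambda>a. \<phi>'' (inv_into D \<phi> a \<otimes>\<^bsub>L\<^esub> g)) has_derivative f') (at (\<phi> x)) \<and>
        (\<forall>\<^sub>F a in nhds (\<phi> x). a \<in> \<phi> ` D \<and> inv_into D \<phi> a \<otimes>\<^bsub>L\<^esub> g \<in> D'')"
proof -
  obtain E \<psi> where E: "(E, \<psi>) \<in> charts L" "g \<in> E"
    using chart_at[OF g] .
  note inj = chartD(3)[OF c(1)] chartD(3)[OF E(1)]
  have g_eq: "inv_into E \<psi> (\<psi> g) = g"
    using inj E(2) by simp
  show "\<exists>f'. ((\<lambda>a. \<phi>'' (g \<otimes>\<^bsub>L\<^esub> inv_into D \<phi> a)) has_derivative f') (at (\<phi> x)) \<and>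
        (\<forall>\<^sub>F a in nhds (\<phi> x). a \<in> \<phi> ` D \<and> g \<otimes>\<^bsub>L\<^esub> inv_into D \<phi> a \<in> D'')" if gx: "g \<otimes>\<^bsub>L\<^esub> x \<in> D''"
  proof -
    let ?S = "{(\<psi> x, \<phi> y) | x y. x \<in> E \<and> y \<in> D \<and> x \<otimes>\<^bsub>L\<^esub> y \<in> D''}"
    let ?F = "\<lambda>(a, b). \<phi>'' (inv_into E \<psi> a \<otimes>\<^bsub>L\<^esub> inv_into D \<phi> b)"
    have mem: "(\<psi> g, \<phi> x) \<in> ?S" using E x gx by blast
    obtain F' where F': "(?F has_derivative F') (at (\<psi> g, \<phi> x))" and op: "open ?S"
      using product_holo[OF E(1) c] mem unfolding holo_on_def by blast
    have "((\<lambda>b. (\<psi> g, b)) has_derivative (\<lambda>v. (0, v))) (at (\<phi> x))"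
      by (auto intro!: derivative_eq_intros)
    from diff_chain_at[OF this F']
    have "((\<lambda>a. \<phi>'' (g \<otimes>\<^bsub>L\<^esub> inv_into D \<phi> a)) has_derivative (\<lambda>v. F' (0, v))) (at (\<phi> x))"
      by (simp add: o_def g_eq)
    moreover have "\<forall>\<^sub>F a in nhds (\<phi> x). a \<in> {b. (\<psi> g, b) \<in> ?S}"
      by (rule eventually_nhds_in_open[OF open_slice(1)[OF op]]) (use mem in simp)
    then have "\<forall>\<^sub>F a in nhds (\<phi> x). a \<in> \<phi> ` D \<and> g \<otimes>\<^bsub>L\<^esub> inv_into D \<phi> a \<in> D''"
      by (rule eventually_mono) (use inj E(2) in \<open>auto dest: inj_onD\<close>)
    ultimately show ?thesis by blast
  qed
  show "\<exists>f'. ((\<lambda>a. \<phi>'' (inv_into D \<phi> a \<otimes>\<^bsub>L\<^esub> g)) has_derivative f') (at (\<phi> x)) \<and>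
        (\<forall>\<^sub>F a in nhds (\<phi> x). a \<in> \<phi> ` D \<and> inv_into D \<phi> a \<otimes>\<^bsub>L\<^esub> g \<in> D'')" if gx: "x \<otimes>\<^bsub>L\<^esub> g \<in> D''"
  proof -
    let ?S = "{(\<phi> x, \<psi> y) | x y. x \<in> D \<and> y \<in> E \<and> x \<otimes>\<^bsub>L\<^esub> y \<in> D''}"
    let ?F = "\<lambda>(a, b). \<phi>'' (inv_into D \<phi> a \<otimes>\<^bsub>L\<^esub> inv_into E \<psi> b)"
    have mem: "(\<phi> x, \<psi> g) \<in> ?S" using E x gx by blast
    obtain F' where F': "(?F has_derivative F') (at (\<phi> x, \<psi> g))" and op: "open ?S"
      using product_holo[OF c(1) E(1) c(2)] mem unfolding holo_on_def by blast
    have "((\<lambda>b. (b, \<psi> g)) has_derivative (\<lambda>v. (v, 0))) (at (\<phi> x))"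
      by (auto intro!: derivative_eq_intros)
    from diff_chain_at[OF this F']
    have "((\<lambda>a. \<phi>'' (inv_into D \<phi> a \<otimes>\<^bsub>L\<^esub> g)) has_derivative (\<lambda>v. F' (v, 0))) (at (\<phi> x))"
      by (simp add: o_def g_eq)
    moreover have "\<forall>\<^sub>F a in nhds (\<phi> x). a \<in> {b. (b, \<psi> g) \<in> ?S}"
      by (rule eventually_nhds_in_open[OF open_slice(2)[OF op]]) (use mem in simp)
    then have "\<forall>\<^sub>F a in nhds (\<phi> x). a \<in> \<phi> ` D \<and> inv_into D \<phi> a \<otimes>\<^bsub>L\<^esub> g \<in> D''"
      by (rule eventually_mono) (use inj E(2) in \<open>auto dest: inj_onD\<close>)
    ultimately show ?thesis by blast
  qed
qed

abbreviation chart_dom :: "'g set" where "chart_dom \<equiv> fst (id_chart L)"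
abbreviation one_coord :: "complex^'n" where "one_coord \<equiv> coord L \<one>\<^bsub>L\<^esub>"

lemma id_chart: "(chart_dom, coord L) \<in> charts L" "\<one>\<^bsub>L\<^esub> \<in> chart_dom"
proof -
  obtain D \<phi> where "(D, \<phi>) \<in> charts L" "\<one>\<^bsub>L\<^esub> \<in> D"
    using chart_at[OF one_closed] .
  then have "id_chart L \<in> charts L \<and> \<one>\<^bsub>L\<^esub> \<in> fst (id_chart L)"
    unfolding id_chart_def by (intro someI_ex[of "\<lambda>c. c \<in> charts L \<and> \<one>\<^bsub>L\<^esub> \<in> fst c"]) auto
  then show "(chart_dom, coord L) \<in> charts L" "\<one>\<^bsub>L\<^esub> \<in> chart_dom"
    by (auto simp: coord_def)
qed

lemma uncoord_coord [simp]: "x \<in> chart_dom \<Longrightarrow> uncoord L (coord L x) = x"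
  using chartD(3)[OF id_chart(1)] by (simp add: uncoord_def)

lemma uncoord_one [simp]: "uncoord L one_coord = \<one>\<^bsub>L\<^esub>"
  using id_chart(2) by simp

lemma coord_uncoord: "a \<in> coord L ` chart_dom \<Longrightarrow> uncoord L a \<in> chart_dom \<and> coord L (uncoord L a) = a"
  by (simp add: uncoord_def inv_into_into f_inv_into_f)

end

text \<open>\<open>J\<close> stands for multiplication by the imaginary unit on the representation
  space, so that complex linearity of derivatives can be expressed with real matrices.\<close>

locale lie_matrix_rep = lie_group_charts L
  for L :: "('g, 'n::finite) lie_data" +
  fixes r :: "'g \<Rightarrow> 'k::finite mtx" and J :: "'k mtx"
  assumes r_mult: "g \<in> carrier L \<Longrightarrow> g' \<in> carrier L \<Longrightarrow> r (g \<otimes>\<^bsub>L\<^esub> g') = r g * r g'"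
    and r_one: "r \<one>\<^bsub>L\<^esub> = 1"
    and r_holo: "(D, \<phi>) \<in> charts L \<Longrightarrow> a \<in> \<phi> ` D \<Longrightarrow>
      \<exists>f'. ((\<lambda>a. r (inv_into D \<phi> a)) has_derivative f') (at a) \<and> (\<forall>v. f' (im_unit v) = J * f' v)"
begin

lemma r_inv: "g \<in> carrier L \<Longrightarrow> r g * r (inv\<^bsub>L\<^esub> g) = 1" "g \<in> carrier L \<Longrightarrow> r (inv\<^bsub>L\<^esub> g) * r g = 1"
  by (simp_all add: r_mult[symmetric] r_one)

lemma continuous_map_r: "continuous_map (gtop L) euclidean r"
proof (rule pasting_lemma[where I = "charts L" and T = fst and f = "\<lambda>_. r"])
  fix c assume "c \<in> charts L"
  then obtain D \<phi> where c: "c = (D, \<phi>)" and D: "(D, \<phi>) \<in> charts L"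
    by (cases c) auto
  note C = chartD[OF D]
  show "openin (gtop L) (fst c)" using C(1) by (simp add: c)
  have "continuous_on (\<phi> ` D) (\<lambda>a. r (inv_into D \<phi> a))"
    using r_holo[OF D] by (meson continuous_at_imp_continuous_on has_derivative_continuous)
  then have "continuous_map (subtopology (gtop L) D) euclidean ((\<lambda>a. r (inv_into D \<phi> a)) \<circ> \<phi>)"
    using homeomorphic_imp_continuous_map[OF C(5)]
    by (intro continuous_map_compose[of _ "top_of_set (\<phi> ` D)"]) auto
  then show "continuous_map (subtopology (gtop L) (fst c)) euclidean r"
    unfolding c fst_conv by (rule continuous_map_eq) (use C(3) in auto)
next
  fix x assume "x \<in> topspace (gtop L)"
  then obtain D \<phi> where "(D, \<phi>) \<in> charts L" "x \<in> D"
    using chart_at by (auto simp: topspace)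
  then show "\<exists>c. c \<in> charts L \<and> x \<in> fst c \<and> r x = r x" by force
qed simp

text \<open>The differential of the representation at the identity, on the Lie algebra as seen in
  \<open>id_chart\<close>.\<close>

definition dr :: "complex^'n \<Rightarrow> 'k mtx" where
  "dr = frechet_derivative (\<lambda>a. r (uncoord L a)) (at one_coord)"

lemma dr: "((\<lambda>a. r (uncoord L a)) has_derivative dr) (at one_coord)"
  and dr_J: "dr (im_unit v) = J * dr v"
proof -
  obtain f' where f': "((\<lambda>a. r (uncoord L a)) has_derivative f') (at one_coord)" "\<And>v. f' (im_unit v) = J * f' v"
    using r_holo[OF id_chart(1), of one_coord] id_chart(2) by (auto simp: uncoord_def)
  then have "dr = f'"
    unfolding dr_def by (metis frechet_derivative_at)
  with f' show "((\<lambda>a. r (uncoord L a)) has_derivative dr) (at one_coord)" "dr (im_unit v) = J * dr v"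
    by simp_all
qed

lemma linear_dr: "linear dr"
  using dr by (rule has_derivative_linear)

text \<open>The preimage is \<open>X\<close> under the adjoint action of \<open>g\<close>. It arises
  by differentiating \<open>r\<close> along conjugation by \<open>g\<close>, which fixes the
  identity, in two ways.\<close>

lemma conj_dr:
  assumes g: "g \<in> carrier L"
  shows "r g * dr X * r (inv\<^bsub>L\<^esub> g) \<in> range dr"
proof -
  let ?h = "inv\<^bsub>L\<^esub> g"
  have h: "?h \<in> carrier L" using g by simp
  obtain D \<phi> where D: "(D, \<phi>) \<in> charts L" "?h \<in> D"
    using chart_at[OF h] .
  \<comment> \<open>Conjugation is split into a right and a left translation that meet in a chart
    around the inverse of \<open>g\<close>, a point that the identity chart need not
    contain.\<close>
  define \<kappa>1 where "\<kappa>1 a = \<phi> (uncoord L a \<otimes>\<^bsub>L\<^esub> ?h)" for a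
  define \<kappa>2 where "\<kappa>2 b = coord L (g \<otimes>\<^bsub>L\<^esub> inv_into D \<phi> b)" for b
  have \<kappa>1_one: "\<kappa>1 one_coord = \<phi> ?h" using h by (simp add: \<kappa>1_def)
  obtain \<kappa>1' where \<kappa>1': "(\<kappa>1 has_derivative \<kappa>1') (at one_coord)"
    and ev1: "\<forall>\<^sub>F a in nhds one_coord. a \<in> coord L ` chart_dom \<and> uncoord L a \<otimes>\<^bsub>L\<^esub> ?h \<in> D"
    using right_translation[OF id_chart(1) D(1) h id_chart(2)] h D(2)
    unfolding \<kappa>1_def uncoord_def[symmetric] by auto
  obtain \<kappa>2' where \<kappa>2': "(\<kappa>2 has_derivative \<kappa>2') (at (\<phi> ?h))"
    and ev2: "\<forall>\<^sub>F b in nhds (\<phi> ?h). b \<in> \<phi> ` D \<and> g \<otimes>\<^bsub>L\<^esub> inv_into D \<phi> b \<in> chart_dom"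
    using left_translation[OF D(1) id_chart(1) g D(2)] g id_chart(2)
    unfolding \<kappa>2_def by auto
  have \<kappa>': "(\<kappa>2 \<circ> \<kappa>1 has_derivative \<kappa>2' \<circ> \<kappa>1') (at one_coord)"
    by (rule diff_chain_at[OF \<kappa>1']) (simp add: \<kappa>1_one \<kappa>2')
  have \<kappa>_one: "(\<kappa>2 \<circ> \<kappa>1) one_coord = one_coord"
    using g D chartD(3)[OF D(1)] by (simp add: \<kappa>1_one \<kappa>2_def)
  have "((\<lambda>a. r (uncoord L a)) \<circ> (\<kappa>2 \<circ> \<kappa>1) has_derivative dr \<circ> (\<kappa>2' \<circ> \<kappa>1')) (at one_coord)"
    by (rule diff_chain_at[OF \<kappa>']) (simp only: \<kappa>_one dr)
  moreover have "\<forall>\<^sub>F a in nhds one_coord. r g * r (uncoord L a) * r ?h = ((\<lambda>a. r (uncoord L a)) \<circ> (\<kappa>2 \<circ> \<kappa>1)) a"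
  proof -
    have "(\<kappa>1 \<longlongrightarrow> \<kappa>1 one_coord) (nhds one_coord)"
      using has_derivative_continuous[OF \<kappa>1'] by (simp only: isCont_def tendsto_at_iff_tendsto_nhds)
    then have "(\<kappa>1 \<longlongrightarrow> \<phi> ?h) (nhds one_coord)"
      by (simp only: \<kappa>1_one)
    then have "\<forall>\<^sub>F a in nhds one_coord. \<kappa>1 a \<in> \<phi> ` D \<and> g \<otimes>\<^bsub>L\<^esub> inv_into D \<phi> (\<kappa>1 a) \<in> chart_dom"
      using ev2 by (rule eventually_compose_filterlim[rotated])
    with ev1 show ?thesis
    proof eventually_elim
      case (elim a)
      have ua: "uncoord L a \<in> carrier L"
        using elim chartD(4)[OF id_chart(1)] coord_uncoord[of a] by auto
      have "inv_into D \<phi> (\<kappa>1 a) = uncoord L a \<otimes>\<^bsub>L\<^esub> ?h"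
        using elim chartD(3)[OF D(1)] by (simp add: \<kappa>1_def)
      then have "uncoord L (\<kappa>2 (\<kappa>1 a)) = g \<otimes>\<^bsub>L\<^esub> (uncoord L a \<otimes>\<^bsub>L\<^esub> ?h)"
        using elim by (simp add: \<kappa>2_def)
      then show ?case
        using g h ua by (simp add: r_mult mult.assoc)
    qed
  qed
  ultimately have "((\<lambda>a. r g * r (uncoord L a) * r ?h) has_derivative dr \<circ> (\<kappa>2' \<circ> \<kappa>1')) (at one_coord)"
    by (rule has_derivative_eventually_eq)
  moreover have "((\<lambda>a. r g * r (uncoord L a) * r ?h) has_derivative (\<lambda>v. r g * dr v * r ?h)) (at one_coord)"
    by (auto intro!: derivative_eq_intros dr)
  ultimately have "dr \<circ> (\<kappa>2' \<circ> \<kappa>1') = (\<lambda>v. r g * dr v * r ?h)"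
    by (rule has_derivative_unique)
  then have "r g * dr X * r ?h = dr ((\<kappa>2' \<circ> \<kappa>1') X)"
    by (metis comp_apply)
  then show ?thesis by blast
qed

text \<open>Translating back by the inverse of \<open>uncoord L a\<close> moves the base point to
  the identity, where \<open>dr\<close> is the derivative.\<close>

lemma r_uncoord_derivative:
  assumes a: "a \<in> coord L ` chart_dom"
  obtains K where "\<And>v. K v \<in> range dr"
    "((\<lambda>a. r (uncoord L a)) has_derivative (\<lambda>v. r (uncoord L a) * K v)) (at a)"
proof -
  define g where "g = uncoord L a"
  have gD: "g \<in> chart_dom" and ga: "coord L g = a"
    using coord_uncoord[OF a] by (auto simp: g_def)
  then have g: "g \<in> carrier L" using chartD(4)[OF id_chart(1)] by auto
  define \<kappa> where "\<kappa> b = coord L (inv\<^bsub>L\<^esub> g \<otimes>\<^bsub>L\<^esub> uncoord L b)" for b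
  obtain \<kappa>' where \<kappa>': "(\<kappa> has_derivative \<kappa>') (at a)"
    and ev: "\<forall>\<^sub>F b in nhds a. b \<in> coord L ` chart_dom \<and> inv\<^bsub>L\<^esub> g \<otimes>\<^bsub>L\<^esub> uncoord L b \<in> chart_dom"
    using left_translation[OF id_chart(1) id_chart(1) inv_closed[OF g] gD] g id_chart(2)
    unfolding \<kappa>_def uncoord_def[symmetric] ga by auto
  have \<kappa>a: "\<kappa> a = one_coord"
    using g by (simp add: \<kappa>_def g_def[symmetric])
  have "((\<lambda>b. r g * r (uncoord L b)) \<circ> \<kappa> has_derivative (\<lambda>v. r g * dr v) \<circ> \<kappa>') (at a)"
    by (rule diff_chain_at[OF \<kappa>']) (auto intro!: derivative_eq_intros dr simp: \<kappa>a)
  moreover have "\<forall>\<^sub>F b in nhds a. r (uncoord L b) = ((\<lambda>b. r g * r (uncoord L b)) \<circ> \<kappa>) b"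
    using ev
  proof eventually_elim
    case (elim b)
    have ub: "uncoord L b \<in> carrier L"
      using elim chartD(4)[OF id_chart(1)] coord_uncoord[of b] by auto
    have "r g * (r (inv\<^bsub>L\<^esub> g) * r (uncoord L b)) = r (uncoord L b)"
      using r_inv(1)[OF g] by (simp add: mult.assoc[symmetric])
    then show ?case
      using elim g ub by (simp add: \<kappa>_def r_mult)
  qed
  ultimately have "((\<lambda>b. r (uncoord L b)) has_derivative (\<lambda>v. r g * dr v) \<circ> \<kappa>') (at a)"
    by (rule has_derivative_eventually_eq)
  then show ?thesis
    using that[of "\<lambda>v. dr (\<kappa>' v)"] by (auto simp: o_def g_def)
qed

lemma one_paramD:
  assumes "one_param L \<gamma> X"
  shows "\<gamma> t \<in> carrier L" "\<gamma> 0 = \<one>\<^bsub>L\<^esub>" "r (\<gamma> (s + t)) = r (\<gamma> s) * r (\<gamma> t)"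
    "((\<lambda>t. r (\<gamma> t)) has_vector_derivative r (\<gamma> t) * dr X) (at t)"
proof -
  have cont: "continuous_map euclideanreal (gtop L) \<gamma>" and add: "\<And>s t. \<gamma> (s + t) = \<gamma> s \<otimes>\<^bsub>L\<^esub> \<gamma> t"
    and der: "((\<lambda>t. coord L (\<gamma> t)) has_vector_derivative X) (at 0)"
    using assms by (auto simp: one_param_def)
  show car: "\<gamma> t \<in> carrier L" for t
    using cont by (auto simp: continuous_map_def topspace)
  show \<gamma>0: "\<gamma> 0 = \<one>\<^bsub>L\<^esub>"
    using add[of 0 0] car[of 0] by (metis add.right_neutral l_cancel_one')
  show mult: "r (\<gamma> (s + t)) = r (\<gamma> s) * r (\<gamma> t)" for s t
    by (simp add: add r_mult car)
  have "openin euclideanreal {t \<in> topspace euclideanreal. \<gamma> t \<in> chart_dom}"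
    by (rule openin_continuous_map_preimage[OF cont chartD(1)[OF id_chart(1)]])
  then have "open {t. \<gamma> t \<in> chart_dom}" by simp
  then have ev: "\<forall>\<^sub>F t in nhds 0. \<gamma> t \<in> chart_dom"
    using eventually_nhds_in_open[of "{t. \<gamma> t \<in> chart_dom}" 0] \<gamma>0 id_chart(2) by simp
  have "((\<lambda>a. r (uncoord L a)) \<circ> (\<lambda>t. coord L (\<gamma> t)) has_derivative dr \<circ> (\<lambda>t. t *\<^sub>R X)) (at 0)"
    by (rule diff_chain_at) (use der dr \<gamma>0 in \<open>simp_all add: has_vector_derivative_def\<close>)
  moreover have "\<forall>\<^sub>F t in nhds 0. r (\<gamma> t) = ((\<lambda>a. r (uncoord L a)) \<circ> (\<lambda>t. coord L (\<gamma> t))) t"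
    using ev by eventually_elim simp
  ultimately have "((\<lambda>t. r (\<gamma> t)) has_derivative dr \<circ> (\<lambda>t. t *\<^sub>R X)) (at 0)"
    by (rule has_derivative_eventually_eq)
  then have 0: "((\<lambda>t. r (\<gamma> t)) has_vector_derivative dr X) (at 0)"
    by (simp add: has_vector_derivative_def o_def linear_scale[OF linear_dr])
  have "((\<lambda>\<tau>. r (\<gamma> (\<tau> - t))) has_vector_derivative dr X) (at t)"
  proof -
    have "((\<lambda>\<tau>. r (\<gamma> \<tau>)) \<circ> (\<lambda>\<tau>. \<tau> - t) has_vector_derivative 1 *\<^sub>R dr X) (at t)"
      by (rule vector_diff_chain_at) (auto intro!: derivative_eq_intros simp: 0)
    then show ?thesis by (simp add: o_def)
  qed
  from has_vector_derivative_mult_right[OF this, of "r (\<gamma> t)"]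
  show "((\<lambda>t. r (\<gamma> t)) has_vector_derivative r (\<gamma> t) * dr X) (at t)"
    by (simp add: mult[symmetric])
qed

lemma lie_algebra_path:
  assumes "X \<in> lie_algebra L S"
  obtains \<gamma> where "\<And>t. \<gamma> t \<in> S" "\<And>t. \<gamma> t \<in> carrier L" "r (\<gamma> 0) = 1"
    "\<And>t. ((\<lambda>t. r (\<gamma> t)) has_vector_derivative r (\<gamma> t) * dr X) (at t)"
    "((\<lambda>t. r (\<gamma> t)) has_vector_derivative dr X) (at 0)"
proof -
  obtain \<gamma> where \<gamma>: "one_param L \<gamma> X" "\<And>t. \<gamma> t \<in> S"
    using assms by (auto simp: lie_algebra_def)
  note P = one_paramD[OF \<gamma>(1)]
  show ?thesis
    using that[OF \<gamma>(2) P(1) _ P(4)] P(2) P(4)[of 0] r_one by simp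
qed

end

section \<open>Representations with a compact real form\<close>

lemma eq_uminus_imp_zero:
  fixes x :: "'a::real_vector"
  assumes "x = - x"
  shows "x = 0"
proof -
  have "2 *\<^sub>R x = x + - x"
    unfolding assms[symmetric] by (rule scaleR_2)
  then show ?thesis by simp
qed

lemma real_form_decomp:
  assumes "real_form W"
  obtains a b where "a \<in> W" "b \<in> W" "x = a + im_unit b"
proof -
  have "x \<in> {a + im_unit b | a b. a \<in> W \<and> b \<in> W}"
    using assms by (simp add: real_form_def)
  with that show ?thesis by blast
qed

context lie_matrix_rep
begin

lemma lie_algebra_commute:
  assumes X: "X \<in> lie_algebra L S" and comm: "\<And>g. g \<in> S \<Longrightarrow> r g * A = A * r g"
  shows "dr X * A = A * dr X"
proof -
  obtain \<gamma> where \<gamma>: "\<And>t. \<gamma> t \<in> S" "((\<lambda>t. r (\<gamma> t)) has_vector_derivative dr X) (at 0)"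
    using lie_algebra_path[OF X] by metis
  have "((\<lambda>t. r (\<gamma> t) * A) has_vector_derivative dr X * A) (at 0)"
    by (intro has_vector_derivative_mult_left \<gamma>)
  moreover have "((\<lambda>t. r (\<gamma> t) * A) has_vector_derivative A * dr X) (at 0)"
    unfolding comm[OF \<gamma>(1)] by (intro has_vector_derivative_mult_right \<gamma>)
  ultimately show ?thesis by (rule vector_derivative_unique_at)
qed

lemma lie_algebra_skew:
  assumes X: "X \<in> lie_algebra L S" and orth: "\<And>g. g \<in> S \<Longrightarrow> orth (r g)"
  shows "adj (dr X) = - dr X"
proof -
  obtain \<gamma> where \<gamma>: "\<And>t. \<gamma> t \<in> S" "r (\<gamma> 0) = 1" "((\<lambda>t. r (\<gamma> t)) has_vector_derivative dr X) (at 0)"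
    using lie_algebra_path[OF X] by metis
  have "((\<lambda>t. adj (r (\<gamma> t)) * r (\<gamma> t)) has_vector_derivative
      adj (r (\<gamma> 0)) * dr X + adj (dr X) * r (\<gamma> 0)) (at 0)"
    by (intro has_vector_derivative_mult bounded_linear.has_vector_derivative[OF bounded_linear_adj] \<gamma>)
  moreover have "adj (r (\<gamma> t)) * r (\<gamma> t) = 1" for t
    using orth[OF \<gamma>(1)] by (simp add: orth_def)
  ultimately have "((\<lambda>t. 1) has_vector_derivative adj (r (\<gamma> 0)) * dr X + adj (dr X) * r (\<gamma> 0)) (at 0)"
    by simp
  from vector_derivative_unique_at[OF this has_vector_derivative_const]
  have "adj (r (\<gamma> 0)) * dr X + adj (dr X) * r (\<gamma> 0) = 0" .
  then show ?thesis
    using \<gamma>(2) by (simp add: eq_neg_iff_add_eq_0 add.commute)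
qed

end

text \<open>\<open>J\<close> is skew because the Euclidean inner product will be the real part of a
  Hermitian one. \<open>carrier_U\<close> says that \<open>U\<close> meets every connected
  component.\<close>

locale compact_form_rep = lie_matrix_rep L r J
  for L :: "('g, 'n::finite) lie_data" and r :: "'g \<Rightarrow> 'k::finite mtx" and J +
  fixes U :: "'g set"
  assumes U: "subgroup U L" "compactin (gtop L) U" "real_form (lie_algebra L U)"
    and carrier_U: "carrier L = U <#>\<^bsub>L\<^esub> connected_component_of_set (gtop L) \<one>\<^bsub>L\<^esub>"
    and U_orth: "u \<in> U \<Longrightarrow> orth (r u)"
    and J: "adj J = - J" "J * J = - 1" "g \<in> carrier L \<Longrightarrow> r g * J = J * r g"
begin

lemma U_carrier: "u \<in> U \<Longrightarrow> u \<in> carrier L"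
  using subgroup.subset[OF U(1)] by blast

lemma r_inv_U: "u \<in> U \<Longrightarrow> r (inv\<^bsub>L\<^esub> u) = adj (r u)"
proof -
  assume u: "u \<in> U"
  have "r (inv\<^bsub>L\<^esub> u) = r (inv\<^bsub>L\<^esub> u) * (r u * adj (r u))"
    using orthD(2)[OF U_orth[OF u]] by simp
  also have "\<dots> = adj (r u)"
    using r_inv(2)[OF U_carrier[OF u]] by (simp add: mult.assoc[symmetric])
  finally show ?thesis .
qed

lemma dr_decomp:
  assumes "real_form (lie_algebra L S)"
  obtains X Y where "X \<in> lie_algebra L S" "Y \<in> lie_algebra L S" "dr Z = dr X + J * dr Y"
proof -
  obtain X Y where "X \<in> lie_algebra L S" "Y \<in> lie_algebra L S" "Z = X + im_unit Y"
    using real_form_decomp[OF assms] .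
  then show ?thesis
    using that linear_add[OF linear_dr] dr_J by metis
qed

lemma dr_combine: "dr X + J * dr Y = dr (X + im_unit Y)"
  by (simp add: linear_add[OF linear_dr] dr_J)

lemma dr_U_J: "X \<in> lie_algebra L U \<Longrightarrow> dr X * J = J * dr X"
  by (rule lie_algebra_commute) (auto intro: J U_carrier)

lemma dr_U_skew: "X \<in> lie_algebra L U \<Longrightarrow> adj (dr X) = - dr X"
  by (rule lie_algebra_skew[OF _ U_orth])

lemma J_dr: "dr X * J = J * dr X"
proof -
  obtain X1 X2 where "X1 \<in> lie_algebra L U" "X2 \<in> lie_algebra L U" "dr X = dr X1 + J * dr X2"
    using dr_decomp[OF U(3)] .
  then show ?thesis
    by (simp add: dr_U_J algebra_simps)
qed

lemma subspace_range_dr: "subspace (range dr)"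
  using linear_subspace_image[OF linear_dr subspace_UNIV] .

text \<open>The conjugates of \<open>dr Y\<close> along a one-parameter subgroup of \<open>U\<close>
  stay in the closed subspace \<open>range dr\<close>, so their velocity lies there too. Brackets
  are thus obtained from the adjoint action rather than from \<open>lie_bracket\<close> in a
  chart.\<close>

lemma bracket_lie_algebra:
  assumes X: "X \<in> lie_algebra L U"
  shows "dr X * dr Y - dr Y * dr X \<in> range dr"
proof -
  obtain \<gamma> where \<gamma>: "\<And>t. \<gamma> t \<in> U" "r (\<gamma> 0) = 1" "((\<lambda>t. r (\<gamma> t)) has_vector_derivative dr X) (at 0)"
    using lie_algebra_path[OF X] by metis
  let ?f = "\<lambda>t. r (\<gamma> t) * dr Y * adj (r (\<gamma> t))"
  have "(?f has_vector_derivative r (\<gamma> 0) * dr Y * adj (dr X) + dr X * dr Y * adj (r (\<gamma> 0))) (at 0)"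
    by (intro has_vector_derivative_mult has_vector_derivative_mult_left
        bounded_linear.has_vector_derivative[OF bounded_linear_adj] \<gamma>)
  then have der: "(?f has_vector_derivative dr X * dr Y - dr Y * dr X) (at 0)"
    by (simp add: \<gamma>(2) dr_U_skew[OF X])
  have mem: "?f t \<in> range dr" for t
    using conj_dr[OF U_carrier[OF \<gamma>(1)], of t Y] r_inv_U[OF \<gamma>(1)] by simp
  have "((\<lambda>t. (1 / norm (t - 0)) *\<^sub>R (?f t - (?f 0 + (t - 0) *\<^sub>R (dr X * dr Y - dr Y * dr X)))) \<longlongrightarrow> 0) (at 0)"
    using der unfolding has_vector_derivative_def has_derivative_within by simp
  then have "((\<lambda>t. (1 / norm t) *\<^sub>R (?f t - ?f 0) - (t / norm t) *\<^sub>R (dr X * dr Y - dr Y * dr X)) \<longlongrightarrow> 0) (at 0)"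
    by (simp add: algebra_simps)
  \<comment> \<open>One-sided, so that \<open>t / norm t\<close> is 1.\<close>
  then have "((\<lambda>t. (1 / norm t) *\<^sub>R (?f t - ?f 0) - (t / norm t) *\<^sub>R (dr X * dr Y - dr Y * dr X)) \<longlongrightarrow> 0) (at_right 0)"
    by (rule tendsto_within_subset) simp
  then have "((\<lambda>t. (1 / norm t) *\<^sub>R (?f t - ?f 0) - (dr X * dr Y - dr Y * dr X)) \<longlongrightarrow> 0) (at_right 0)"
    by (rule Lim_transform_eventually) (auto simp: eventually_at_filter)
  then have "((\<lambda>t. (1 / norm t) *\<^sub>R (?f t - ?f 0)) \<longlongrightarrow> dr X * dr Y - dr Y * dr X) (at_right 0)"
    by (rule LIM_zero_cancel)
  moreover have "closed (range dr)"
    by (rule closed_subspace[OF subspace_range_dr])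
  moreover have "(1 / norm t) *\<^sub>R (?f t - ?f 0) \<in> range dr" for t
    by (intro subspace_scale subspace_diff subspace_range_dr mem)
  ultimately show ?thesis
    by (intro Lim_in_closed_set[of "range dr" _ "at_right (0 :: real)"]) simp_all
qed

text \<open>In \<open>dr X1 + J * dr X2\<close> with \<open>X1\<close> and \<open>X2\<close> in the
  Lie algebra of \<open>U\<close>, the first term is skew and the second symmetric, as
  \<open>J\<close> is skew and commutes with \<open>dr X2\<close>. A skew element is therefore
  tangent to \<open>r U\<close>, which provides \<open>H_tangent\<close>.\<close>

sublocale self_adjoint_group "range dr" "r ` U"
proof
  show "subspace (range dr)" by (rule subspace_range_dr)
  show "adj X \<in> range dr" if "X \<in> range dr" for X
  proof -
    from that obtain Z where "X = dr Z" by blast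
    then obtain X1 X2 where X: "X1 \<in> lie_algebra L U" "X2 \<in> lie_algebra L U" "X = dr X1 + J * dr X2"
      using dr_decomp[OF U(3)] by metis
    then have "adj X = - dr X1 + J * dr X2"
      by (simp add: dr_U_skew J dr_U_J)
    also have "\<dots> = dr (- X1 + im_unit X2)"
      using dr_combine[of "- X1" X2] by (simp add: linear_neg[OF linear_dr])
    finally show ?thesis by simp
  qed
  show "X * Y - Y * X \<in> range dr" if "X \<in> range dr" "Y \<in> range dr" for X Y
  proof -
    from that obtain Z W where "X = dr Z" and Y: "Y = dr W" by blast
    then obtain X1 X2 where X: "X1 \<in> lie_algebra L U" "X2 \<in> lie_algebra L U" "X = dr X1 + J * dr X2"
      using dr_decomp[OF U(3)] by metis
    have "X * Y - Y * X = (dr X1 * dr W - dr W * dr X1) + J * (dr X2 * dr W - dr W * dr X2)"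
      unfolding X(3) Y using J_dr[of W] by (simp add: algebra_simps) (simp add: mult.assoc[symmetric])
    moreover obtain A B where "dr X1 * dr W - dr W * dr X1 = dr A" "dr X2 * dr W - dr W * dr X2 = dr B"
      using bracket_lie_algebra[OF X(1)] bracket_lie_algebra[OF X(2)] by blast
    ultimately show ?thesis by (simp add: dr_combine)
  qed
  have "compactin euclidean (r ` U)"
    by (rule image_compactin[OF U(2) continuous_map_r])
  then show "closed (r ` U)"
    by (simp add: compact_imp_closed)
  show "orth u" if "u \<in> r ` U" for u
    using that U_orth by auto
  show "1 \<in> r ` U"
    using subgroup.one_closed[OF U(1)] r_one by (metis image_eqI)
  show "u * w \<in> r ` U" if "u \<in> r ` U" "w \<in> r ` U" for u w
    using that subgroup.m_closed[OF U(1)] r_mult U_carrier by (auto simp: image_iff) metis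
  show "adj u \<in> r ` U" if "u \<in> r ` U" for u
    using that subgroup.m_inv_closed[OF U(1)] r_inv_U by (auto simp: image_iff) metis
  show "u * X * adj u \<in> range dr" if "u \<in> r ` U" "X \<in> range dr" for u X
    using that conj_dr[OF U_carrier] r_inv_U by auto
  show "\<exists>c. (\<forall>t. c t \<in> r ` U) \<and> c 0 = 1 \<and> (c has_vector_derivative X) (at 0)"
    if "X \<in> range dr" "adj X = - X" for X
  proof -
    from that obtain Z where "X = dr Z" by blast
    then obtain X1 X2 where X: "X1 \<in> lie_algebra L U" "X2 \<in> lie_algebra L U" "X = dr X1 + J * dr X2"
      using dr_decomp[OF U(3)] by metis
    have "adj X = - dr X1 + J * dr X2"
      using X by (simp add: dr_U_skew J dr_U_J)
    with that(2) X(3) have "J * dr X2 = - (J * dr X2)"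
      by simp
    with X have "X = dr X1" by (simp add: eq_uminus_imp_zero)
    obtain \<gamma> where "\<And>t. \<gamma> t \<in> U" "r (\<gamma> 0) = 1" "((\<lambda>t. r (\<gamma> t)) has_vector_derivative dr X1) (at 0)"
      using lie_algebra_path[OF X(1)] by metis
    with \<open>X = dr X1\<close> show ?thesis
      by (intro exI[of _ "\<lambda>t. r (\<gamma> t)"]) auto
  qed
qed

lemma conj_range_dr:
  "g \<in> carrier L \<Longrightarrow> X \<in> range dr \<Longrightarrow> r g * X * r (inv\<^bsub>L\<^esub> g) \<in> range dr"
  using conj_dr by auto

text \<open>The straight segment in coordinates from the identity to \<open>n\<close> stays in the
  ball and, translated by \<open>g\<close>, becomes a tangent path between the two points compared
  here.\<close>

lemma chart_step:
  assumes \<epsilon>: "ball one_coord \<epsilon> \<subseteq> coord L ` chart_dom"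
    and g: "g \<in> carrier L" and n: "n \<in> chart_dom" "coord L n \<in> ball one_coord \<epsilon>"
  shows "r g \<in> polar_set \<longleftrightarrow> r (g \<otimes>\<^bsub>L\<^esub> n) \<in> polar_set"
proof -
  let ?v = "coord L n - one_coord"
  define a where "a t = one_coord + t *\<^sub>R ?v" for t :: real
  define x where "x t = uncoord L (a t)" for t
  have a_mem: "a t \<in> coord L ` chart_dom" if "t \<in> {0..1}" for t
  proof -
    have "norm (t *\<^sub>R ?v) \<le> norm ?v"
      using that by (simp add: mult_left_le_one_le)
    also have "\<dots> < \<epsilon>" using n(2) by (simp add: dist_norm norm_minus_commute)
    finally have "a t \<in> ball one_coord \<epsilon>" by (simp add: a_def dist_norm)
    then show ?thesis using \<epsilon> by blast
  qed
  have x: "x t \<in> carrier L" if "t \<in> {0..1}" for t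
    using coord_uncoord[OF a_mem[OF that]] chartD(4)[OF id_chart(1)] by (auto simp: x_def)
  have "\<exists>m\<in>range dr. ((\<lambda>t. r (x t)) has_vector_derivative r (x t) * m) (at t within {0..1})"
    if t: "t \<in> {0..1}" for t
  proof -
    obtain K where K: "\<And>v. K v \<in> range dr"
      "((\<lambda>a. r (uncoord L a)) has_derivative (\<lambda>v. r (uncoord L (a t)) * K v)) (at (a t))"
      by (rule r_uncoord_derivative[OF a_mem[OF t]]) (rule that)
    have "(a has_derivative (\<lambda>h. h *\<^sub>R ?v)) (at t within {0..1})"
      unfolding a_def by (auto intro!: derivative_eq_intros)
    from has_derivative_compose[OF this K(2)]
    have D: "((\<lambda>t. r (x t)) has_derivative (\<lambda>h. r (x t) * K (h *\<^sub>R ?v))) (at t within {0..1})"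
      by (simp add: x_def)
    have "r (x t) * K (h *\<^sub>R ?v) = h *\<^sub>R (r (x t) * K ?v)" for h
      using linear_scale[OF has_derivative_linear[OF D], of h 1] by simp
    with D have "((\<lambda>t. r (x t)) has_vector_derivative r (x t) * K ?v) (at t within {0..1})"
      by (simp add: has_vector_derivative_def)
    with K(1) show ?thesis by blast
  qed
  then obtain m where m: "\<And>t. t \<in> {0..1} \<Longrightarrow> m t \<in> range dr"
    "\<And>t. t \<in> {0..1} \<Longrightarrow> ((\<lambda>t. r (x t)) has_vector_derivative r (x t) * m t) (at t within {0..1})"
    by metis
  let ?r = "\<lambda>t. r (g \<otimes>\<^bsub>L\<^esub> x t)" and ?s = "\<lambda>t. r (inv\<^bsub>L\<^esub> (g \<otimes>\<^bsub>L\<^esub> x t))"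
  have gx: "g \<otimes>\<^bsub>L\<^esub> x t \<in> carrier L" if "t \<in> {0..1}" for t
    using g x[OF that] by simp
  have "tangent_path ?r ?s m"
    unfolding tangent_path_def
  proof (intro ballI conjI)
    fix t :: real assume t: "t \<in> {0..1}"
    have "((\<lambda>t. r g * r (x t)) has_vector_derivative r g * (r (x t) * m t)) (at t within {0..1})"
      by (intro has_vector_derivative_mult_right m t)
    then have "((\<lambda>t. r g * r (x t)) has_vector_derivative ?r t * m t) (at t within {0..1})"
      using g x[OF t] by (simp add: r_mult mult.assoc)
    then show der: "(?r has_vector_derivative ?r t * m t) (at t within {0..1})"
      by (rule has_vector_derivative_transform[OF t, rotated]) (use g x in \<open>simp add: r_mult\<close>)
    show "(?s has_vector_derivative - (m t * ?s t)) (at t within {0..1})"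
      by (rule has_vector_derivative_mtx_inverse[OF der t]) (rule r_inv(1)[OF gx])
    show "?r t * ?s t = 1" by (rule r_inv(1)[OF gx[OF t]])
    show "m t \<in> range dr" by (rule m(1)[OF t])
    fix X assume X: "X \<in> range dr"
    show "?r t * X * ?s t \<in> range dr"
      by (rule conj_range_dr[OF gx[OF t] X])
    show "?s t * X * ?r t \<in> range dr"
      using conj_range_dr[OF inv_closed[OF gx[OF t]] X] gx[OF t] by simp
  qed
  from tangent_path_polar_iff[OF this] show ?thesis
    using g n by (simp add: x_def a_def)
qed

lemma continuous_map_left_mult:
  assumes "g \<in> carrier L"
  shows "continuous_map (gtop L) (gtop L) (\<lambda>x. g \<otimes>\<^bsub>L\<^esub> x)"
proof -
  have "continuous_map (prod_topology (gtop L) (gtop L)) (gtop L) (\<lambda>(x, y). x \<otimes>\<^bsub>L\<^esub> y)"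
    using lie unfolding complex_lie_group_def by blast
  moreover have "continuous_map (gtop L) (prod_topology (gtop L) (gtop L)) (\<lambda>x. (g, x))"
    using assms by (auto simp: continuous_map_pairwise o_def topspace)
  ultimately have "continuous_map (gtop L) (gtop L) ((\<lambda>(x, y). x \<otimes>\<^bsub>L\<^esub> y) \<circ> (\<lambda>x. (g, x)))"
    by (rule continuous_map_compose[rotated])
  then show ?thesis by (simp add: o_def)
qed


lemma r_mem_polar_set:
  assumes "g \<in> carrier L"
  shows "r g \<in> polar_set"
proof -
  obtain \<epsilon> where \<epsilon>: "\<epsilon> > 0" "ball one_coord \<epsilon> \<subseteq> coord L ` chart_dom"
    using chartD(2)[OF id_chart(1)] id_chart(2) by (meson imageI open_contains_ball)
  define N where "N = {x \<in> chart_dom. coord L x \<in> ball one_coord \<epsilon>}"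
  note C = chartD[OF id_chart(1)]
  have N_open: "openin (gtop L) N"
  proof -
    have "continuous_map (subtopology (gtop L) chart_dom) euclidean (coord L)"
      using homeomorphic_imp_continuous_map[OF C(5)] by (simp add: continuous_map_in_subtopology)
    from openin_continuous_map_preimage[OF this, of "ball one_coord \<epsilon>"]
    have "openin (subtopology (gtop L) chart_dom) N"
      using C(4) by (simp add: N_def topspace Int_absorb1)
    then show ?thesis
      using C(1) openin_trans_full by blast
  qed
  have one_N: "\<one>\<^bsub>L\<^esub> \<in> N"
    using \<epsilon>(1) id_chart(2) by (simp add: N_def)
  have step: "r g \<in> polar_set \<longleftrightarrow> r (g \<otimes>\<^bsub>L\<^esub> n) \<in> polar_set" if "g \<in> carrier L" "n \<in> N" for g n
    using chart_step[OF \<epsilon>(2) that(1)] that(2) by (simp add: N_def)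
  \<comment> \<open>The parameter \<open>P\<close> covers the set and its complement at
    once.\<close>
  have open_if: "openin (gtop L) {g \<in> carrier L. P (r g \<in> polar_set)}" for P
  proof (subst openin_subopen, safe)
    fix g assume g: "g \<in> carrier L" "P (r g \<in> polar_set)"
    let ?T = "{x \<in> topspace (gtop L). inv\<^bsub>L\<^esub> g \<otimes>\<^bsub>L\<^esub> x \<in> N}"
    have "openin (gtop L) ?T"
      by (rule openin_continuous_map_preimage[OF continuous_map_left_mult N_open]) (use g in simp)
    moreover have "g \<in> ?T" using g one_N by (simp add: topspace)
    moreover have "?T \<subseteq> {g \<in> carrier L. P (r g \<in> polar_set)}"
    proof safe
      fix x assume x: "x \<in> topspace (gtop L)" "inv\<^bsub>L\<^esub> g \<otimes>\<^bsub>L\<^esub> x \<in> N"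
      then show xc: "x \<in> carrier L" by (simp add: topspace)
      have "g \<otimes>\<^bsub>L\<^esub> (inv\<^bsub>L\<^esub> g \<otimes>\<^bsub>L\<^esub> x) = x"
        using g(1) xc by (simp add: m_assoc[symmetric])
      then show "P (r x \<in> polar_set)"
        using step[OF g(1) x(2)] g(2) by simp
    qed
    ultimately show "\<exists>T. openin (gtop L) T \<and> g \<in> T \<and> T \<subseteq> {g \<in> carrier L. P (r g \<in> polar_set)}"
      by blast
  qed
  let ?A = "{g \<in> carrier L. r g \<in> polar_set}" and ?B = "{g \<in> carrier L. \<not> r g \<in> polar_set}"
  let ?C = "connected_component_of_set (gtop L) \<one>\<^bsub>L\<^esub>"
  have "connectedin (gtop L) ?C"
    by (rule connectedin_connected_component_of)
  moreover have "\<one>\<^bsub>L\<^esub> \<in> ?C"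
    by (simp add: connected_component_of_refl topspace)
  moreover have "1 * mexp 0 \<in> polar_set"
    unfolding polar_set_def using H_one subspace_0[OF subspace_range_dr] by (fastforce simp: sym_part_def)
  then have "\<one>\<^bsub>L\<^esub> \<in> ?A" by (simp add: r_one)
  ultimately have "?B \<inter> ?C = {}"
    using open_if[of "\<lambda>b. b"] open_if[of Not] unfolding connectedin topspace by blast
  then have comp: "r x \<in> polar_set" if "x \<in> ?C" for x
    using that connected_component_of_subset_topspace[of "gtop L"] by (auto simp: topspace)
  \<comment> \<open>Outside the identity component a factor from \<open>U\<close> is split off and
    absorbed into the orthogonal factor.\<close>
  obtain u x where u: "u \<in> U" and x: "x \<in> ?C" and g: "g = u \<otimes>\<^bsub>L\<^esub> x"
    using assms carrier_U by (auto simp: set_mult_def)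
  have xc: "x \<in> carrier L"
    using x connected_component_of_subset_topspace[of "gtop L"] by (auto simp: topspace)
  obtain w X where w: "w \<in> r ` U" and X: "X \<in> sym_part" and rx: "r x = w * mexp X"
    using comp[OF x] by (auto simp: polar_set_def)
  have "r g = (r u * w) * mexp X"
    unfolding g r_mult[OF U_carrier[OF u] xc] rx by (simp add: mult.assoc)
  with X H_mult[OF imageI[OF u] w] show ?thesis
    unfolding polar_set_def by blast
qed

end

text \<open>\<sigma> plays the conjugation of the real form \<open>V\<close> as a real matrix:
  antilinear, hence anticommuting with \<open>J\<close>, an isometric involution, and commuting with
  \<open>G\<close>, which preserves \<open>V\<close>.\<close>

locale real_form_rep = compact_form_rep L r J U
  for L :: "('g, 'n::finite) lie_data" and r :: "'g \<Rightarrow> 'k::finite mtx" and J U +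
  fixes G :: "'g set" and \<sigma> :: "'k mtx"
  assumes G: "real_form (lie_algebra L G)"
    and \<sigma>: "\<sigma> * \<sigma> = 1" "adj \<sigma> = \<sigma>" "\<sigma> * J = - (J * \<sigma>)" "g \<in> G \<Longrightarrow> r g * \<sigma> = \<sigma> * r g"
begin

text \<open>\<sigma> commutes with the differential of \<open>G\<close> and anticommutes with
  \<open>J\<close>, so conjugating by it realizes the conjugation of the Lie algebra relative to
  that of \<open>G\<close>.\<close>

lemma \<sigma>_conj:
  assumes "X \<in> lie_algebra L G" "Y \<in> lie_algebra L G"
  shows "\<sigma> * (dr X + J * dr Y) * \<sigma> = dr X - J * dr Y"
proof -
  have \<sigma>\<sigma>: "\<sigma> * (\<sigma> * A) = A" for A using \<sigma>(1) by (simp add: mult.assoc[symmetric])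
  have \<sigma>J: "\<sigma> * (J * A) = - (J * (\<sigma> * A))" for A using \<sigma>(3) by (simp add: mult.assoc[symmetric])
  have "dr X * \<sigma> = \<sigma> * dr X" "dr Y * \<sigma> = \<sigma> * dr Y"
    by (intro lie_algebra_commute[OF assms(1)] lie_algebra_commute[OF assms(2)] \<sigma>(4); assumption)+
  then show ?thesis
    by (simp add: algebra_simps \<sigma>\<sigma> \<sigma>J)
qed

lemma \<sigma>_range_dr:
  assumes "X \<in> range dr"
  shows "\<sigma> * X * \<sigma> \<in> range dr"
proof -
  from assms obtain Z where "X = dr Z" by blast
  then obtain X1 X2 where X: "X1 \<in> lie_algebra L G" "X2 \<in> lie_algebra L G" "X = dr X1 + J * dr X2"
    using dr_decomp[OF G] by metis
  have "\<sigma> * X * \<sigma> = dr (X1 + im_unit (- X2))"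
    using \<sigma>_conj[OF X(1,2)] dr_combine[of X1 "- X2"] by (simp add: X(3) linear_neg[OF linear_dr])
  then show ?thesis by simp
qed

text \<open>An element fixed by \<sigma> has no \<open>J\<close>-part, so it is \<open>dr X\<close>
  for some \<open>X\<close> in the Lie algebra of \<open>G\<close>. The one-parameter subgroup of
  \<open>X\<close> maps to the exponential, since
  \<open>r (\<gamma> t) * mexp (t *\<^sub>R (- Q))\<close> has derivative 0.\<close>

lemma fixed_sym_part_path:
  assumes Q: "Q \<in> sym_part" and fixed: "\<sigma> * Q * \<sigma> = Q"
  obtains \<gamma> where "\<And>t :: real. \<gamma> t \<in> G" "\<And>t. r (\<gamma> t) = mexp (t *\<^sub>R Q)"
proof -
  have adjQ: "adj Q = Q" using Q by (simp add: sym_part_def)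
  from sym_partD(1)[OF Q] obtain Z where "Q = dr Z" by blast
  then obtain X Y where X: "X \<in> lie_algebra L G" "Y \<in> lie_algebra L G" "Q = dr X + J * dr Y"
    using dr_decomp[OF G] by metis
  have "dr X - J * dr Y = dr X + J * dr Y"
    using \<sigma>_conj[OF X(1,2)] fixed X(3) by simp
  then have "J * dr Y = - (J * dr Y)"
    by (simp add: diff_conv_add_uminus del: add_uminus_conv_diff)
  then have QX: "Q = dr X" using X(3) by (simp add: eq_uminus_imp_zero)
  obtain \<gamma> where \<gamma>: "\<And>t. \<gamma> t \<in> G" "r (\<gamma> 0) = 1"
    "\<And>t. ((\<lambda>t. r (\<gamma> t)) has_vector_derivative r (\<gamma> t) * Q) (at t)"
    using lie_algebra_path[OF X(1)] unfolding QX by metis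
  have "r (\<gamma> t) = mexp (t *\<^sub>R Q)" for t
  proof -
    let ?f = "\<lambda>t. r (\<gamma> t) * mexp (t *\<^sub>R (- Q))"
    have "(?f has_vector_derivative 0) (at t within UNIV)" for t
    proof -
      have "(?f has_vector_derivative r (\<gamma> t) * (mexp (t *\<^sub>R (- Q)) * (- Q)) + r (\<gamma> t) * Q * mexp (t *\<^sub>R (- Q))) (at t)"
        using adjQ by (intro has_vector_derivative_mult \<gamma> mexp_has_vector_derivative) simp
      moreover have "mexp (t *\<^sub>R (- Q)) * Q = Q * mexp (t *\<^sub>R (- Q))"
        using adjQ by (intro mexp_commute) simp_all
      ultimately show ?thesis by (simp add: mult.assoc)
    qed
    then obtain c where "\<And>t. ?f t = c"
      using has_vector_derivative_zero_constant[of UNIV ?f] by auto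
    from this[of t] this[of 0] have "?f t = 1" using \<gamma>(2) by simp
    then have "?f t * mexp (t *\<^sub>R Q) = mexp (t *\<^sub>R Q)" by simp
    then show ?thesis
      using mexp_inverse(2)[of "t *\<^sub>R Q"] adjQ by (simp add: mult.assoc)
  qed
  with \<gamma>(1) show ?thesis by (rule that)
qed

text \<open>
  On the part of \<open>sym_part\<close> anticommuting with \<open>\<sigma>\<close> the moment map vanishes at every vector fixed
  by \<open>\<sigma>\<close>; the part commuting with \<open>\<sigma>\<close> is tangent to \<open>G\<close>.
\<close>

lemma minimal_imp_critical:
  assumes x: "\<sigma> \<star> x = x" and min: "\<And>g. g \<in> G \<Longrightarrow> norm x \<le> norm (r g \<star> x)"
  shows "critical x"
  unfolding critical_def
proof
  fix Z assume Z: "Z \<in> sym_part"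
  \<comment> \<open>Twice the part of \<open>Z\<close> commuting with \<sigma>; as \<sigma> fixes
    \<open>x\<close>, its moment at \<open>x\<close> is twice that of \<open>Z\<close>.\<close>
  define Q where "Q = Z + \<sigma> * Z * \<sigma>"
  have adjZ: "adj Z = Z" using Z by (simp add: sym_part_def)
  have Q: "Q \<in> sym_part"
    unfolding Q_def using \<sigma>_range_dr[OF sym_partD(1)[OF Z]] sym_partD(1)[OF Z] adjZ \<sigma>(2)
    by (simp add: sym_part_def M_closed mult.assoc)
  then have adjQ: "adj Q = Q" by (simp add: sym_part_def)
  have "\<sigma> * Q * \<sigma> = Q"
    using \<sigma>(1) by (simp add: Q_def algebra_simps) (simp add: mult.assoc[symmetric] add.commute)
  then obtain \<gamma> where \<gamma>: "\<And>t :: real. \<gamma> t \<in> G" "\<And>t. r (\<gamma> t) = mexp (t *\<^sub>R Q)"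
    using fixed_sym_part_path[OF Q] by blast
  let ?g = "\<lambda>t. inner x (mexp (t *\<^sub>R Q) \<star> x)"
  have lin: "linear (\<lambda>A. inner x (A \<star> x))"
    by (rule linearI) (simp_all add: app_linear inner_add_right)
  have "(?g has_vector_derivative inner x ((mexp (0 *\<^sub>R Q) * Q) \<star> x)) (at 0)"
    by (rule bounded_linear.has_vector_derivative[OF _ mexp_has_vector_derivative[OF adjQ]])
      (use lin in \<open>simp add: linear_conv_bounded_linear\<close>)
  then have "DERIV ?g 0 :> inner x (Q \<star> x)"
    by (simp add: has_real_derivative_iff_has_vector_derivative)
  moreover have "?g 0 \<le> ?g t" for t
  proof -
    \<comment> \<open>Half the time, because the square of
      \<open>norm (mexp ((t / 2) *\<^sub>R Q) \<star> x)\<close> is \<open>?g t\<close>, which is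
      linear in the exponential.\<close>
    have tQ: "adj ((t / 2) *\<^sub>R Q) = (t / 2) *\<^sub>R Q" using adjQ by simp
    have "(norm x)\<^sup>2 \<le> (norm (mexp ((t / 2) *\<^sub>R Q) \<star> x))\<^sup>2"
      using min[OF \<gamma>(1)[of "t / 2"]] \<gamma>(2) by (intro power_mono) simp_all
    also have "\<dots> = inner x ((mexp ((t / 2) *\<^sub>R Q) * mexp ((t / 2) *\<^sub>R Q)) \<star> x)"
      using tQ by (simp add: power2_norm_eq_inner inner_app app_mult)
    also have "\<dots> = ?g t"
      using mexp_add[OF adjQ, of "t / 2" "t / 2"] by simp
    finally show ?thesis by (simp add: power2_norm_eq_inner)
  qed
  ultimately have "inner x (Q \<star> x) = 0"
    using DERIV_local_min[of ?g "inner x (Q \<star> x)" 0 1] by simp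
  moreover have "inner x ((\<sigma> * Z * \<sigma>) \<star> x) = inner x (Z \<star> x)"
    using inner_app[of \<sigma> x] \<sigma>(2) by (simp add: app_mult x)
  ultimately show "inner x (Z \<star> x) = 0"
    by (simp add: Q_def app_linear inner_add_right)
qed

lemma orbit_reaches_critical:
  assumes v: "\<sigma> \<star> v = v" and x: "critical x" and g: "g \<in> carrier L" "v = r g \<star> x"
  obtains a u where "a \<in> G" "u \<in> U" "r a \<star> v = r u \<star> x"
proof -
  obtain w Z where w: "w \<in> r ` U" and Z: "Z \<in> sym_part" and rg: "r g = w * mexp Z"
    using r_mem_polar_set[OF g(1)] by (auto simp: polar_set_def)
  \<comment> \<open>Moving \<open>w\<close> past the exponential exhibits \<open>v\<close> as a
    positive matrix applied to the critical vector \<open>w \<star> x\<close>.\<close>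
  have "v = mexp (w * Z * adj w) \<star> w \<star> x"
    using mexp_conj[OF H_orth[OF w] sym_partD(2)[OF Z], symmetric] orthD(1)[OF H_orth[OF w]]
    by (simp add: g(2) rg app_mult[symmetric] mult.assoc)
  then obtain Q u where Q: "Q \<in> sym_part" "\<sigma> * Q * \<sigma> = Q" and u: "u \<in> r ` U" "mexp Q \<star> v = u \<star> w \<star> x"
    using fixed_point_reaches_critical_orbit[OF \<sigma>(1,2) \<sigma>_range_dr v critical_app[OF w x] sym_part_conj[OF w Z]]
    by metis
  obtain \<gamma> where \<gamma>: "\<And>t :: real. \<gamma> t \<in> G" "\<And>t. r (\<gamma> t) = mexp (t *\<^sub>R Q)"
    using fixed_sym_part_path[OF Q] by blast
  obtain u' where "u' \<in> U" "u * w = r u'"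
    using H_mult[OF u(1) w] by blast
  with \<gamma>(1)[of 1] \<gamma>(2)[of 1] u(2) show ?thesis
    using that[of "\<gamma> 1" u'] by (simp add: app_mult[symmetric])
qed

end

section \<open>Realification of a Hermitian space\<close>

definition enc :: "complex^'m::finite \<Rightarrow> real^('m \<times> bool)" where
  "enc x = (\<chi> p. if snd p then Im (x $ fst p) else Re (x $ fst p))"

definition dec :: "real^('m::finite \<times> bool) \<Rightarrow> complex^'m" where
  "dec y = (\<chi> i. Complex (y $ (i, False)) (y $ (i, True)))"

lemma enc_dec [simp]: "enc (dec y) = y"
  by (auto simp: enc_def dec_def vec_eq_iff)

lemma dec_enc [simp]: "dec (enc x) = x"
  by (simp add: enc_def dec_def vec_eq_iff)

lemma linear_enc: "linear enc"
  by (rule linearI) (auto simp: enc_def vec_eq_iff)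

lemma linear_dec: "linear dec"
  by (rule linearI) (auto simp: dec_def vec_eq_iff complex_eq_iff)

definition opm :: "(real^'k::finite \<Rightarrow> real^'k) \<Rightarrow> 'k mtx" where
  "opm f = Mtx (matrix f)"

lemma opm_app: "linear f \<Longrightarrow> opm f \<star> x = f x"
  by (simp add: opm_def app.rep_eq Mtx_inverse matrix_works)

lemma entry_axis: "entry A i j = (A \<star> axis j 1) $ i"
  by (simp add: app_nth axis_def if_distrib[of "\<lambda>x. _ * x"] cong: if_cong)

lemma adj_eqI:
  assumes "\<And>x y. inner (A \<star> x) y = inner x (B \<star> y)"
  shows "adj A = B"
proof (rule app_eqI)
  fix y
  have "inner x (adj A \<star> y) = inner x (B \<star> y)" for x
    using assms[of x y] inner_app[of A x y] by simp
  then show "adj A \<star> y = B \<star> y"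
    using vector_eq_ldot by blast
qed

lemma has_derivative_mtxI:
  fixes f :: "'a::real_normed_vector \<Rightarrow> 'k::finite mtx"
  assumes "\<And>i j. ((\<lambda>x. entry (f x) i j) has_derivative (\<lambda>v. entry (f' v) i j)) F"
  shows "(f has_derivative f') F"
proof -
  define E :: "'k \<Rightarrow> 'k \<Rightarrow> 'k mtx" where "E i j = mtx_of (\<lambda>k l. if i = k \<and> j = l then 1 else 0)" for i j
  have E: "A = (\<Sum>i\<in>UNIV. \<Sum>j\<in>UNIV. entry A i j *\<^sub>R E i j)" for A
  proof -
    have "(\<Sum>i\<in>UNIV. \<Sum>j\<in>UNIV. entry A i j * (if i = k \<and> j = l then 1 else 0)) = entry A k l" for k l
    proof -
      have "(\<Sum>j\<in>UNIV. entry A i j * (if i = k \<and> j = l then 1 else 0)) = (if i = k then entry A k l else 0)" for i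
        by (simp add: if_distrib[of "\<lambda>x. _ * x"] cong: if_cong)
      then show ?thesis by simp
    qed
    then show ?thesis by (simp add: mtx_eq_iff entry_sum E_def)
  qed
  have "((\<lambda>x. \<Sum>i\<in>UNIV. \<Sum>j\<in>UNIV. entry (f x) i j *\<^sub>R E i j) has_derivative
      (\<lambda>v. \<Sum>i\<in>UNIV. \<Sum>j\<in>UNIV. entry (f' v) i j *\<^sub>R E i j)) F"
    by (intro has_derivative_sum has_derivative_scaleR_left assms)
  then show ?thesis
    unfolding E[symmetric] .
qed

lemma hermitian_innerD:
  assumes "hermitian_inner h"
  shows "h (x + y) z = h x z + h y z" "h z (x + y) = h z x + h z y"
    "h (c *s x) y = c * h x y" "h x (c *s y) = cnj c * h x y"
    "h y x = cnj (h x y)" "x \<noteq> 0 \<Longrightarrow> 0 < Re (h x x)"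
proof -
  note H = assms[unfolded hermitian_inner_def]
  show add: "h (x + y) z = h x z + h y z" for x y z using H by blast
  show mult: "h (c *s x) y = c * h x y" for c x y using H by blast
  show sym: "h y x = cnj (h x y)" for x y using H by blast
  show "x \<noteq> 0 \<Longrightarrow> 0 < Re (h x x)" using H by blast
  show "h z (x + y) = h z x + h z y"
    by (subst (1 2 3) sym) (simp add: add)
  show "h x (c *s y) = cnj c * h x y"
    by (subst (1 2) sym) (simp add: mult)
qed

lemma scaleR_eq_scalar_mult: "c *\<^sub>R x = (of_real c :: complex) *s x" for x :: "complex^'m"
  by (simp add: vec_eq_iff complex_eq_iff)

text \<open>In the coordinates \<open>enc\<close> the form \<open>Re h\<close> has a positive
  definite Gram matrix \<open>S\<close>; composing \<open>enc\<close> with the positive square root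
  of \<open>S\<close> gives the isometry.\<close>

lemma hermitian_isometry:
  fixes h :: "complex^'m::finite \<Rightarrow> complex^'m \<Rightarrow> complex"
  assumes h: "hermitian_inner h"
  obtains T :: "complex^'m \<Rightarrow> real^('m \<times> bool)" and T'
  where "linear T" "linear T'" "\<And>x. T' (T x) = x" "\<And>y. T (T' y) = y"
    "\<And>x y. inner (T x) (T y) = Re (h x y)"
proof -
  note H = hermitian_innerD[OF h]
  have linl: "linear (\<lambda>a. Re (h (dec a) b))" for b
    by (rule linearI) (simp_all add: linear_add[OF linear_dec] linear_scale[OF linear_dec] H(1,3) scaleR_eq_scalar_mult)
  define w :: "real^('m \<times> bool) \<Rightarrow> real^('m \<times> bool)"
    where "w b = (\<chi> p. Re (h (dec (axis p 1)) (dec b)))" for b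
  have linw: "linear w"
    by (rule linearI) (simp_all add: w_def vec_eq_iff linear_add[OF linear_dec]
        linear_scale[OF linear_dec] H(2,4) scaleR_eq_scalar_mult)
  have inner_w: "inner a (w b) = Re (h (dec a) (dec b))" for a b
  proof -
    have "(\<Sum>p\<in>UNIV. (a $ p) *\<^sub>R axis p 1) = a"
      using basis_expansion[of a] by (simp add: scalar_mult_eq_scaleR)
    then have "Re (h (dec a) (dec b)) = Re (h (dec (\<Sum>p\<in>UNIV. (a $ p) *\<^sub>R axis p 1)) (dec b))"
      by simp
    also have "\<dots> = (\<Sum>p\<in>UNIV. a $ p * Re (h (dec (axis p 1)) (dec b)))"
      by (simp add: linear_sum[OF linl] linear_scale[OF linl])
    finally show ?thesis by (simp add: inner_vec_def w_def)
  qed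
  define S where "S = opm w"
  have S: "inner a (S \<star> b) = Re (h (dec a) (dec b))" for a b
    by (simp add: S_def opm_app[OF linw] inner_w)
  have "adj S = S"
  proof (rule adj_eqI)
    fix x y
    have "Re (h (dec y) (dec x)) = Re (h (dec x) (dec y))"
      by (subst H(5)) simp
    then show "inner (S \<star> x) y = inner x (S \<star> y)"
      by (simp add: S inner_commute[of "S \<star> x"])
  qed
  moreover have "0 < inner x (S \<star> x)" if "x \<noteq> 0" for x
  proof -
    have "dec x \<noteq> 0" using that linear_0[OF linear_enc] by (metis enc_dec)
    then show ?thesis by (simp add: S H(6))
  qed
  ultimately obtain Z where Z: "adj Z = Z" "mexp Z = S"
    using mexp_log by metis
  define R where "R = mexp ((1/2) *\<^sub>R Z)"
  have R: "adj R = R" "R * R = S" "R * mexp (- ((1/2) *\<^sub>R Z)) = 1" "mexp (- ((1/2) *\<^sub>R Z)) * R = 1"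
    using mexp_half[OF Z(1)] mexp_inverse[of "(1/2) *\<^sub>R Z"] Z by (simp_all add: R_def)
  show ?thesis
  proof
    show "linear (\<lambda>x. R \<star> enc x)"
      by (rule linearI) (simp_all add: linear_add[OF linear_enc] linear_scale[OF linear_enc] app_linear)
    show "linear (\<lambda>y. dec (mexp (- ((1/2) *\<^sub>R Z)) \<star> y))"
      by (rule linearI) (simp_all add: linear_add[OF linear_dec] linear_scale[OF linear_dec] app_linear)
    show "inner (R \<star> enc x) (R \<star> enc y) = Re (h x y)" for x y
      by (simp add: inner_app R(1)) (simp add: app_mult[symmetric] R(2) S)
  qed (simp_all add: app_mult[symmetric] R)
qed

section \<open>Complex-linear maps and conjugations as real-linear maps\<close>

lemma linear_complex_linear:
  fixes f :: "complex^'m::finite \<Rightarrow> complex^'m"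
  assumes "Vector_Spaces.linear (*s) (*s) f"
  shows "linear f" "f (c *s x) = c *s f x"
proof -
  interpret Vector_Spaces.linear "(*s)" "(*s)" f by (rule assms)
  show "f (c *s x) = c *s f x" by (rule scale)
  show "linear f"
    by (rule linearI) (simp_all add: add scaleR_eq_scalar_mult scale)
qed

lemma linear_im_unit: "linear im_unit"
  by (rule linearI) (simp_all add: vec_eq_iff algebra_simps)

text \<open>The map is \<open>a + im_unit b \<mapsto> a - im_unit b\<close>; uniqueness of the
  splitting is what makes it linear.\<close>

lemma real_form_conjugation:
  assumes V: "real_form V"
  obtains c where "linear c" "\<And>x. c (c x) = x" "\<And>x. x \<in> V \<Longrightarrow> c x = x"
    "\<And>x. c (im_unit x) = - im_unit (c x)"
proof -
  have sub: "subspace V" and V0: "V \<inter> im_unit ` V = {0}"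
    using V by (auto simp: real_form_def)
  have "\<forall>x. \<exists>a b. a \<in> V \<and> b \<in> V \<and> x = a + im_unit b"
    using real_form_decomp[OF V] by metis
  then obtain A B where AB: "\<And>x. A x \<in> V" "\<And>x. B x \<in> V" "\<And>x. x = A x + im_unit (B x)"
    by metis
  have uniq: "A x = a \<and> B x = b" if "a \<in> V" "b \<in> V" "x = a + im_unit b" for x a b
  proof -
    have "A x - a = im_unit (b - B x)"
      using AB(3)[of x] that(3) linear_diff[OF linear_im_unit, of b "B x"] by (simp add: algebra_simps)
    moreover have "A x - a \<in> V" "b - B x \<in> V"
      using sub AB(1,2) that by (auto intro: subspace_diff)
    ultimately have "A x - a \<in> V \<inter> im_unit ` V"
      by (intro IntI image_eqI)
    then have 0: "A x - a = 0" using V0 by blast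
    then have "im_unit (im_unit (b - B x)) = 0"
      using \<open>A x - a = im_unit (b - B x)\<close> linear_0[OF linear_im_unit] by metis
    with 0 show ?thesis by simp
  qed
  define c where "c x = A x - im_unit (B x)" for x
  have c: "c (a + im_unit b) = a - im_unit b" if "a \<in> V" "b \<in> V" for a b
    using uniq[OF that refl] by (simp add: c_def)
  have "linear c"
  proof (rule linearI)
    fix x y and k :: real
    have "A (x + y) = A x + A y \<and> B (x + y) = B x + B y"
    proof (rule uniq)
      show "x + y = A x + A y + im_unit (B x + B y)"
      proof -
        have "x + y = (A x + im_unit (B x)) + (A y + im_unit (B y))"
          by (simp only: AB(3)[symmetric])
        then show ?thesis by (simp add: linear_add[OF linear_im_unit])
      qed
    qed (use sub AB in \<open>auto intro: subspace_add\<close>)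
    then show "c (x + y) = c x + c y"
      by (simp add: c_def linear_add[OF linear_im_unit])
    have "A (k *\<^sub>R x) = k *\<^sub>R A x \<and> B (k *\<^sub>R x) = k *\<^sub>R B x"
    proof (rule uniq)
      show "k *\<^sub>R x = k *\<^sub>R A x + im_unit (k *\<^sub>R B x)"
      proof -
        have "k *\<^sub>R x = k *\<^sub>R (A x + im_unit (B x))"
          by (simp only: AB(3)[symmetric])
        then show ?thesis by (simp add: linear_scale[OF linear_im_unit] scaleR_right_distrib)
      qed
    qed (use sub AB in \<open>auto intro: subspace_scale\<close>)
    then show "c (k *\<^sub>R x) = k *\<^sub>R c x"
      by (simp add: c_def linear_scale[OF linear_im_unit] scaleR_diff_right)
  qed
  moreover have neg: "- b \<in> V" if "b \<in> V" for b using sub that by (rule subspace_neg)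
  have "c (c x) = x" for x
    using c[OF AB(1)[of x] neg[OF AB(2)[of x]]] AB(3)[of x]
    by (simp add: c_def linear_neg[OF linear_im_unit])
  moreover have "c x = x" if "x \<in> V" for x
    using c[OF that subspace_0[OF sub]] by (simp add: linear_0[OF linear_im_unit])
  moreover have "c (im_unit x) = - im_unit (c x)" for x
  proof -
    have "im_unit x = - B x + im_unit (A x)"
      using arg_cong[OF AB(3)[of x], of im_unit] linear_add[OF linear_im_unit, of "A x" "im_unit (B x)"]
      by (simp add: add.commute)
    then have "c (im_unit x) = - B x - im_unit (A x)"
      using c[OF neg[OF AB(2)] AB(1)] by metis
    then show ?thesis
      by (simp add: c_def linear_diff[OF linear_im_unit])
  qed
  ultimately show ?thesis by (rule that)
qed

text \<open>As \<open>h\<close> is real on \<open>V\<close>, the mixed terms of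
  \<open>h (a + im_unit b) (a' + im_unit b')\<close> are purely imaginary, so reversing the signs of
  \<open>b\<close> and \<open>b'\<close> leaves the real part alone.\<close>

lemma real_form_conjugation_isometry:
  assumes h: "hermitian_inner h" and V: "real_form V" and real: "\<forall>x\<in>V. \<forall>y\<in>V. h x y \<in> \<real>"
    and c: "linear c" "\<And>x. x \<in> V \<Longrightarrow> c x = x" "\<And>x. c (im_unit x) = - im_unit (c x)"
  shows "Re (h (c x) (c y)) = Re (h x y)"
proof -
  obtain a b where ab: "a \<in> V" "b \<in> V" "x = a + im_unit b" using real_form_decomp[OF V] .
  obtain a' b' where ab': "a' \<in> V" "b' \<in> V" "y = a' + im_unit b'" using real_form_decomp[OF V] .
  have im: "Im (h u w) = 0" if "u \<in> V" "w \<in> V" for u w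
    using real that by (auto simp: complex_is_Real_iff)
  have cx: "c x = a + (- \<i>) *s b" "c y = a' + (- \<i>) *s b'"
    using ab ab' c by (simp_all add: linear_add[OF c(1)])
  have "Re (h (c x) (c y)) = Re (h (a + im_unit b) (a' + im_unit b'))"
    unfolding cx hermitian_innerD(1-4)[OF h] using ab(1,2) ab'(1,2) by (simp add: im)
  then show ?thesis
    using ab(3) ab'(3) by simp
qed

lemma holo_onD:
  assumes "holo_on J J' S f" "x \<in> S"
  obtains f' where "(f has_derivative f') (at x)" "\<And>v. f' (J v) = J' (f' v)"
  using assms unfolding holo_on_def by blast

lemma holomorphic_repD:
  assumes "holomorphic_rep L \<rho>"
  shows "g \<in> carrier L \<Longrightarrow> Vector_Spaces.linear (*s) (*s) (\<rho> g)" "g \<in> carrier L \<Longrightarrow> bij (\<rho> g)"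
    "g \<in> carrier L \<Longrightarrow> g' \<in> carrier L \<Longrightarrow> \<rho> (g \<otimes>\<^bsub>L\<^esub> g') x = \<rho> g (\<rho> g' x)"
    "(D, \<phi>) \<in> charts L \<Longrightarrow> holo_on im_unit im_unit (\<phi> ` D) (\<lambda>a. \<rho> (inv_into D \<phi> a) x)"
  using assms unfolding holomorphic_rep_def by auto

section \<open>Transfer of orbits and minimal vectors to real matrices\<close>

theorem theorem5p5:
  fixes GC :: "('g, 'n::finite) lie_data"
    and G G' U K K' :: "'g set"
    and \<gg> \<gg>' \<uu> :: "(complex^'n) set"
    and V V' :: "(complex^'m::finite) set"
    and \<rho> \<rho>' \<rho>C :: "'g \<Rightarrow> complex^'m \<Rightarrow> complex^'m"
    and h :: "complex^'m \<Rightarrow> complex^'m \<Rightarrow> complex"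
    and v v' :: "complex^'m"
  assumes GC: "semisimple_complex_lie_group GC"
    and G: "semisimple_real_form_group GC G" and "\<gg> = lie_algebra GC G"
    and G': "semisimple_real_form_group GC G'" and "\<gg>' = lie_algebra GC G'"
    and triple: "compatible_triple (lie_bracket GC) \<gg> \<gg>' \<uu>"
    and U: "semisimple_real_form_group GC U" "compact_subgroup GC U" and "lie_algebra GC U = \<uu>"
    and K: "associated_maximal_compact GC G U K"
    and K': "associated_maximal_compact GC G' U K'"
    and reps: "real_rep GC G V \<rho>" "real_rep GC G' V' \<rho>'"
    and complexified: "complexified_action GC G V \<rho> \<rho>C" "complexified_action GC G' V' \<rho>' \<rho>C"
    and V_compatible: "compatible_real_forms V V'"
    and h: "hermitian_inner h"
    and h_invariant: "\<forall>u\<in>U. \<forall>x y. h (\<rho>C u x) (\<rho>C u y) = h x y"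
    and h_real: "\<forall>x\<in>V. \<forall>y\<in>V. h x y \<in> \<real>" "\<forall>x\<in>V'. \<forall>y\<in>V'. h x y \<in> \<real>"
    and v: "v \<in> V" and v': "v' \<in> V'"
  shows
    "(v' \<in> orbit \<rho>C (carrier GC) v \<and>
      v \<in> minimal_vectors (hnorm h) \<rho> G V \<and> v' \<in> minimal_vectors (hnorm h) \<rho>' G' V'
      \<longrightarrow> orbit \<rho>C U v = orbit \<rho>C U v' \<and>
          orbit \<rho> K v \<subseteq> orbit \<rho>C U v \<and> orbit \<rho>' K' v' \<subseteq> orbit \<rho>C U v)
     \<and>
     (G' = U \<longrightarrow>
      (orbit \<rho> G v \<subseteq> orbit \<rho>C (carrier GC) v \<and> orbit \<rho>' G' v' \<subseteq> orbit \<rho>C (carrier GC) v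
       \<longleftrightarrow> orbit \<rho> G v \<inter> orbit \<rho>' G' v' \<noteq> {}))"
proof -
  have lie: "complex_lie_group GC"
    using GC by (simp add: semisimple_complex_lie_group_def)
  interpret lie_group_charts GC by unfold_locales (rule lie)
  have sub: "subgroup G GC" "subgroup G' GC" "subgroup U GC"
    and forms: "real_form (lie_algebra GC G)" "real_form (lie_algebra GC G')" "real_form (lie_algebra GC U)"
    and U_comp: "carrier GC = U <#>\<^bsub>GC\<^esub> connected_component_of_set (gtop GC) \<one>\<^bsub>GC\<^esub>"
    using G G' U(1) by (auto simp: semisimple_real_form_group_def real_form_lie_algebra_def)
  have V_form: "real_form V" "real_form V'" and hol: "holomorphic_rep GC \<rho>C"
    and res: "\<And>g x. g \<in> G \<Longrightarrow> x \<in> V \<Longrightarrow> \<rho>C g x = \<rho> g x"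
    "\<And>g x. g \<in> G' \<Longrightarrow> x \<in> V' \<Longrightarrow> \<rho>C g x = \<rho>' g x"
    using complexified by (auto simp: complexified_action_def)
  note R = holomorphic_repD[OF hol]
  have car: "\<And>g. g \<in> G \<Longrightarrow> g \<in> carrier GC" "\<And>g. g \<in> G' \<Longrightarrow> g \<in> carrier GC"
    "\<And>g. g \<in> U \<Longrightarrow> g \<in> carrier GC"
    using sub by (auto dest: subgroup.subset)
  have lin\<rho>: "linear (\<rho>C g)" and i\<rho>: "\<rho>C g (c *s x) = c *s \<rho>C g x" if "g \<in> carrier GC" for g c x
    using linear_complex_linear[OF R(1)[OF that]] by auto
  \<comment> \<open>The image of the identity is idempotent and injective, hence trivial.\<close>
  have \<rho>_one: "\<rho>C \<one>\<^bsub>GC\<^esub> x = x" for x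
  proof -
    have "\<rho>C \<one>\<^bsub>GC\<^esub> (\<rho>C \<one>\<^bsub>GC\<^esub> x) = \<rho>C \<one>\<^bsub>GC\<^esub> x"
      using R(3)[of "\<one>\<^bsub>GC\<^esub>" "\<one>\<^bsub>GC\<^esub>" x] by simp
    then show ?thesis
      using R(2)[of "\<one>\<^bsub>GC\<^esub>"] by (simp add: bij_def inj_eq)
  qed
  have \<rho>_inv: "\<rho>C (inv\<^bsub>GC\<^esub> g) (\<rho>C g x) = x" "\<rho>C g (\<rho>C (inv\<^bsub>GC\<^esub> g) x) = x" if "g \<in> carrier GC" for g x
    using R(3)[of "inv\<^bsub>GC\<^esub> g" g x] R(3)[of g "inv\<^bsub>GC\<^esub> g" x] that by (simp_all add: \<rho>_one)

  obtain T :: "complex^'m \<Rightarrow> real^('m \<times> bool)" and T' where T: "linear T" "linear T'"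
    "\<And>x. T' (T x) = x" "\<And>y. T (T' y) = y" "\<And>x y. inner (T x) (T y) = Re (h x y)"
    using hermitian_isometry[OF h] by blast
  \<comment> \<open>Real matrices represent the group action and the antilinear conjugations
    alike.\<close>
  define mat where "mat f = opm (T \<circ> f \<circ> T')" for f
  have mat_app: "mat f \<star> T x = T (f x)" if "linear f" for f x
    using opm_app[of "T \<circ> f \<circ> T'" "T x"] that T(1-3) by (simp add: mat_def linear_compose)
  have mat_eqI: "A = B" if "\<And>x. A \<star> T x = B \<star> T x" for A B :: "('m \<times> bool) mtx"
    using that T(4) by (intro app_eqI) metis
  define r where "r g = mat (\<rho>C g)" for g
  define J where "J = mat im_unit"
  have r_app: "r g \<star> T x = T (\<rho>C g x)" if "g \<in> carrier GC" for g x
    unfolding r_def by (rule mat_app[OF lin\<rho>[OF that]])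
  have J_app: "J \<star> T x = T (im_unit x)" for x
    unfolding J_def by (rule mat_app[OF linear_im_unit])
  have T_neg: "T (- x) = - T x" for x by (rule linear_neg[OF T(1)])
  have mat_adj: "adj A = B" if "\<And>x y. inner (A \<star> T x) (T y) = inner (T x) (B \<star> T y)" for A B
    using that T(4) by (intro adj_eqI) metis
  have T_inj: "x = y" if "T x = T y" for x y using that T(3) by metis
  have norm_T: "norm (T x) = hnorm h x" for x
    by (simp add: hnorm_def norm_eq_sqrt_inner T(5))

  interpret lie_matrix_rep GC r J
  proof unfold_locales
    show "r (g \<otimes>\<^bsub>GC\<^esub> g') = r g * r g'" if "g \<in> carrier GC" "g' \<in> carrier GC" for g g'
      by (rule mat_eqI) (simp add: that r_app app_mult R(3))
    show "r \<one>\<^bsub>GC\<^esub> = 1"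
      by (rule mat_eqI) (simp add: r_app \<rho>_one)
    fix D \<phi> a assume D: "(D, \<phi>) \<in> charts GC" "a \<in> \<phi> ` D"
    have "\<exists>f'. ((\<lambda>a. \<rho>C (inv_into D \<phi> a) x) has_derivative f') (at a) \<and> (\<forall>v. f' (im_unit v) = im_unit (f' v))" for x
      using holo_onD[OF R(4)[OF D(1), of x] D(2)] by metis
    then obtain F where F: "\<And>x. ((\<lambda>a. \<rho>C (inv_into D \<phi> a) x) has_derivative F x) (at a)"
      "\<And>x v. F x (im_unit v) = im_unit (F x v)"
      by metis
    have nth: "bounded_linear (\<lambda>x. T x $ i)" for i
      using T(1) by (simp add: linear_conv_bounded_linear[symmetric] linear_iff)
    \<comment> \<open>Holomorphy is given vector by vector; the derivative of the matrix is put
      together from its columns, which belong to the vectors \<open>T' (axis q 1)\<close>.\<close>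
    define f' where "f' v = mtx_of (\<lambda>p q. T (F (T' (axis q 1)) v) $ p)" for v
    have ev: "\<forall>\<^sub>F a in nhds a. a \<in> \<phi> ` D"
      by (rule eventually_nhds_in_open[OF chartD(2)[OF D(1)] D(2)])
    have "((\<lambda>a. r (inv_into D \<phi> a)) has_derivative f') (at a)"
    proof (rule has_derivative_mtxI)
      fix p q
      have "((\<lambda>a. T (\<rho>C (inv_into D \<phi> a) (T' (axis q 1))) $ p) has_derivative
          (\<lambda>v. T (F (T' (axis q 1)) v) $ p)) (at a)"
        by (rule bounded_linear.has_derivative[OF nth F(1)])
      moreover have "\<forall>\<^sub>F a in nhds a. entry (r (inv_into D \<phi> a)) p q = T (\<rho>C (inv_into D \<phi> a) (T' (axis q 1))) $ p"
        using ev
      proof eventually_elim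
        case (elim b)
        then have "inv_into D \<phi> b \<in> carrier GC"
          using chartD(4)[OF D(1)] inv_into_into[of b \<phi> D] by auto
        from r_app[OF this, of "T' (axis q 1)"] show ?case
          by (simp add: entry_axis T(4))
      qed
      ultimately show "((\<lambda>a. entry (r (inv_into D \<phi> a)) p q) has_derivative (\<lambda>v. entry (f' v) p q)) (at a)"
        unfolding f'_def entry_simps by (rule has_derivative_eventually_eq)
    qed
    moreover have "f' (im_unit v) = J * f' v" for v
    proof -
      have "entry (J * f' v) p q = (J \<star> T (F (T' (axis q 1)) v)) $ p" for p q
        by (simp add: entry_mult app_nth f'_def)
      then show ?thesis
        by (simp add: mtx_eq_iff J_app F(2)) (simp add: f'_def F(2))
    qed
    ultimately show "\<exists>f'. ((\<lambda>a. r (inv_into D \<phi> a)) has_derivative f') (at a) \<and> (\<forall>v. f' (im_unit v) = J * f' v)"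
      by blast
  qed

  interpret compact_form_rep GC r J U
  proof unfold_locales
    show "compactin (gtop GC) U" using U(2) by (simp add: compact_subgroup_def)
    show "orth (r u)" if "u \<in> U" for u
    proof -
      have "inner (r u \<star> T x) (r u \<star> T y) = inner (T x) (T y)" for x y
        using h_invariant that by (simp add: r_app car(3) T(5))
      then have "inner ((adj (r u) * r u) \<star> T x) (T y) = inner (T x) (T y)" for x y
        by (simp add: app_mult inner_app)
      then have "adj (adj (r u) * r u) = 1"
        by (intro mat_adj) simp
      then show ?thesis by (intro orthI) simp
    qed
    show "adj J = - J"
      by (rule mat_adj) (simp add: J_app app_linear T(5) hermitian_innerD(3,4)[OF h])
    show "J * J = - 1"
      by (rule mat_eqI) (simp add: app_mult J_app app_linear T_neg)
    show "r g * J = J * r g" if "g \<in> carrier GC" for g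
      by (rule mat_eqI) (simp add: app_mult J_app r_app that i\<rho>)
  qed (use sub(3) forms(3) U_comp in \<open>auto intro: subgroup.m_closed subgroup.one_closed subgroup.m_inv_closed
      dest: subgroup.subset\<close>)

  \<comment> \<open>Stated for a general pair \<open>H\<close>, \<open>W\<close>, since it is
    applied to \<open>G\<close> with \<open>V\<close> and to \<open>G'\<close> with
    \<open>V'\<close>.\<close>
  have conj: "\<exists>\<sigma>. real_form_rep GC r J U H \<sigma> \<and> (\<forall>x\<in>W. \<sigma> \<star> T x = T x)"
    if H: "subgroup H GC" "real_form (lie_algebra GC H)" and W: "real_form W" "\<forall>x\<in>W. \<forall>y\<in>W. h x y \<in> \<real>"
      and stable: "\<And>g x. g \<in> H \<Longrightarrow> x \<in> W \<Longrightarrow> \<rho>C g x \<in> W" for H W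
  proof -
    obtain c where c: "linear c" "\<And>x. c (c x) = x" "\<And>x. x \<in> W \<Longrightarrow> c x = x"
      "\<And>x. c (im_unit x) = - im_unit (c x)"
      using real_form_conjugation[OF W(1)] by metis
    define \<sigma> where "\<sigma> = mat c"
    have \<sigma>_app: "\<sigma> \<star> T x = T (c x)" for x unfolding \<sigma>_def by (rule mat_app[OF c(1)])
    have \<sigma>\<sigma>: "\<sigma> * \<sigma> = 1" by (rule mat_eqI) (simp add: app_mult \<sigma>_app c(2))
    have "real_form_rep GC r J U H \<sigma>"
    proof unfold_locales
      show "\<sigma> * \<sigma> = 1" by (rule \<sigma>\<sigma>)
      show "adj \<sigma> = \<sigma>"
      proof (rule mat_adj)
        fix x y
        have "Re (h (c x) (c (c y))) = Re (h x (c y))"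
          by (rule real_form_conjugation_isometry[OF h W c(1,3,4)])
        then show "inner (\<sigma> \<star> T x) (T y) = inner (T x) (\<sigma> \<star> T y)"
          by (simp add: \<sigma>_app T(5) c(2))
      qed
      show "\<sigma> * J = - (J * \<sigma>)"
        by (rule mat_eqI) (simp add: app_mult \<sigma>_app J_app c(4) app_linear T_neg)
      show "r g * \<sigma> = \<sigma> * r g" if g: "g \<in> H" for g
      proof (rule mat_eqI)
        fix x
        have gc: "g \<in> carrier GC" using H(1) g by (auto dest: subgroup.subset)
        obtain a b where ab: "a \<in> W" "b \<in> W" "x = a + im_unit b" using real_form_decomp[OF W(1)] .
        \<comment> \<open>\<open>\<rho>C g\<close> is complex linear and preserves \<open>W\<close>,
          so it respects the splitting through which \<open>c\<close> acts.\<close>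
        have "\<rho>C g (c x) = c (\<rho>C g x)"
          using ab c stable[OF g]
          by (simp add: linear_add[OF c(1)] linear_add[OF lin\<rho>[OF gc]] linear_diff[OF lin\<rho>[OF gc]]
              linear_neg[OF lin\<rho>[OF gc]] i\<rho>[OF gc])
        then show "(r g * \<sigma>) \<star> T x = (\<sigma> * r g) \<star> T x"
          by (simp add: app_mult \<sigma>_app r_app gc)
      qed
    qed (rule H(2))
    with c(3) show ?thesis by (auto simp: \<sigma>_app)
  qed
  have stable: "\<rho>C g x \<in> V" if "g \<in> G" "x \<in> V" for g x
    using reps(1) that res(1)[OF that] unfolding real_rep_def by (metis bij_betw_apply)
  have stable': "\<rho>C g x \<in> V'" if "g \<in> G'" "x \<in> V'" for g x
    using reps(2) that res(2)[OF that] unfolding real_rep_def by (metis bij_betw_apply)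
  obtain \<sigma> where \<sigma>: "real_form_rep GC r J U G \<sigma>" "\<sigma> \<star> T v = T v"
    using conj[OF sub(1) forms(1) V_form(1) h_real(1) stable] v by blast
  obtain \<sigma>' where \<sigma>': "real_form_rep GC r J U G' \<sigma>'" "\<sigma>' \<star> T v' = T v'"
    using conj[OF sub(2) forms(2) V_form(2) h_real(2) stable'] v' by blast
  interpret A: real_form_rep GC r J U G \<sigma> by (rule \<sigma>(1))
  interpret B: real_form_rep GC r J U G' \<sigma>' by (rule \<sigma>'(1))

  have part1: "orbit \<rho>C U v = orbit \<rho>C U v' \<and>
      orbit \<rho> K v \<subseteq> orbit \<rho>C U v \<and> orbit \<rho>' K' v' \<subseteq> orbit \<rho>C U v"
    if orb: "v' \<in> orbit \<rho>C (carrier GC) v"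
      and min: "v \<in> minimal_vectors (hnorm h) \<rho> G V" "v' \<in> minimal_vectors (hnorm h) \<rho>' G' V'"
  proof -
    obtain g where g: "g \<in> carrier GC" "v' = \<rho>C g v"
      using orb by (auto simp: orbit_def)
    have "critical (T v)"
      by (rule A.minimal_imp_critical[OF \<sigma>(2)])
        (use min(1) v in \<open>simp add: minimal_vectors_def r_app car norm_T res\<close>)
    moreover have "critical (r g \<star> T v)"
      unfolding r_app[OF g(1)] g(2)[symmetric]
      by (rule B.minimal_imp_critical[OF \<sigma>'(2)])
        (use min(2) v' in \<open>simp add: minimal_vectors_def r_app car norm_T res\<close>)
    ultimately obtain w where "w \<in> r ` U" "r g \<star> T v = w \<star> T v"
      by (rule critical_polar_orbit[OF _ _ r_mem_polar_set[OF g(1)]])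
    then obtain u where u: "u \<in> U" and "T v' = T (\<rho>C u v)"
      using r_app[OF g(1)] by (auto simp: r_app car g(2))
    then have v'u: "v' = \<rho>C u v" using T_inj by blast
    have uc: "u \<in> carrier GC" using u by (rule car(3))
    have Uv: "orbit \<rho>C U v = orbit \<rho>C U v'"
    proof
      show "orbit \<rho>C U v \<subseteq> orbit \<rho>C U v'"
      proof (clarsimp simp: orbit_def)
        fix w assume w: "w \<in> U"
        have "\<rho>C w v = \<rho>C (w \<otimes>\<^bsub>GC\<^esub> inv\<^bsub>GC\<^esub> u) v'"
          using w uc by (simp add: v'u R(3) car \<rho>_inv)
        moreover have "w \<otimes>\<^bsub>GC\<^esub> inv\<^bsub>GC\<^esub> u \<in> U"
          using w u sub(3) by (simp add: subgroup.m_closed subgroup.m_inv_closed)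
        ultimately show "\<rho>C w v \<in> (\<lambda>g. \<rho>C g v') ` U" by blast
      qed
      show "orbit \<rho>C U v' \<subseteq> orbit \<rho>C U v"
      proof (clarsimp simp: orbit_def)
        fix w assume w: "w \<in> U"
        have "\<rho>C w v' = \<rho>C (w \<otimes>\<^bsub>GC\<^esub> u) v"
          using w uc by (simp add: v'u R(3) car)
        moreover have "w \<otimes>\<^bsub>GC\<^esub> u \<in> U"
          using w u sub(3) by (simp add: subgroup.m_closed)
        ultimately show "\<rho>C w v' \<in> (\<lambda>g. \<rho>C g v) ` U" by blast
      qed
    qed
    have KU: "K \<subseteq> G" "K \<subseteq> U" "K' \<subseteq> G'" "K' \<subseteq> U"
      using K K' by (auto simp: associated_maximal_compact_def)
    have "\<rho> g v = \<rho>C g v" if "g \<in> K" for g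
      using res(1)[OF _ v] KU that by auto
    then have "orbit \<rho> K v \<subseteq> orbit \<rho>C U v"
      unfolding orbit_def using KU(2) by auto
    moreover have "\<rho>' g v' = \<rho>C g v'" if "g \<in> K'" for g
      using res(2)[OF _ v'] KU that by auto
    then have "orbit \<rho>' K' v' \<subseteq> orbit \<rho>C U v'"
      unfolding orbit_def using KU(4) by auto
    ultimately have "orbit \<rho> K v \<subseteq> orbit \<rho>C U v" "orbit \<rho>' K' v' \<subseteq> orbit \<rho>C U v'"
      by blast+
    with Uv show ?thesis by simp
  qed

  have part2: "orbit \<rho> G v \<subseteq> orbit \<rho>C (carrier GC) v \<and> orbit \<rho>' G' v' \<subseteq> orbit \<rho>C (carrier GC) v
       \<longleftrightarrow> orbit \<rho> G v \<inter> orbit \<rho>' G' v' \<noteq> {}" if G'U: "G' = U"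
  proof
    assume "orbit \<rho> G v \<subseteq> orbit \<rho>C (carrier GC) v \<and> orbit \<rho>' G' v' \<subseteq> orbit \<rho>C (carrier GC) v"
    moreover have "v' \<in> orbit \<rho>' G' v'"
      using subgroup.one_closed[OF sub(2)] res(2)[OF _ v', of "\<one>\<^bsub>GC\<^esub>"] \<rho>_one
      unfolding orbit_def by (metis image_eqI)
    ultimately obtain g where g: "g \<in> carrier GC" "v' = \<rho>C g v"
      by (auto simp: orbit_def)
    \<comment> \<open>Read from \<open>v'\<close> to \<open>v\<close>, because \<open>v'\<close> is
      the critical vector and \<open>v\<close> the one fixed by \<sigma>.\<close>
    then have v_eq: "T v = r (inv\<^bsub>GC\<^esub> g) \<star> T v'"
      by (simp add: r_app \<rho>_inv)
    have "critical (T v')"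
    proof (rule B.minimal_imp_critical[OF \<sigma>'(2)])
      fix u assume "u \<in> G'"
      then have "orth (r u)" using U_orth G'U by simp
      then show "norm (T v') \<le> norm (r u \<star> T v')" by (simp add: norm_orth_app)
    qed
    then obtain a u where au: "a \<in> G" "u \<in> U" "r a \<star> T v = r u \<star> T v'"
      using A.orbit_reaches_critical[OF \<sigma>(2) _ inv_closed[OF g(1)] v_eq] by blast
    then have "\<rho>C a v = \<rho>C u v'"
      by (intro T_inj) (simp add: r_app car)
    then have "\<rho> a v = \<rho>' u v'"
      using res au v v' G'U by metis
    then show "orbit \<rho> G v \<inter> orbit \<rho>' G' v' \<noteq> {}"
      using au G'U by (auto simp: orbit_def)
  next
    assume "orbit \<rho> G v \<inter> orbit \<rho>' G' v' \<noteq> {}"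
    then obtain a u where au: "a \<in> G" "u \<in> G'" "\<rho> a v = \<rho>' u v'"
      by (auto simp: orbit_def)
    note c = car(1)[OF au(1)] car(2)[OF au(2)]
    have "\<rho>C a v = \<rho>C u v'"
      using au res v v' by simp
    then have v'_eq: "v' = \<rho>C (inv\<^bsub>GC\<^esub> u) (\<rho>C a v)"
      using \<rho>_inv(1)[OF c(2)] by simp
    have "\<rho> g v = \<rho>C g v" if "g \<in> G" for g
      using res(1)[OF that v] by simp
    then have "orbit \<rho> G v \<subseteq> orbit \<rho>C (carrier GC) v"
      unfolding orbit_def using car(1) by auto
    moreover have "orbit \<rho>' G' v' \<subseteq> orbit \<rho>C (carrier GC) v"
    proof (clarsimp simp: orbit_def)
      fix w assume w: "w \<in> G'"
      have "\<rho>' w v' = \<rho>C w v'" using res(2)[OF w v'] by simp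
      also have "\<dots> = \<rho>C (w \<otimes>\<^bsub>GC\<^esub> (inv\<^bsub>GC\<^esub> u \<otimes>\<^bsub>GC\<^esub> a)) v"
        using v'_eq c car(2)[OF w] by (simp add: R(3))
      finally show "\<rho>' w v' \<in> (\<lambda>g. \<rho>C g v) ` carrier GC"
        using c car(2)[OF w] by simp
    qed
    ultimately show "orbit \<rho> G v \<subseteq> orbit \<rho>C (carrier GC) v \<and> orbit \<rho>' G' v' \<subseteq> orbit \<rho>C (carrier GC) v" ..
  qed
  show ?thesis
    using part1 part2 by blast
qed

end
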